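(* The category $\mathbf{LRS}$ of locally ringed spaces has all inverse limits.
   Context: Inverse limits mean limits of functors from arbitrary small categories. Rings are commutative with $1$. $\mathbf{LRS}$ has as objects locally ringed spaces and as morphisms the morphisms of ringed spaces whose stalk maps $f_x : \mathcal{O}_{Y,f(x)} \to \mathcal{O}_{X,x}$ are local homomorphisms. *)

theory Defs
  imports "HOL-Analysis.Abstract_Topology" "HOL-Algebra.Ideal" "HOL-Algebra.Ring"
begin

section \<open>Ringed spaces\<close>

text \<open>
  A ringed space has points of type \<open>'p\<close> and sections of type \<open>'s\<close>. Only the values of
  \<open>sect\<close> and \<open>restr\<close> at open sets, and of \<open>restr\<close> at actual sections, are meaningful.
  The same element of \<open>'s\<close> may be a section over several open sets. In
  \<open>restr X U V s\<close>, the section \<open>s\<close> over \<open>U\<close> is restricted to \<open>V \<subseteq> U\<close>.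
\<close>

record ('p, 's) ringed_space =
  space :: "'p topology"
  sect :: "'p set \<Rightarrow> 's ring"
  restr :: "'p set \<Rightarrow> 'p set \<Rightarrow> 's \<Rightarrow> 's"

definition presheaf_of_rings :: "('p, 's) ringed_space \<Rightarrow> bool" where
  "presheaf_of_rings X \<longleftrightarrow>
     (\<forall>U. openin (space X) U \<longrightarrow> cring (sect X U)) \<and>
     (\<forall>U V. openin (space X) U \<longrightarrow> openin (space X) V \<longrightarrow> V \<subseteq> U \<longrightarrow>
        restr X U V \<in> ring_hom (sect X U) (sect X V)) \<and>
     (\<forall>U. openin (space X) U \<longrightarrow> (\<forall>s \<in> carrier (sect X U). restr X U U s = s)) \<and>
     (\<forall>U V W. openin (space X) U \<longrightarrow> openin (space X) V \<longrightarrow> openin (space X) W \<longrightarrow>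
        W \<subseteq> V \<longrightarrow> V \<subseteq> U \<longrightarrow>
        (\<forall>s \<in> carrier (sect X U). restr X V W (restr X U V s) = restr X U W s))"

text \<open>
  Covers are sets of open sets rather than indexed families; the empty cover of the empty set
  is included, so that there is exactly one section over the empty set.
\<close>

definition sheaf_condition :: "('p, 's) ringed_space \<Rightarrow> bool" where
  "sheaf_condition X \<longleftrightarrow>
     (\<forall>\<U>. (\<forall>U \<in> \<U>. openin (space X) U) \<longrightarrow>
        (\<forall>f. (\<forall>U \<in> \<U>. f U \<in> carrier (sect X U)) \<longrightarrow>
             (\<forall>U \<in> \<U>. \<forall>V \<in> \<U>. restr X U (U \<inter> V) (f U) = restr X V (U \<inter> V) (f V)) \<longrightarrow>
             (\<exists>!s. s \<in> carrier (sect X (\<Union>\<U>)) \<and> (\<forall>U \<in> \<U>. restr X (\<Union>\<U>) U s = f U))))"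

definition ringed_space :: "('p, 's) ringed_space \<Rightarrow> bool" where
  "ringed_space X \<longleftrightarrow> presheaf_of_rings X \<and> sheaf_condition X"


section \<open>Stalks and local rings\<close>

definition germ :: "('p, 's) ringed_space \<Rightarrow> 'p \<Rightarrow> 'p set \<Rightarrow> 's \<Rightarrow> ('p set \<times> 's) set" where
  "germ X x U s =
     {(V, t). openin (space X) V \<and> x \<in> V \<and> t \<in> carrier (sect X V) \<and>
        (\<exists>W. openin (space X) W \<and> x \<in> W \<and> W \<subseteq> U \<inter> V \<and> restr X U W s = restr X V W t)}"

text \<open>
  In the ring operations below, the sets in the union are all equal, since the germ does not depend
  on the chosen representatives; as for the quotient groups and rings of the library, taking the
  union avoids choosing any.
\<close>

definition stalk :: "('p, 's) ringed_space \<Rightarrow> 'p \<Rightarrow> ('p set \<times> 's) set ring" where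
  "stalk X x =
     \<lparr>carrier = {germ X x U s |U s. openin (space X) U \<and> x \<in> U \<and> s \<in> carrier (sect X U)},
      mult = (\<lambda>a b. \<Union>(U, s) \<in> a. \<Union>(V, t) \<in> b. germ X x (U \<inter> V)
        (restr X U (U \<inter> V) s \<otimes>\<^bsub>sect X (U \<inter> V)\<^esub> restr X V (U \<inter> V) t)),
      one = germ X x (topspace (space X)) \<one>\<^bsub>sect X (topspace (space X))\<^esub>,
      zero = germ X x (topspace (space X)) \<zero>\<^bsub>sect X (topspace (space X))\<^esub>,
      add = (\<lambda>a b. \<Union>(U, s) \<in> a. \<Union>(V, t) \<in> b. germ X x (U \<inter> V)
        (restr X U (U \<inter> V) s \<oplus>\<^bsub>sect X (U \<inter> V)\<^esub> restr X V (U \<inter> V) t))\<rparr>"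

definition local_ring :: "'r ring \<Rightarrow> bool" where
  "local_ring R \<longleftrightarrow> cring R \<and> (\<exists>!\<mm>. maximalideal \<mm> R)"

definition local_ring_hom :: "'r ring \<Rightarrow> 't ring \<Rightarrow> ('r \<Rightarrow> 't) \<Rightarrow> bool" where
  "local_ring_hom R S h \<longleftrightarrow> h \<in> ring_hom R S \<and>
     (\<forall>\<mm> \<nn>. maximalideal \<mm> R \<longrightarrow> maximalideal \<nn> S \<longrightarrow> h ` \<mm> \<subseteq> \<nn>)"

definition locally_ringed_space :: "('p, 's) ringed_space \<Rightarrow> bool" where
  "locally_ringed_space X \<longleftrightarrow>
     ringed_space X \<and> (\<forall>x \<in> topspace (space X). local_ring (stalk X x))"


section \<open>Morphisms\<close>

text \<open>
  A morphism from \<open>X\<close> to \<open>Y\<close> maps points of \<open>X\<close> to points of \<open>Y\<close>, and sections of \<open>Y\<close> over an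
  open set \<open>V\<close> to sections of \<open>X\<close> over the preimage of \<open>V\<close>.
\<close>

record ('p, 's, 'q, 't) rs_map =
  pt_map :: "'p \<Rightarrow> 'q"
  sec_map :: "'q set \<Rightarrow> 't \<Rightarrow> 's"

definition preim ::
    "('p, 's) ringed_space \<Rightarrow> ('p, 's, 'q, 't) rs_map \<Rightarrow> 'q set \<Rightarrow> 'p set" where
  "preim X f V = {x \<in> topspace (space X). pt_map f x \<in> V}"

definition ringed_space_morphism ::
    "('p, 's) ringed_space \<Rightarrow> ('q, 't) ringed_space \<Rightarrow> ('p, 's, 'q, 't) rs_map \<Rightarrow> bool" where
  "ringed_space_morphism X Y f \<longleftrightarrow>
     continuous_map (space X) (space Y) (pt_map f) \<and>
     (\<forall>V. openin (space Y) V \<longrightarrow>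
        sec_map f V \<in> ring_hom (sect Y V) (sect X (preim X f V))) \<and>
     (\<forall>V W. openin (space Y) V \<longrightarrow> openin (space Y) W \<longrightarrow> W \<subseteq> V \<longrightarrow>
        (\<forall>s \<in> carrier (sect Y V).
           sec_map f W (restr Y V W s) = restr X (preim X f V) (preim X f W) (sec_map f V s)))"

definition stalk_map ::
    "('p, 's) ringed_space \<Rightarrow> ('p, 's, 'q, 't) rs_map \<Rightarrow> 'p \<Rightarrow> ('q set \<times> 't) set \<Rightarrow> ('p set \<times> 's) set"
  where
  "stalk_map X f x a = (\<Union>(V, s) \<in> a. germ X x (preim X f V) (sec_map f V s))"

definition lrs_morphism ::
    "('p, 's) ringed_space \<Rightarrow> ('q, 't) ringed_space \<Rightarrow> ('p, 's, 'q, 't) rs_map \<Rightarrow> bool" where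
  "lrs_morphism X Y f \<longleftrightarrow>
     locally_ringed_space X \<and> locally_ringed_space Y \<and> ringed_space_morphism X Y f \<and>
     (\<forall>x \<in> topspace (space X).
        local_ring_hom (stalk Y (pt_map f x)) (stalk X x) (stalk_map X f x))"

text \<open>
  Morphisms are identified when they agree on all points and all sections, so that the junk values
  of the underlying total functions play no role.
\<close>

definition morphism_eq ::
    "('p, 's) ringed_space \<Rightarrow> ('q, 't) ringed_space \<Rightarrow>
     ('p, 's, 'q, 't) rs_map \<Rightarrow> ('p, 's, 'q, 't) rs_map \<Rightarrow> bool" where
  "morphism_eq X Y f g \<longleftrightarrow>
     (\<forall>x \<in> topspace (space X). pt_map f x = pt_map g x) \<and>
     (\<forall>V. openin (space Y) V \<longrightarrow> (\<forall>s \<in> carrier (sect Y V). sec_map f V s = sec_map g V s))"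

definition id_morphism :: "('p, 's, 'p, 's) rs_map" where
  "id_morphism = \<lparr>pt_map = (\<lambda>x. x), sec_map = (\<lambda>V s. s)\<rparr>"

text \<open>The composite of \<open>f\<close> from \<open>X\<close> to \<open>Y\<close> with \<open>g\<close> from \<open>Y\<close> to \<open>Z\<close>.\<close>

definition comp_morphism ::
    "('q, 't) ringed_space \<Rightarrow> ('q, 't, 'r, 'u) rs_map \<Rightarrow> ('p, 's, 'q, 't) rs_map \<Rightarrow>
     ('p, 's, 'r, 'u) rs_map" where
  "comp_morphism Y g f =
     \<lparr>pt_map = (\<lambda>x. pt_map g (pt_map f x)),
      sec_map = (\<lambda>W s. sec_map f (preim Y g W) (sec_map g W s))\<rparr>"


section \<open>Diagrams and limits\<close>

record ('i, 'j) cat =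
  Ob :: "'i set"
  Ar :: "'j set"
  Dom :: "'j \<Rightarrow> 'i"
  Cod :: "'j \<Rightarrow> 'i"
  Ident :: "'i \<Rightarrow> 'j"
  Comp :: "'j \<Rightarrow> 'j \<Rightarrow> 'j"

definition small_category :: "('i, 'j) cat \<Rightarrow> bool" where
  "small_category J \<longleftrightarrow>
     (\<forall>a \<in> Ar J. Dom J a \<in> Ob J \<and> Cod J a \<in> Ob J) \<and>
     (\<forall>i \<in> Ob J. Ident J i \<in> Ar J \<and> Dom J (Ident J i) = i \<and> Cod J (Ident J i) = i) \<and>
     (\<forall>a \<in> Ar J. \<forall>b \<in> Ar J. Dom J b = Cod J a \<longrightarrow>
        Comp J b a \<in> Ar J \<and> Dom J (Comp J b a) = Dom J a \<and> Cod J (Comp J b a) = Cod J b) \<and>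
     (\<forall>a \<in> Ar J. Comp J a (Ident J (Dom J a)) = a \<and> Comp J (Ident J (Cod J a)) a = a) \<and>
     (\<forall>a \<in> Ar J. \<forall>b \<in> Ar J. \<forall>c \<in> Ar J. Dom J b = Cod J a \<longrightarrow> Dom J c = Cod J b \<longrightarrow>
        Comp J c (Comp J b a) = Comp J (Comp J c b) a)"

text \<open>Functors from \<open>J\<close> to locally ringed spaces, with object part \<open>D\<close> and arrow part \<open>\<delta>\<close>.\<close>

definition lrs_functor ::
    "('i, 'j) cat \<Rightarrow> ('i \<Rightarrow> ('p, 's) ringed_space) \<Rightarrow> ('j \<Rightarrow> ('p, 's, 'p, 's) rs_map) \<Rightarrow> bool" where
  "lrs_functor J D \<delta> \<longleftrightarrow>
     (\<forall>i \<in> Ob J. locally_ringed_space (D i)) \<and>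
     (\<forall>a \<in> Ar J. lrs_morphism (D (Dom J a)) (D (Cod J a)) (\<delta> a)) \<and>
     (\<forall>i \<in> Ob J. morphism_eq (D i) (D i) (\<delta> (Ident J i)) id_morphism) \<and>
     (\<forall>a \<in> Ar J. \<forall>b \<in> Ar J. Dom J b = Cod J a \<longrightarrow>
        morphism_eq (D (Dom J a)) (D (Cod J b)) (\<delta> (Comp J b a))
          (comp_morphism (D (Cod J a)) (\<delta> b) (\<delta> a)))"

definition lrs_cone ::
    "('i, 'j) cat \<Rightarrow> ('i \<Rightarrow> ('p, 's) ringed_space) \<Rightarrow> ('j \<Rightarrow> ('p, 's, 'p, 's) rs_map) \<Rightarrow>
     ('q, 't) ringed_space \<Rightarrow> ('i \<Rightarrow> ('q, 't, 'p, 's) rs_map) \<Rightarrow> bool" where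
  "lrs_cone J D \<delta> X \<xi> \<longleftrightarrow>
     locally_ringed_space X \<and>
     (\<forall>i \<in> Ob J. lrs_morphism X (D i) (\<xi> i)) \<and>
     (\<forall>a \<in> Ar J. morphism_eq X (D (Cod J a))
        (comp_morphism (D (Dom J a)) (\<delta> a) (\<xi> (Dom J a))) (\<xi> (Cod J a)))"

text \<open>
  HOL cannot quantify over types inside a formula, so the types of points and of sections of the
  locally ringed spaces against which the universal property is tested are a parameter.
\<close>

definition lrs_limit ::
    "('q \<times> 't) itself \<Rightarrow> ('i, 'j) cat \<Rightarrow> ('i \<Rightarrow> ('p, 's) ringed_space) \<Rightarrow>
     ('j \<Rightarrow> ('p, 's, 'p, 's) rs_map) \<Rightarrow>
     ('l, 'm) ringed_space \<Rightarrow> ('i \<Rightarrow> ('l, 'm, 'p, 's) rs_map) \<Rightarrow> bool" where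
  "lrs_limit _ J D \<delta> L \<pi> \<longleftrightarrow>
     lrs_cone J D \<delta> L \<pi> \<and>
     (\<forall>(X :: ('q, 't) ringed_space) \<xi>. lrs_cone J D \<delta> X \<xi> \<longrightarrow>
        (\<exists>u. lrs_morphism X L u \<and>
             (\<forall>i \<in> Ob J. morphism_eq X (D i) (comp_morphism L (\<pi> i) u) (\<xi> i)) \<and>
             (\<forall>v. lrs_morphism X L v \<and>
                  (\<forall>i \<in> Ob J. morphism_eq X (D i) (comp_morphism L (\<pi> i) v) (\<xi> i)) \<longrightarrow>
                  morphism_eq X L u v)))"


section \<open>Types large enough to carry a limit\<close>

text \<open>
  The limit of a diagram cannot in general live on the types of the diagram. The types below only
  provide enough room: a point of the limit amounts to a compatible family of points
  together with a prime ideal of the colimit of their stalks, and a section to a function sending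
  points to fractions. Elements of the colimit are represented by ring expressions
  in triples (index, open set, section). No such structure is imposed on the limit.
\<close>

datatype 'g ring_expr =
    Gen 'g
  | Zero
  | One
  | Neg "'g ring_expr"
  | Add "'g ring_expr" "'g ring_expr"
  | Mul "'g ring_expr" "'g ring_expr"

type_synonym ('i, 'p, 's) colim_expr = "('i \<times> 'p set \<times> 's) ring_expr"

type_synonym ('i, 'p, 's) limit_point = "('i \<Rightarrow> 'p) \<times> ('i, 'p, 's) colim_expr set"

type_synonym ('i, 'p, 's) limit_section =
  "('i, 'p, 's) limit_point \<Rightarrow> (('i, 'p, 's) colim_expr \<times> ('i, 'p, 's) colim_expr) set"

end

(*
The limit of the underlying diagram of ringed spaces has as points the compatible families
x = (x_i), and its stalk at x is the colimit of the local rings of the D i at x_i. This colimit need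
not be local, so each x is replaced by all pairs (x, P), where P is a prime ideal of the colimit
lying over every maximal ideal; the stalk becomes the localization at P, and sections are the
functions that are locally given by one fraction. A cone over the diagram sends a point p to its
family of images together with the ideal of all elements of the colimit that become nonunits in the
local ring at p. Locality forces this choice of ideal, and the values of sections are forced because
every element of a stalk of the limit is a fraction of sections pulled back from the D i.
*)
theory Submission
  imports Defs
begin

section \<open>Local rings\<close>

text \<open>Since the diagram need not be filtered, the colimit of the local rings has in general no
  description by germs; it is presented by generators and relations. Colimit and localization are
  presented in one step: an expression may contain -1/e for any expression \<open>e\<close> that is
  a unit at the point, and equality is the congruence generated by the ring laws, these inverses and
  the structure of the \<open>D i\<close>. The gain is that expressions are mere syntax, independent
  of the point. One expression can be read at all points at which its generators are defined and its
  denominators are units, so that being locally given by one fraction means being locally given by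
  one expression; and it can be evaluated in the stalks of the tip of a cone as well. An expression
  and a derivation of an equality involve only finitely many generators and denominators, so
  definedness and equality persist near a point; the topology, the stalks and the continuity of the
  induced map rest on this. A point records the complement of its prime ideal rather than the ideal
  itself, because this set decides which expressions are defined.\<close>

lemma cring_lawsI:
  fixes R (structure)
  assumes "\<And>a b. \<lbrakk>a \<in> carrier R; b \<in> carrier R\<rbrakk> \<Longrightarrow> a \<oplus> b \<in> carrier R"
    and "\<zero> \<in> carrier R"
    and "\<And>a b c. \<lbrakk>a \<in> carrier R; b \<in> carrier R; c \<in> carrier R\<rbrakk> \<Longrightarrow> (a \<oplus> b) \<oplus> c = a \<oplus> (b \<oplus> c)"
    and "\<And>a b. \<lbrakk>a \<in> carrier R; b \<in> carrier R\<rbrakk> \<Longrightarrow> a \<oplus> b = b \<oplus> a"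
    and "\<And>a. a \<in> carrier R \<Longrightarrow> \<zero> \<oplus> a = a"
    and "\<And>a. a \<in> carrier R \<Longrightarrow> \<exists>b \<in> carrier R. b \<oplus> a = \<zero>"
    and "\<And>a b. \<lbrakk>a \<in> carrier R; b \<in> carrier R\<rbrakk> \<Longrightarrow> a \<otimes> b \<in> carrier R"
    and "\<one> \<in> carrier R"
    and "\<And>a b c. \<lbrakk>a \<in> carrier R; b \<in> carrier R; c \<in> carrier R\<rbrakk> \<Longrightarrow> (a \<otimes> b) \<otimes> c = a \<otimes> (b \<otimes> c)"
    and "\<And>a b. \<lbrakk>a \<in> carrier R; b \<in> carrier R\<rbrakk> \<Longrightarrow> a \<otimes> b = b \<otimes> a"
    and "\<And>a. a \<in> carrier R \<Longrightarrow> \<one> \<otimes> a = a"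
    and "\<And>a b c. \<lbrakk>a \<in> carrier R; b \<in> carrier R; c \<in> carrier R\<rbrakk> \<Longrightarrow> (a \<oplus> b) \<otimes> c = a \<otimes> c \<oplus> b \<otimes> c"
  shows "cring R"
proof (rule cringI)
  show "abelian_group R" by (intro abelian_groupI; fact assms)
  show "comm_monoid R" by (intro comm_monoidI; fact assms)
qed (fact assms)

lemma (in cring) Units_iff: "u \<in> Units R \<longleftrightarrow> u \<in> carrier R \<and> (\<exists>v \<in> carrier R. u \<otimes> v = \<one>)"
  unfolding Units_def using m_comm by auto

lemma (in cring) Units_mult_iff:
  assumes "a \<in> carrier R" "b \<in> carrier R"
  shows "a \<otimes> b \<in> Units R \<longleftrightarrow> a \<in> Units R \<and> b \<in> Units R"
proof
  assume "a \<otimes> b \<in> Units R"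
  then obtain c where c: "c \<in> carrier R" "a \<otimes> b \<otimes> c = \<one>" using Units_iff by auto
  then have "a \<otimes> (b \<otimes> c) = \<one>" "b \<otimes> (a \<otimes> c) = \<one>" using assms by (simp_all add: m_ac)
  then show "a \<in> Units R \<and> b \<in> Units R" using assms c(1) Units_iff m_closed by blast
qed auto

lemma ring_hom_Units:
  assumes "cring R" "cring S" "h \<in> ring_hom R S" "a \<in> Units R"
  shows "h a \<in> Units S"
proof -
  obtain b where b: "b \<in> carrier R" "a \<otimes>\<^bsub>R\<^esub> b = \<one>\<^bsub>R\<^esub>" and a: "a \<in> carrier R"
    using assms(4) cring.Units_iff[OF assms(1)] by auto
  show ?thesis
    unfolding cring.Units_iff[OF assms(2)]
    using ring_hom_mult[OF assms(3) a b(1)] ring_hom_one[OF assms(3)] b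
      ring_hom_closed[OF assms(3) a] ring_hom_closed[OF assms(3) b(1)] by auto
qed

text \<open>Zorn's lemma for the ideals that contain \<open>a\<close> and avoid
  \<open>\<one>\<close>, the principal ideal of \<open>a\<close> being one of them. A maximal member
  is a maximal ideal, because every ideal above it still contains \<open>a\<close>.\<close>

lemma (in cring) nonunit_in_maximalideal:
  assumes a: "a \<in> carrier R" "a \<notin> Units R"
  shows "\<exists>\<mm>. maximalideal \<mm> R \<and> a \<in> \<mm>"
proof -
  define A where "A = {I. ideal I R \<and> a \<in> I \<and> \<one> \<notin> I}"
  have "\<one> \<notin> PIdl a"
  proof
    assume "\<one> \<in> PIdl a"
    then obtain x where "x \<in> carrier R" "\<one> = x \<otimes> a" unfolding cgenideal_def by blast
    then show False using a Units_iff m_comm[OF a(1)] by metis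
  qed
  then have P: "PIdl a \<in> A"
    unfolding A_def using cgenideal_ideal[OF a(1)] cgenideal_self[OF a(1)] by blast
  have "\<Union>C \<in> A" if C: "C \<noteq> {}" "subset.chain A C" for C
  proof -
    have CA: "C \<subseteq> A" and tot: "\<And>I K. I \<in> C \<Longrightarrow> K \<in> C \<Longrightarrow> I \<subseteq> K \<or> K \<subseteq> I"
      using C(2) unfolding subset.chain_def by auto
    have idl: "\<And>I. I \<in> C \<Longrightarrow> ideal I R" using CA unfolding A_def by auto
    have sub: "I \<subseteq> carrier R" if "I \<in> C" for I
      using ideal.Icarr[OF idl[OF that]] by (rule subsetI)
    have "ideal (\<Union>C) R"
    proof (rule idealI[OF ring_axioms])
      show "subgroup (\<Union>C) (add_monoid R)"
      proof (rule add.subgroupI)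
        show "\<Union>C \<subseteq> carrier R" using sub by auto
        show "\<Union>C \<noteq> {}" using C(1) CA A_def by auto
        show "\<ominus> b \<in> \<Union>C" if "b \<in> \<Union>C" for b
        proof -
          obtain I where I: "I \<in> C" "b \<in> I" using \<open>b \<in> \<Union>C\<close> by auto
          interpret I: ideal I R using idl[OF I(1)] .
          show ?thesis using I by blast
        qed
        show "b \<oplus> c \<in> \<Union>C" if bc: "b \<in> \<Union>C" "c \<in> \<Union>C" for b c
        proof -
          obtain I where I: "I \<in> C" "b \<in> I" "c \<in> I" using bc tot by blast
          interpret I: ideal I R using idl[OF I(1)] .
          show ?thesis using I I.a_closed by blast
        qed
      qed
    next
      fix b c assume "b \<in> \<Union>C" and c: "c \<in> carrier R"
      then obtain I where I: "I \<in> C" "b \<in> I" by auto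
      interpret I: ideal I R using idl[OF I(1)] .
      show "c \<otimes> b \<in> \<Union>C" "b \<otimes> c \<in> \<Union>C" using I c I.I_l_closed I.I_r_closed by blast+
    qed
    then show ?thesis using C(1) CA unfolding A_def by auto
  qed
  then obtain M where M: "M \<in> A" and max: "\<And>I. I \<in> A \<Longrightarrow> M \<subseteq> I \<Longrightarrow> I = M"
    using subset_Zorn_nonempty[of A] P by blast
  have "maximalideal M R"
  proof (rule maximalidealI)
    show "carrier R \<noteq> M" using M A_def by auto
    show "I = M \<or> I = carrier R" if "ideal I R" "M \<subseteq> I" "I \<subseteq> carrier R" for I
      using that M max[of I] ideal.one_imp_carrier[OF that(1)] unfolding A_def by blast
  qed (use M A_def in auto)
  then show ?thesis using M A_def by auto
qed

lemma (in cring) maximalideal_nonunit: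
  assumes "maximalideal \<mm> R" "a \<in> \<mm>" shows "a \<notin> Units R"
proof
  interpret maximalideal \<mm> R by fact
  assume "a \<in> Units R"
  then obtain b where "b \<in> carrier R" "a \<otimes> b = \<one>" using Units_iff by auto
  then show False using I_r_closed assms(2) one_imp_carrier I_notcarr by metis
qed

text \<open>A unique maximal ideal has to be the set of nonunits, and the nonunits of a nonzero
  commutative ring form an ideal as soon as they are closed under addition. In this form locality is
  a condition on elements, which carries over to expressions.\<close>

lemma local_ring_iff:
  fixes R (structure)
  shows "local_ring R \<longleftrightarrow> cring R \<and> \<one> \<noteq> \<zero> \<and>
    (\<forall>a \<in> carrier R. \<forall>b \<in> carrier R. a \<oplus> b \<in> Units R \<longrightarrow> a \<in> Units R \<or> b \<in> Units R)"
    (is "_ \<longleftrightarrow> _ \<and> _ \<and> ?nonunits")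
proof
  assume "local_ring R"
  then obtain \<mm> where R: "cring R" and \<mm>: "maximalideal \<mm> R"
    and uniq: "\<And>\<nn>. maximalideal \<nn> R \<Longrightarrow> \<nn> = \<mm>"
    unfolding local_ring_def by blast
  interpret cring R by fact
  interpret maximalideal \<mm> R by fact
  have "\<one> \<noteq> \<zero>" using I_notcarr one_imp_carrier additive_subgroup.zero_closed[OF is_additive_subgroup] by metis
  moreover have ?nonunits
  proof (intro ballI impI)
    fix a b assume ab: "a \<in> carrier R" "b \<in> carrier R" "a \<oplus> b \<in> Units R"
    show "a \<in> Units R \<or> b \<in> Units R"
    proof (rule ccontr)
      assume "\<not> (a \<in> Units R \<or> b \<in> Units R)"
      then have "a \<in> \<mm>" "b \<in> \<mm>" using nonunit_in_maximalideal uniq ab by metis+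
      then have "a \<oplus> b \<in> \<mm>" by (rule additive_subgroup.a_closed[OF is_additive_subgroup])
      then show False using maximalideal_nonunit[OF \<mm>] ab(3) by simp
    qed
  qed
  ultimately show "cring R \<and> \<one> \<noteq> \<zero> \<and> ?nonunits" using R by blast
next
  assume A: "cring R \<and> \<one> \<noteq> \<zero> \<and> ?nonunits"
  then interpret cring R by blast
  define M where "M = carrier R - Units R"
  have "ideal M R"
  proof (rule idealI[OF ring_axioms])
    show "subgroup M (add_monoid R)"
    proof (rule add.subgroupI)
      show "M \<noteq> {}"
      proof -
        have "\<zero> \<notin> Units R" using A Units_iff[of \<zero>] by (metis l_null)
        then show ?thesis unfolding M_def by blast
      qed
      show "\<ominus> b \<in> M" if "b \<in> M" for b
      proof -
        have "\<ominus> b = \<ominus> \<one> \<otimes> b" using that M_def by (simp add: l_minus)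
        then show ?thesis using that Units_mult_iff[of "\<ominus> \<one>" b] unfolding M_def by auto
      qed
      show "b \<oplus> c \<in> M" if "b \<in> M" "c \<in> M" for b c
        using A that unfolding M_def by (meson DiffD1 DiffD2 DiffI a_closed)
    qed (simp add: M_def)
  qed (simp_all add: M_def Units_mult_iff)
  moreover have "\<one> \<notin> M" by (simp add: M_def)
  moreover have proper: "I \<subseteq> M" if "ideal I R" "I \<noteq> carrier R" for I
  proof
    fix a assume a: "a \<in> I"
    interpret I: ideal I R by fact
    have "a \<notin> Units R"
      using that(2) a I.I_r_closed I.one_imp_carrier by (metis Units_iff)
    then show "a \<in> M" using a I.Icarr M_def by auto
  qed
  ultimately have "maximalideal M R"
  proof (intro maximalidealI)
    show "carrier R \<noteq> M" using \<open>\<one> \<notin> M\<close> one_closed by metis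
    show "I = M \<or> I = carrier R" if "ideal I R" "M \<subseteq> I" "I \<subseteq> carrier R" for I
      using proper that by (metis subset_antisym)
  qed
  moreover have "\<nn> = M" if "maximalideal \<nn> R" for \<nn>
  proof -
    interpret n: maximalideal \<nn> R by fact
    have "\<nn> \<subseteq> M" using proper[OF n.is_ideal] n.I_notcarr by metis
    then show ?thesis
      using n.I_maximal[OF \<open>ideal M R\<close>] \<open>\<one> \<notin> M\<close> M_def by (metis Diff_subset one_closed)
  qed
  ultimately show "local_ring R" unfolding local_ring_def using is_cring by metis
qed

text \<open>The maximal ideals consist of the nonunits, so that mapping one into the other means
  that nonunits go to nonunits. Locality of a homomorphism is used below only in this form.\<close>

lemma local_ring_hom_iff:
  assumes "local_ring R" "local_ring S"
  shows "local_ring_hom R S h \<longleftrightarrow>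
    h \<in> ring_hom R S \<and> (\<forall>a \<in> carrier R. h a \<in> Units S \<longrightarrow> a \<in> Units R)"
proof -
  interpret R: cring R using assms(1) by (simp add: local_ring_def)
  interpret S: cring S using assms(2) by (simp add: local_ring_def)
  obtain \<nn> where \<nn>: "maximalideal \<nn> S" "\<And>I. maximalideal I S \<Longrightarrow> I = \<nn>"
    using assms(2) unfolding local_ring_def by (metis (no_types))
  show ?thesis
  proof
    assume h: "local_ring_hom R S h"
    have "a \<in> Units R" if a: "a \<in> carrier R" "h a \<in> Units S" for a
    proof (rule ccontr)
      assume "a \<notin> Units R"
      then obtain \<mm> where "maximalideal \<mm> R" "a \<in> \<mm>" using R.nonunit_in_maximalideal a(1) by metis
      then have "h a \<in> \<nn>" using h \<nn>(1) unfolding local_ring_hom_def by (meson image_subset_iff)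
      then show False using S.maximalideal_nonunit[OF \<nn>(1)] a(2) by simp
    qed
    then show "h \<in> ring_hom R S \<and> (\<forall>a \<in> carrier R. h a \<in> Units S \<longrightarrow> a \<in> Units R)"
      using h unfolding local_ring_hom_def by simp
  next
    assume h: "h \<in> ring_hom R S \<and> (\<forall>a \<in> carrier R. h a \<in> Units S \<longrightarrow> a \<in> Units R)"
    show "local_ring_hom R S h"
      unfolding local_ring_hom_def
    proof (intro conjI allI impI subsetI)
      fix \<mm> I b assume \<mm>: "maximalideal \<mm> R" and I: "maximalideal I S" and "b \<in> h ` \<mm>"
      then obtain a where a: "a \<in> \<mm>" "b = h a" by auto
      have "a \<in> carrier R" using \<mm> a(1) ideal.Icarr maximalideal.axioms(1) by metis
      moreover have "a \<notin> Units R" using R.maximalideal_nonunit[OF \<mm> a(1)] .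
      ultimately have "b \<in> carrier S" "b \<notin> Units S"
        using h a(2) ring_hom_closed by metis+
      then show "b \<in> I" using S.nonunit_in_maximalideal \<nn>(2) I by metis
    qed (use h in simp)
  qed
qed

section \<open>Sections and stalks\<close>

lemma
  assumes "presheaf_of_rings X"
  shows cring_sect: "openin (space X) U \<Longrightarrow> cring (sect X U)"
    and restr_hom: "\<lbrakk>openin (space X) U; openin (space X) V; V \<subseteq> U\<rbrakk> \<Longrightarrow>
          restr X U V \<in> ring_hom (sect X U) (sect X V)"
    and restr_id: "\<lbrakk>openin (space X) U; s \<in> carrier (sect X U)\<rbrakk> \<Longrightarrow> restr X U U s = s"
    and restr_restr: "\<lbrakk>openin (space X) U; openin (space X) V; openin (space X) W; W \<subseteq> V; V \<subseteq> U;
          s \<in> carrier (sect X U)\<rbrakk> \<Longrightarrow> restr X V W (restr X U V s) = restr X U W s"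
  using assms by (simp_all add: presheaf_of_rings_def)

lemma restr_closed:
  "\<lbrakk>presheaf_of_rings X; openin (space X) U; openin (space X) V; V \<subseteq> U; s \<in> carrier (sect X U)\<rbrakk>
     \<Longrightarrow> restr X U V s \<in> carrier (sect X V)"
  using restr_hom ring_hom_closed by metis

text \<open>A germ is the set of all pairs that agree with the given one near \<open>x\<close>.
  Equality of two such sets reduces to agreement of the representatives because agreement near
  \<open>x\<close> is transitive: the intersection of the two neighbourhoods is the witness.\<close>

lemma germ_eq_iff:
  assumes X: "presheaf_of_rings X"
    and U: "openin (space X) U" "x \<in> U" "s \<in> carrier (sect X U)"
    and V: "openin (space X) V" "x \<in> V" "t \<in> carrier (sect X V)"
  shows "germ X x U s = germ X x V t \<longleftrightarrow>
    (\<exists>W. openin (space X) W \<and> x \<in> W \<and> W \<subseteq> U \<inter> V \<and> restr X U W s = restr X V W t)"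
proof
  assume "germ X x U s = germ X x V t"
  moreover have "(V, t) \<in> germ X x V t"
    unfolding germ_def using V by (auto intro!: exI[of _ V])
  ultimately have "(V, t) \<in> germ X x U s" by simp
  then show "\<exists>W. openin (space X) W \<and> x \<in> W \<and> W \<subseteq> U \<inter> V \<and> restr X U W s = restr X V W t"
    unfolding germ_def by auto
next
  assume "\<exists>W. openin (space X) W \<and> x \<in> W \<and> W \<subseteq> U \<inter> V \<and> restr X U W s = restr X V W t"
  then obtain W where W: "openin (space X) W" "x \<in> W" "W \<subseteq> U \<inter> V" "restr X U W s = restr X V W t"
    by blast
  have "(\<exists>N. openin (space X) N \<and> x \<in> N \<and> N \<subseteq> U \<inter> V' \<and> restr X U N s = restr X V' N t') \<longleftrightarrow>
    (\<exists>N. openin (space X) N \<and> x \<in> N \<and> N \<subseteq> V \<inter> V' \<and> restr X V N t = restr X V' N t')"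
    (is "?L \<longleftrightarrow> ?R")
    if V': "openin (space X) V'" "t' \<in> carrier (sect X V')" for V' t'
  proof -
    have restr: "restr X A (W \<inter> N) a = restr X W (W \<inter> N) (restr X A W a)"
      "restr X A (W \<inter> N) a = restr X N (W \<inter> N) (restr X A N a)"
      if "openin (space X) N" "openin (space X) A" "W \<subseteq> A" "N \<subseteq> A" "a \<in> carrier (sect X A)" for A N a
      using that W(1) restr_restr[OF X] openin_Int by (metis inf_le1, metis inf_le2)
    have restr': "restr X V' (W \<inter> N) t' = restr X N (W \<inter> N) (restr X V' N t')"
      if "openin (space X) N" "N \<subseteq> V'" for N
      using that W(1) V' restr_restr[OF X] openin_Int by (metis inf_le2)
    show ?thesis
    proof
      assume ?L
      then obtain N where N: "openin (space X) N" "x \<in> N" "N \<subseteq> U \<inter> V'" "restr X U N s = restr X V' N t'"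
        by blast
      have "restr X V (W \<inter> N) t = restr X W (W \<inter> N) (restr X V W t)"
        using restr_restr[OF X V(1) W(1), of "W \<inter> N" t] W N V by (simp add: openin_Int)
      also have "\<dots> = restr X V' (W \<inter> N) t'"
        using restr(1)[of N U s] restr(2)[of N U s] restr'[of N] U W N by auto
      finally show ?R using W N by (intro exI[of _ "W \<inter> N"]) auto
    next
      assume ?R
      then obtain N where N: "openin (space X) N" "x \<in> N" "N \<subseteq> V \<inter> V'" "restr X V N t = restr X V' N t'"
        by blast
      have "restr X U (W \<inter> N) s = restr X W (W \<inter> N) (restr X U W s)"
        using restr_restr[OF X U(1) W(1), of "W \<inter> N" s] W N U by (simp add: openin_Int)
      also have "\<dots> = restr X V' (W \<inter> N) t'"
        using restr(1)[of N V t] restr(2)[of N V t] restr'[of N] V W N by auto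
      finally show ?L using W N by (intro exI[of _ "W \<inter> N"]) auto
    qed
  qed
  then show "germ X x U s = germ X x V t" unfolding germ_def by auto
qed

lemma germ_restr:
  assumes X: "presheaf_of_rings X" and "openin (space X) U" "openin (space X) V" "V \<subseteq> U" "x \<in> V"
    "s \<in> carrier (sect X U)"
  shows "germ X x V (restr X U V s) = germ X x U s"
proof -
  have "x \<in> U" using assms by blast
  moreover have "restr X V V (restr X U V s) = restr X U V s"
    using assms restr_id restr_closed by metis
  ultimately show ?thesis
    using assms restr_closed[OF assms(1-4)] by (subst germ_eq_iff[OF X]) auto
qed

lemma stalk_carrier:
  "carrier (stalk X x) = {germ X x U s |U s. openin (space X) U \<and> x \<in> U \<and> s \<in> carrier (sect X U)}"
  by (simp add: stalk_def)

lemma germ_closed: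
  "\<lbrakk>openin (space X) U; x \<in> U; s \<in> carrier (sect X U)\<rbrakk> \<Longrightarrow> germ X x U s \<in> carrier (stalk X x)"
  by (auto simp: stalk_carrier)

text \<open>A ring law involves at most three elements, so representing three germs over one open
  set reduces every law of the stalk to the same law in a ring of sections.\<close>

lemma stalk_common_reps:
  assumes X: "presheaf_of_rings X" and "a \<in> carrier (stalk X x)" "b \<in> carrier (stalk X x)"
    "c \<in> carrier (stalk X x)"
  obtains U s t r where "openin (space X) U" "x \<in> U" "s \<in> carrier (sect X U)" "t \<in> carrier (sect X U)"
    "r \<in> carrier (sect X U)" "a = germ X x U s" "b = germ X x U t" "c = germ X x U r"
proof -
  obtain A s B t C r where
    A: "openin (space X) A" "x \<in> A" "s \<in> carrier (sect X A)" "a = germ X x A s" and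
    B: "openin (space X) B" "x \<in> B" "t \<in> carrier (sect X B)" "b = germ X x B t" and
    C: "openin (space X) C" "x \<in> C" "r \<in> carrier (sect X C)" "c = germ X x C r"
    using assms unfolding stalk_carrier by auto
  let ?U = "A \<inter> B \<inter> C"
  have U: "openin (space X) ?U" "x \<in> ?U" using A B C by auto
  show thesis
  proof (rule that[OF U])
    show "a = germ X x ?U (restr X A ?U s)" "b = germ X x ?U (restr X B ?U t)"
      "c = germ X x ?U (restr X C ?U r)"
      using A B C U germ_restr[OF X] by (metis Int_lower1 Int_lower2 le_infI1)+
  qed (use restr_closed[OF X] A B C U in auto)
qed

text \<open>Treats multiplication and addition of the stalk at once, with \<open>f\<close> the
  operation on sections. Compatibility with restriction makes all members of the union equal, and
  the representatives \<open>s\<close> and \<open>t\<close> themselves show that it is not an empty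
  union.\<close>

lemma stalk_op:
  assumes X: "presheaf_of_rings X"
    and closed: "\<And>W a b. \<lbrakk>openin (space X) W; a \<in> carrier (sect X W); b \<in> carrier (sect X W)\<rbrakk> \<Longrightarrow>
      f W a b \<in> carrier (sect X W)"
    and restr: "\<And>V W a b. \<lbrakk>openin (space X) V; openin (space X) W; W \<subseteq> V; a \<in> carrier (sect X V);
      b \<in> carrier (sect X V)\<rbrakk> \<Longrightarrow> restr X V W (f V a b) = f W (restr X V W a) (restr X V W b)"
    and U: "openin (space X) U" "x \<in> U" "s \<in> carrier (sect X U)" "t \<in> carrier (sect X U)"
  shows "(\<Union>(V, s') \<in> germ X x U s. \<Union>(V', t') \<in> germ X x U t.
    germ X x (V \<inter> V') (f (V \<inter> V') (restr X V (V \<inter> V') s') (restr X V' (V \<inter> V') t')))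
    = germ X x U (f U s t)"
proof -
  have eq: "germ X x (V \<inter> V') (f (V \<inter> V') (restr X V (V \<inter> V') s') (restr X V' (V \<inter> V') t'))
    = germ X x U (f U s t)"
    if "(V, s') \<in> germ X x U s" "(V', t') \<in> germ X x U t" for V s' V' t'
  proof -
    obtain W where V: "openin (space X) V" "x \<in> V" "s' \<in> carrier (sect X V)" and
      W: "openin (space X) W" "x \<in> W" "W \<subseteq> U \<inter> V" "restr X U W s = restr X V W s'"
      using \<open>(V, s') \<in> germ X x U s\<close> unfolding germ_def by auto
    obtain W' where V': "openin (space X) V'" "x \<in> V'" "t' \<in> carrier (sect X V')" and
      W': "openin (space X) W'" "x \<in> W'" "W' \<subseteq> U \<inter> V'" "restr X U W' t = restr X V' W' t'"
      using \<open>(V', t') \<in> germ X x U t\<close> unfolding germ_def by auto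
    let ?W = "W \<inter> W'" and ?V = "V \<inter> V'"
    have o: "openin (space X) ?W" "openin (space X) ?V" using W W' V V' by auto
    have c: "restr X V ?V s' \<in> carrier (sect X ?V)" "restr X V' ?V t' \<in> carrier (sect X ?V)"
      using restr_closed[OF X] V V' o by auto
    have "restr X ?V ?W (f ?V (restr X V ?V s') (restr X V' ?V t')) =
      f ?W (restr X V ?W s') (restr X V' ?W t')"
    proof -
      have "?W \<subseteq> ?V" using W W' by auto
      then show ?thesis
        using restr[OF o(2) o(1) _ c] restr_restr[OF X V(1) o(2) o(1) _ _ V(3)]
          restr_restr[OF X V'(1) o(2) o(1) _ _ V'(3)] by simp
    qed
    also have "\<dots> = f ?W (restr X U ?W s) (restr X U ?W t)"
    proof -
      have "restr X V ?W s' = restr X U ?W s"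
        using restr_restr[OF X V(1) W(1) o(1) _ _ V(3)] restr_restr[OF X U(1) W(1) o(1) _ _ U(3)]
          W by auto
      moreover have "restr X V' ?W t' = restr X U ?W t"
        using restr_restr[OF X V'(1) W'(1) o(1) _ _ V'(3)] restr_restr[OF X U(1) W'(1) o(1) _ _ U(4)]
          W' by auto
      ultimately show ?thesis by simp
    qed
    also have "\<dots> = restr X U ?W (f U s t)"
      using restr[OF U(1) o(1) _ U(3,4)] W(3) by (simp add: le_infI1)
    finally show ?thesis
      using germ_eq_iff[OF X o(2) _ closed[OF o(2) c] U(1,2) closed[OF U(1,3,4)]] V V' W W' o(1)
      by blast
  qed
  have s: "(U, s) \<in> germ X x U s" and t: "(U, t) \<in> germ X x U t"
    unfolding germ_def using U by (auto intro!: exI[of _ U])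
  show ?thesis
  proof (intro equalityI subsetI)
    fix y assume "y \<in> germ X x U (f U s t)"
    then show "y \<in> (\<Union>(V, s') \<in> germ X x U s. \<Union>(V', t') \<in> germ X x U t.
      germ X x (V \<inter> V') (f (V \<inter> V') (restr X V (V \<inter> V') s') (restr X V' (V \<inter> V') t')))"
      using eq[OF s t] s t by blast
  qed (use eq in blast)
qed

lemma
  assumes X: "presheaf_of_rings X"
    and U: "openin (space X) U" "x \<in> U" "s \<in> carrier (sect X U)" "t \<in> carrier (sect X U)"
  shows germ_mult: "germ X x U s \<otimes>\<^bsub>stalk X x\<^esub> germ X x U t = germ X x U (s \<otimes>\<^bsub>sect X U\<^esub> t)"
    and germ_add: "germ X x U s \<oplus>\<^bsub>stalk X x\<^esub> germ X x U t = germ X x U (s \<oplus>\<^bsub>sect X U\<^esub> t)"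
proof -
  have m: "a \<otimes>\<^bsub>sect X W\<^esub> b \<in> carrier (sect X W)" and p: "a \<oplus>\<^bsub>sect X W\<^esub> b \<in> carrier (sect X W)"
    if "openin (space X) W" "a \<in> carrier (sect X W)" "b \<in> carrier (sect X W)" for W a b
    using cring.cring_simprules(1,5)[OF cring_sect[OF X that(1)]] that by auto
  show "germ X x U s \<otimes>\<^bsub>stalk X x\<^esub> germ X x U t = germ X x U (s \<otimes>\<^bsub>sect X U\<^esub> t)"
    using stalk_op[where f = "\<lambda>W. mult (sect X W)", OF X m _ U]
      ring_hom_mult[OF restr_hom[OF X]] by (simp add: stalk_def)
  show "germ X x U s \<oplus>\<^bsub>stalk X x\<^esub> germ X x U t = germ X x U (s \<oplus>\<^bsub>sect X U\<^esub> t)"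
    using stalk_op[where f = "\<lambda>W. add (sect X W)", OF X p _ U]
      ring_hom_add[OF restr_hom[OF X]] by (simp add: stalk_def)
qed

lemma
  assumes X: "presheaf_of_rings X" and U: "openin (space X) U" "x \<in> U"
  shows germ_one: "germ X x U \<one>\<^bsub>sect X U\<^esub> = \<one>\<^bsub>stalk X x\<^esub>"
    and germ_zero: "germ X x U \<zero>\<^bsub>sect X U\<^esub> = \<zero>\<^bsub>stalk X x\<^esub>"
proof -
  let ?T = "topspace (space X)"
  have UT: "U \<subseteq> ?T" using openin_subset[OF U(1)] .
  interpret T: cring "sect X ?T" using cring_sect[OF X] by simp
  interpret U: cring "sect X U" using cring_sect[OF X U(1)] .
  have h: "restr X ?T U \<in> ring_hom (sect X ?T) (sect X U)" using restr_hom[OF X] U UT by simp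
  show "germ X x U \<one>\<^bsub>sect X U\<^esub> = \<one>\<^bsub>stalk X x\<^esub>"
    using germ_restr[OF X _ U(1) UT U(2), of "\<one>\<^bsub>sect X ?T\<^esub>"] ring_hom_one[OF h]
    by (simp add: stalk_def)
  show "germ X x U \<zero>\<^bsub>sect X U\<^esub> = \<zero>\<^bsub>stalk X x\<^esub>"
    using germ_restr[OF X _ U(1) UT U(2), of "\<zero>\<^bsub>sect X ?T\<^esub>"]
      ring_hom_zero[OF h T.ring_axioms U.ring_axioms]
    by (simp add: stalk_def)
qed

lemma cring_stalk:
  assumes X: "presheaf_of_rings X" and x: "x \<in> topspace (space X)"
  shows "cring (stalk X x)"
proof -
  let ?R = "stalk X x" and ?T = "topspace (space X)"
  interpret T: cring "sect X ?T" using cring_sect[OF X] by simp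
  have laws: "a \<oplus>\<^bsub>?R\<^esub> b \<in> carrier ?R \<and> a \<otimes>\<^bsub>?R\<^esub> b \<in> carrier ?R \<and>
      (a \<oplus>\<^bsub>?R\<^esub> b) \<oplus>\<^bsub>?R\<^esub> c = a \<oplus>\<^bsub>?R\<^esub> (b \<oplus>\<^bsub>?R\<^esub> c) \<and> a \<oplus>\<^bsub>?R\<^esub> b = b \<oplus>\<^bsub>?R\<^esub> a \<and> \<zero>\<^bsub>?R\<^esub> \<oplus>\<^bsub>?R\<^esub> a = a \<and>
      (\<exists>d \<in> carrier ?R. d \<oplus>\<^bsub>?R\<^esub> a = \<zero>\<^bsub>?R\<^esub>) \<and>
      (a \<otimes>\<^bsub>?R\<^esub> b) \<otimes>\<^bsub>?R\<^esub> c = a \<otimes>\<^bsub>?R\<^esub> (b \<otimes>\<^bsub>?R\<^esub> c) \<and> a \<otimes>\<^bsub>?R\<^esub> b = b \<otimes>\<^bsub>?R\<^esub> a \<and> \<one>\<^bsub>?R\<^esub> \<otimes>\<^bsub>?R\<^esub> a = a \<and>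
      (a \<oplus>\<^bsub>?R\<^esub> b) \<otimes>\<^bsub>?R\<^esub> c = a \<otimes>\<^bsub>?R\<^esub> c \<oplus>\<^bsub>?R\<^esub> b \<otimes>\<^bsub>?R\<^esub> c"
    if abc: "a \<in> carrier ?R" "b \<in> carrier ?R" "c \<in> carrier ?R" for a b c
  proof -
    obtain U s t r where U: "openin (space X) U" "x \<in> U" and
      str: "s \<in> carrier (sect X U)" "t \<in> carrier (sect X U)" "r \<in> carrier (sect X U)" and
      eq: "a = germ X x U s" "b = germ X x U t" "c = germ X x U r"
      using stalk_common_reps[OF X abc] .
    interpret U: cring "sect X U" using cring_sect[OF X U(1)] .
    note g = germ_mult[OF X U] germ_add[OF X U] germ_one[OF X U, symmetric]
      germ_zero[OF X U, symmetric] germ_closed[OF U]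
    have "\<exists>d \<in> carrier ?R. d \<oplus>\<^bsub>?R\<^esub> a = \<zero>\<^bsub>?R\<^esub>"
      by (rule bexI[of _ "germ X x U (\<ominus>\<^bsub>sect X U\<^esub> s)"]) (simp_all add: eq g str U.l_neg)
    then show ?thesis using str by (simp add: eq g U.cring_simprules)
  qed
  have zero_one: "\<zero>\<^bsub>?R\<^esub> \<in> carrier ?R" "\<one>\<^bsub>?R\<^esub> \<in> carrier ?R"
    using germ_closed[OF _ x T.zero_closed] germ_closed[OF _ x T.one_closed]
      germ_one[OF X _ x] germ_zero[OF X _ x] by simp_all
  show ?thesis
    \<comment> \<open>A law in fewer than three variables is an instance of \<open>laws\<close> with
      repeated elements.\<close>
    by (intro cring_lawsI) (fact zero_one | (frule (2) laws, elim conjE, assumption))+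
qed

text \<open>Equal germs agree near their point, so the open sets on which \<open>s\<close> and
  \<open>t\<close> agree cover \<open>U\<close>; the uniqueness half of the sheaf condition for this
  cover finishes the proof. Most identities of sections below are checked on germs in this
  way.\<close>

lemma section_eqI:
  assumes "ringed_space X" and U: "openin (space X) U" "s \<in> carrier (sect X U)" "t \<in> carrier (sect X U)"
    and eq: "\<And>x. x \<in> U \<Longrightarrow> germ X x U s = germ X x U t"
  shows "s = t"
proof -
  have X: "presheaf_of_rings X" and sheaf: "sheaf_condition X"
    using assms(1) ringed_space_def by auto
  define \<U> where "\<U> = {W. openin (space X) W \<and> W \<subseteq> U \<and> restr X U W s = restr X U W t}"
  have un: "\<Union>\<U> = U"
  proof (intro equalityI subsetI)
    fix x assume x: "x \<in> U"
    show "x \<in> \<Union>\<U>"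
      using eq[OF x] germ_eq_iff[OF X U(1) x U(2) U(1) x U(3)] unfolding \<U>_def by auto
  qed (auto simp: \<U>_def)
  have o: "\<forall>W \<in> \<U>. openin (space X) W" and sub: "\<forall>W \<in> \<U>. W \<subseteq> U" by (simp_all add: \<U>_def)
  have c: "\<forall>W \<in> \<U>. restr X U W s \<in> carrier (sect X W)"
    using restr_closed[OF X U(1)] U(2,3) by (simp add: \<U>_def)
  have "restr X V (V \<inter> W) (restr X U V s) = restr X W (V \<inter> W) (restr X U W s)"
    if "V \<in> \<U>" "W \<in> \<U>" for V W
    using that o sub restr_restr[OF X U(1) _ _ _ _ U(2), of V "V \<inter> W"]
      restr_restr[OF X U(1) _ _ _ _ U(2), of W "V \<inter> W"] by (simp add: openin_Int)
  then have "\<exists>!r. r \<in> carrier (sect X (\<Union>\<U>)) \<and> (\<forall>W \<in> \<U>. restr X (\<Union>\<U>) W r = restr X U W s)"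
    using sheaf[unfolded sheaf_condition_def, rule_format, of \<U> "\<lambda>W. restr X U W s"] o c by blast
  moreover have "\<forall>W \<in> \<U>. restr X U W t = restr X U W s" by (simp add: \<U>_def)
  ultimately show ?thesis unfolding un using U by blast
qed

text \<open>The sheaf condition in terms of germs: a prescription of one germ at each point that is
  locally that of a section comes from exactly one section. The induced map of a cone is defined on
  sections by such a prescription.\<close>

lemma section_glue:
  assumes "ringed_space X" and U: "openin (space X) U"
    and loc: "\<And>x. x \<in> U \<Longrightarrow> \<exists>W t. openin (space X) W \<and> x \<in> W \<and> W \<subseteq> U \<and> t \<in> carrier (sect X W) \<and>
      (\<forall>y \<in> W. germ X y W t = g y)"
  shows "\<exists>!s. s \<in> carrier (sect X U) \<and> (\<forall>x \<in> U. germ X x U s = g x)"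
proof -
  have X: "presheaf_of_rings X" and sheaf: "sheaf_condition X"
    using assms(1) ringed_space_def by auto
  define P where "P W t \<longleftrightarrow> t \<in> carrier (sect X W) \<and> (\<forall>y \<in> W. germ X y W t = g y)" for W t
  define \<U> where "\<U> = {W. openin (space X) W \<and> W \<subseteq> U \<and> (\<exists>t. P W t)}"
  define f where "f W = (SOME t. P W t)" for W
  have f: "P W (f W)" if "W \<in> \<U>" for W
    using that unfolding \<U>_def f_def by (auto intro: someI_ex)
  have un: "\<Union>\<U> = U"
  proof (intro equalityI subsetI)
    fix x assume "x \<in> U"
    then obtain W t where "openin (space X) W" "x \<in> W" "W \<subseteq> U" "P W t"
      using loc[of x] unfolding P_def by metis
    then show "x \<in> \<Union>\<U>" unfolding \<U>_def by auto
  qed (auto simp: \<U>_def)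
  have o: "openin (space X) W" "W \<subseteq> U" if "W \<in> \<U>" for W using that by (auto simp: \<U>_def)
  \<comment> \<open>The sections \<open>f V\<close> are chosen independently of each other; they
    agree on overlaps because all of them have the germs \<open>g\<close>.\<close>
  have "restr X V (V \<inter> W) (f V) = restr X W (V \<inter> W) (f W)" if V: "V \<in> \<U>" and W: "W \<in> \<U>" for V W
  proof (rule section_eqI[OF assms(1)])
    show VW: "openin (space X) (V \<inter> W)" using o V W by auto
    show "restr X V (V \<inter> W) (f V) \<in> carrier (sect X (V \<inter> W))"
      "restr X W (V \<inter> W) (f W) \<in> carrier (sect X (V \<inter> W))"
      using restr_closed[OF X] o V W f VW unfolding P_def by auto
    show "germ X x (V \<inter> W) (restr X V (V \<inter> W) (f V)) = germ X x (V \<inter> W) (restr X W (V \<inter> W) (f W))"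
      if "x \<in> V \<inter> W" for x
      using that o V W f VW germ_restr[OF X o(1)[OF V] VW, of x "f V"]
        germ_restr[OF X o(1)[OF W] VW, of x "f W"] unfolding P_def by auto
  qed
  then have "\<exists>s. s \<in> carrier (sect X (\<Union>\<U>)) \<and> (\<forall>W \<in> \<U>. restr X (\<Union>\<U>) W s = f W)"
    using sheaf[unfolded sheaf_condition_def, rule_format, of \<U> f] o f unfolding P_def by metis
  then obtain s where s: "s \<in> carrier (sect X U)" "\<And>W. W \<in> \<U> \<Longrightarrow> restr X U W s = f W"
    unfolding un by blast
  have g: "germ X x U s = g x" if x: "x \<in> U" for x
  proof -
    obtain W where W: "W \<in> \<U>" "x \<in> W" using x un by auto
    then have "germ X x U s = germ X x W (f W)"
      using germ_restr[OF X U o[OF W(1)] W(2) s(1)] s(2) by simp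
    then show ?thesis using f[OF W(1)] W(2) P_def by simp
  qed
  show ?thesis using s(1) g section_eqI[OF assms(1) U] by (intro ex1I[of _ s]) auto
qed

text \<open>An equality of germs holds on a neighbourhood. This is applied to the equation which
  says that \<open>s\<close> times a representative of the inverse is one.\<close>

lemma germ_unit_nhd:
  assumes X: "presheaf_of_rings X" and U: "openin (space X) U" "x \<in> U" "s \<in> carrier (sect X U)"
    and unit: "germ X x U s \<in> Units (stalk X x)"
  obtains W t where "openin (space X) W" "x \<in> W" "W \<subseteq> U" "t \<in> carrier (sect X W)"
    "restr X U W s \<otimes>\<^bsub>sect X W\<^esub> t = \<one>\<^bsub>sect X W\<^esub>"
proof -
  have x: "x \<in> topspace (space X)" using U openin_subset by blast
  obtain b where b: "b \<in> carrier (stalk X x)" "germ X x U s \<otimes>\<^bsub>stalk X x\<^esub> b = \<one>\<^bsub>stalk X x\<^esub>"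
    using unit cring.Units_iff[OF cring_stalk[OF X x]] by auto
  obtain V s' t r where V: "openin (space X) V" "x \<in> V" and
    c: "s' \<in> carrier (sect X V)" "t \<in> carrier (sect X V)" and
    eq: "germ X x U s = germ X x V s'" "b = germ X x V t"
    using stalk_common_reps[OF X germ_closed[OF U] b(1) b(1)] by metis
  interpret V: cring "sect X V" using cring_sect[OF X V(1)] .
  obtain W where W: "openin (space X) W" "x \<in> W" "W \<subseteq> U \<inter> V" "restr X U W s = restr X V W s'"
    using eq(1) germ_eq_iff[OF X U V c(1)] by auto
  have "germ X x V (s' \<otimes>\<^bsub>sect X V\<^esub> t) = germ X x V \<one>\<^bsub>sect X V\<^esub>"
    using b(2) eq germ_mult[OF X V c] germ_one[OF X V] by simp
  then obtain W' where W': "openin (space X) W'" "x \<in> W'" "W' \<subseteq> V"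
    "restr X V W' (s' \<otimes>\<^bsub>sect X V\<^esub> t) = restr X V W' \<one>\<^bsub>sect X V\<^esub>"
    using germ_eq_iff[OF X V _ V, of "s' \<otimes>\<^bsub>sect X V\<^esub> t" "\<one>\<^bsub>sect X V\<^esub>"] c by auto
  \<comment> \<open>On \<open>W\<close> the section \<open>s\<close> agrees with its representative
    \<open>s'\<close> over \<open>V\<close>, and on \<open>W'\<close> the product of
    \<open>s'\<close> and \<open>t\<close> is one.\<close>
  let ?N = "W \<inter> W'"
  have N: "openin (space X) ?N" "?N \<subseteq> V" "?N \<subseteq> U" using W W' by auto
  have h: "restr X V ?N \<in> ring_hom (sect X V) (sect X ?N)" using restr_hom[OF X V(1) N(1,2)] .
  have "restr X U ?N s = restr X W ?N (restr X U W s)"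
    using restr_restr[OF X U(1) W(1) N(1) _ _ U(3)] W by auto
  also have "\<dots> = restr X V ?N s'"
    using restr_restr[OF X V(1) W(1) N(1) _ _ c(1)] W by auto
  finally have "restr X U ?N s \<otimes>\<^bsub>sect X ?N\<^esub> restr X V ?N t = restr X V ?N (s' \<otimes>\<^bsub>sect X V\<^esub> t)"
    using ring_hom_mult[OF h c] by simp
  also have "\<dots> = restr X W' ?N (restr X V W' (s' \<otimes>\<^bsub>sect X V\<^esub> t))"
    using restr_restr[OF X V(1) W'(1) N(1), of "s' \<otimes>\<^bsub>sect X V\<^esub> t"] W' c by simp
  also have "\<dots> = restr X V ?N \<one>\<^bsub>sect X V\<^esub>"
    using restr_restr[OF X V(1) W'(1) N(1), of "\<one>\<^bsub>sect X V\<^esub>"] W' by simp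
  also have "\<dots> = \<one>\<^bsub>sect X ?N\<^esub>" using ring_hom_one[OF h] .
  finally show thesis
    using that[OF N(1) _ N(3) restr_closed[OF X V(1) N(1,2) c(2)]] W W' by blast
qed

text \<open>If \<open>t\<close> is inverse to \<open>s\<close> over \<open>W\<close>, then the germs
  of the negative of \<open>t\<close> are -1/s at all points of \<open>W\<close> simultaneously. The
  combination of inverse and sign is the one denoted by \<open>Neg\<close> in expressions.\<close>

lemma germ_inverse_nhd:
  assumes X: "presheaf_of_rings X" and U: "openin (space X) U" "x \<in> U" "s \<in> carrier (sect X U)"
    and unit: "germ X x U s \<in> Units (stalk X x)"
  obtains W t where "openin (space X) W" "x \<in> W" "W \<subseteq> U" "t \<in> carrier (sect X W)"
    "\<And>y. y \<in> W \<Longrightarrow> germ X y U s \<in> Units (stalk X y)"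
    "\<And>y. y \<in> W \<Longrightarrow> \<ominus>\<^bsub>stalk X y\<^esub> (inv\<^bsub>stalk X y\<^esub> germ X y U s) = germ X y W t"
proof -
  obtain W t where W: "openin (space X) W" "x \<in> W" "W \<subseteq> U" and t: "t \<in> carrier (sect X W)"
    and eq: "restr X U W s \<otimes>\<^bsub>sect X W\<^esub> t = \<one>\<^bsub>sect X W\<^esub>"
    using germ_unit_nhd[OF X U unit] .
  interpret W: cring "sect X W" using cring_sect[OF X W(1)] .
  have s: "restr X U W s \<in> carrier (sect X W)" using restr_closed[OF X U(1) W(1,3) U(3)] .
  have inverse: "germ X y U s \<in> Units (stalk X y) \<and>
      \<ominus>\<^bsub>stalk X y\<^esub> (inv\<^bsub>stalk X y\<^esub> germ X y U s) = germ X y W (\<ominus>\<^bsub>sect X W\<^esub> t)" if y: "y \<in> W" for y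
  proof -
    have "y \<in> topspace (space X)" using y openin_subset[OF W(1)] by blast
    then interpret S: cring "stalk X y" using cring_stalk[OF X] by simp
    note g = germ_closed[OF W(1) y]
    have "germ X y U s = germ X y W (restr X U W s)"
      using germ_restr[OF X U(1) W(1,3) y U(3)] by simp
    then have e: "germ X y U s \<otimes>\<^bsub>stalk X y\<^esub> germ X y W t = \<one>\<^bsub>stalk X y\<^esub>"
      and c: "germ X y U s \<in> carrier (stalk X y)"
      using germ_mult[OF X W(1) y s t] germ_one[OF X W(1) y] eq g[OF s] by simp_all
    have "germ X y W (\<ominus>\<^bsub>sect X W\<^esub> t) \<oplus>\<^bsub>stalk X y\<^esub> germ X y W t = \<zero>\<^bsub>stalk X y\<^esub>"
      using germ_add[OF X W(1) y _ t] germ_zero[OF X W(1) y] t by (simp add: W.l_neg)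
    then have "\<ominus>\<^bsub>stalk X y\<^esub> germ X y W t = germ X y W (\<ominus>\<^bsub>sect X W\<^esub> t)"
      using g t by (intro S.minus_equality) simp_all
    then show ?thesis
      using S.comm_inv_char[OF c g[OF t] e] S.Units_iff c e g[OF t] by auto
  qed
  show thesis by (rule that[OF W W.a_inv_closed[OF t]]) (use inverse in simp_all)
qed

section \<open>Morphisms and their maps on stalks\<close>

lemma openin_preim:
  assumes "ringed_space_morphism X Y f" "openin (space Y) V"
  shows "openin (space X) (preim X f V)"
proof -
  have "continuous_map (space X) (space Y) (pt_map f)"
    using assms(1) by (simp add: ringed_space_morphism_def)
  then show ?thesis unfolding preim_def using assms(2) by (rule openin_continuous_map_preimage)
qed

lemma
  assumes "ringed_space_morphism X Y f"
  shows morphism_pt: "x \<in> topspace (space X) \<Longrightarrow> pt_map f x \<in> topspace (space Y)"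
    and morphism_sec: "openin (space Y) V \<Longrightarrow> sec_map f V \<in> ring_hom (sect Y V) (sect X (preim X f V))"
    and morphism_restr: "\<lbrakk>openin (space Y) V; openin (space Y) W; W \<subseteq> V; s \<in> carrier (sect Y V)\<rbrakk> \<Longrightarrow>
      sec_map f W (restr Y V W s) = restr X (preim X f V) (preim X f W) (sec_map f V s)"
  using assms by (auto simp: ringed_space_morphism_def continuous_map_def)

text \<open>The union in \<open>stalk_map\<close> runs over all representatives of the germ. Two of
  them agree near \<open>pt_map f x\<close>, hence their images agree on the preimage of that
  neighbourhood, and all members of the union coincide.\<close>

lemma stalk_map_germ:
  assumes X: "presheaf_of_rings X" and Y: "presheaf_of_rings Y" and f: "ringed_space_morphism X Y f"
    and x: "x \<in> topspace (space X)"
    and V: "openin (space Y) V" "pt_map f x \<in> V" "s \<in> carrier (sect Y V)"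
  shows "stalk_map X f x (germ Y (pt_map f x) V s) = germ X x (preim X f V) (sec_map f V s)"
proof -
  have eq: "germ X x (preim X f W) (sec_map f W t) = germ X x (preim X f V) (sec_map f V s)"
    if Wt: "(W, t) \<in> germ Y (pt_map f x) V s" for W t
  proof -
    obtain N where W: "openin (space Y) W" "pt_map f x \<in> W" "t \<in> carrier (sect Y W)" and
      N: "openin (space Y) N" "pt_map f x \<in> N" "N \<subseteq> V \<inter> W" "restr Y V N s = restr Y W N t"
      using Wt unfolding germ_def by auto
    have o: "openin (space X) (preim X f U)" if "openin (space Y) U" for U
      using openin_preim[OF f that] .
    have sub: "preim X f N \<subseteq> preim X f W \<inter> preim X f V" using N unfolding preim_def by auto
    have "restr X (preim X f W) (preim X f N) (sec_map f W t) =
      restr X (preim X f V) (preim X f N) (sec_map f V s)"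
      using morphism_restr[OF f V(1) N(1) _ V(3)] morphism_restr[OF f W(1) N(1) _ W(3)] N by auto
    moreover have "x \<in> preim X f N" using x N by (simp add: preim_def)
    ultimately show ?thesis
      using germ_eq_iff[OF X o[OF W(1)] _ ring_hom_closed[OF morphism_sec[OF f W(1)] W(3)]
          o[OF V(1)] _ ring_hom_closed[OF morphism_sec[OF f V(1)] V(3)]] sub o[OF N(1)] by blast
  qed
  have "(V, s) \<in> germ Y (pt_map f x) V s"
    unfolding germ_def using V by (auto intro!: exI[of _ V])
  then show ?thesis unfolding stalk_map_def using eq by blast
qed

lemma stalk_map_hom:
  assumes X: "presheaf_of_rings X" and Y: "presheaf_of_rings Y" and f: "ringed_space_morphism X Y f"
    and x: "x \<in> topspace (space X)"
  shows "stalk_map X f x \<in> ring_hom (stalk Y (pt_map f x)) (stalk X x)"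
proof -
  let ?R = "stalk Y (pt_map f x)"
  have laws: "stalk_map X f x a \<in> carrier (stalk X x) \<and>
      stalk_map X f x (a \<otimes>\<^bsub>?R\<^esub> b) = stalk_map X f x a \<otimes>\<^bsub>stalk X x\<^esub> stalk_map X f x b \<and>
      stalk_map X f x (a \<oplus>\<^bsub>?R\<^esub> b) = stalk_map X f x a \<oplus>\<^bsub>stalk X x\<^esub> stalk_map X f x b"
    if ab: "a \<in> carrier ?R" "b \<in> carrier ?R" for a b
  proof -
    obtain V s t where V: "openin (space Y) V" "pt_map f x \<in> V" and
      st: "s \<in> carrier (sect Y V)" "t \<in> carrier (sect Y V)" and
      eq: "a = germ Y (pt_map f x) V s" "b = germ Y (pt_map f x) V t"
      using stalk_common_reps[OF Y ab ab(2)] by metis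
    interpret V: cring "sect Y V" using cring_sect[OF Y V(1)] .
    have h: "sec_map f V \<in> ring_hom (sect Y V) (sect X (preim X f V))" using morphism_sec[OF f V(1)] .
    have P: "openin (space X) (preim X f V)" "x \<in> preim X f V"
      using openin_preim[OF f V(1)] x V(2) by (auto simp: preim_def)
    show ?thesis
      using st by (simp add: eq germ_mult[OF Y V] germ_add[OF Y V] stalk_map_germ[OF X Y f x V]
          ring_hom_mult[OF h] ring_hom_add[OF h] ring_hom_closed[OF h] germ_closed[OF P]
          germ_mult[OF X P] germ_add[OF X P])
  qed
  let ?T = "topspace (space Y)"
  interpret T: cring "sect Y ?T" using cring_sect[OF Y] by simp
  have fx: "pt_map f x \<in> ?T" using morphism_pt[OF f x] .
  have P: "openin (space X) (preim X f ?T)" "x \<in> preim X f ?T"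
    using openin_preim[OF f] x fx by (auto simp: preim_def)
  have "stalk_map X f x \<one>\<^bsub>?R\<^esub> = \<one>\<^bsub>stalk X x\<^esub>"
    using stalk_map_germ[OF X Y f x _ fx T.one_closed] germ_one[OF Y _ fx] germ_one[OF X P]
      ring_hom_one[OF morphism_sec[OF f]] by simp
  then show ?thesis by (intro ring_hom_memI) (use laws in blast)+
qed

lemma locally_ringed_spaceD:
  assumes "locally_ringed_space X"
  shows "ringed_space X" "presheaf_of_rings X"
    "x \<in> topspace (space X) \<Longrightarrow> local_ring (stalk X x)"
  using assms unfolding locally_ringed_space_def ringed_space_def by auto

text \<open>The maps on stalks are always ring homomorphisms, so locality only adds that units are
  reflected, and as every element of a stalk is a germ, this can be checked one section at a
  time.\<close>

lemma lrs_morphism_iff: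
  "lrs_morphism X Y f \<longleftrightarrow> locally_ringed_space X \<and> locally_ringed_space Y \<and> ringed_space_morphism X Y f \<and>
    (\<forall>x \<in> topspace (space X). \<forall>V s. openin (space Y) V \<longrightarrow> pt_map f x \<in> V \<longrightarrow> s \<in> carrier (sect Y V) \<longrightarrow>
       germ X x (preim X f V) (sec_map f V s) \<in> Units (stalk X x) \<longrightarrow>
       germ Y (pt_map f x) V s \<in> Units (stalk Y (pt_map f x)))"
proof (cases "locally_ringed_space X \<and> locally_ringed_space Y \<and> ringed_space_morphism X Y f")
  case True
  then have X: "locally_ringed_space X" and Y: "locally_ringed_space Y"
    and f: "ringed_space_morphism X Y f" by auto
  note X' = locally_ringed_spaceD[OF X] and Y' = locally_ringed_spaceD[OF Y]
  have "local_ring_hom (stalk Y (pt_map f x)) (stalk X x) (stalk_map X f x) \<longleftrightarrow>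
    (\<forall>V s. openin (space Y) V \<longrightarrow> pt_map f x \<in> V \<longrightarrow> s \<in> carrier (sect Y V) \<longrightarrow>
       germ X x (preim X f V) (sec_map f V s) \<in> Units (stalk X x) \<longrightarrow>
       germ Y (pt_map f x) V s \<in> Units (stalk Y (pt_map f x)))" (is "?local \<longleftrightarrow> ?germs")
    if x: "x \<in> topspace (space X)" for x
  proof -
    let ?R = "stalk Y (pt_map f x)"
    have "?local \<longleftrightarrow> (\<forall>a \<in> carrier ?R. stalk_map X f x a \<in> Units (stalk X x) \<longrightarrow> a \<in> Units ?R)"
      using local_ring_hom_iff[OF Y'(3)[OF morphism_pt[OF f x]] X'(3)[OF x]]
        stalk_map_hom[OF X'(2) Y'(2) f x] by simp
    also have "\<dots> \<longleftrightarrow> ?germs"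
    proof
      assume "\<forall>a \<in> carrier ?R. stalk_map X f x a \<in> Units (stalk X x) \<longrightarrow> a \<in> Units ?R"
      then show ?germs
        using germ_closed[of Y _ "pt_map f x"] stalk_map_germ[OF X'(2) Y'(2) f x] by metis
    next
      assume ?germs
      then show "\<forall>a \<in> carrier ?R. stalk_map X f x a \<in> Units (stalk X x) \<longrightarrow> a \<in> Units ?R"
        using stalk_map_germ[OF X'(2) Y'(2) f x] by (auto simp: stalk_carrier)
    qed
    finally show ?thesis .
  qed
  then show ?thesis using True unfolding lrs_morphism_def by blast
qed (auto simp: lrs_morphism_def)

section \<open>Points and sections of the limit\<close>

locale lrs_diagram =
  fixes J :: "('i, 'j) cat"
    and D :: "'i \<Rightarrow> ('p, 's) ringed_space"
    and \<delta> :: "'j \<Rightarrow> ('p, 's, 'p, 's) rs_map"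
  assumes small_category: "small_category J"
    and lrs_functor: "lrs_functor J D \<delta>"
begin

lemma diagram_space: "i \<in> Ob J \<Longrightarrow> locally_ringed_space (D i)"
  using lrs_functor by (simp add: lrs_functor_def)

lemma diagram_presheaf: "i \<in> Ob J \<Longrightarrow> presheaf_of_rings (D i)"
  using diagram_space locally_ringed_spaceD by blast

lemma
  assumes "a \<in> Ar J"
  shows Dom_Ob: "Dom J a \<in> Ob J" and Cod_Ob: "Cod J a \<in> Ob J"
    and diagram_morphism: "ringed_space_morphism (D (Dom J a)) (D (Cod J a)) (\<delta> a)"
  using assms small_category lrs_functor
  by (auto simp: small_category_def lrs_functor_def lrs_morphism_def)

section \<open>Generators and relations for the localized colimit\<close>

definition is_gen :: "('i \<Rightarrow> 'p) \<Rightarrow> 'i \<times> 'p set \<times> 's \<Rightarrow> bool" where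
  "is_gen x g \<longleftrightarrow> (case g of (i, U, s) \<Rightarrow>
     i \<in> Ob J \<and> openin (space (D i)) U \<and> s \<in> carrier (sect (D i) U) \<and> x i \<in> U)"

text \<open>
  A point is a pair \<open>(x, S)\<close>, where \<open>S\<close> is the set of expressions that are units at this point, that
  is, the complement of the prime ideal. The expression \<open>Neg e\<close> is read as \<open>- 1 / e\<close> and only
  admitted for \<open>e \<in> S\<close>, so that expressions denote arbitrary fractions: \<open>Neg One\<close> is \<open>- 1\<close>.
\<close>

primrec wf_expr :: "('i, 'p, 's) limit_point \<Rightarrow> ('i, 'p, 's) colim_expr \<Rightarrow> bool" where
  "wf_expr z (Gen g) \<longleftrightarrow> is_gen (fst z) g"
| "wf_expr z Zero \<longleftrightarrow> True"
| "wf_expr z One \<longleftrightarrow> True"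
| "wf_expr z (Neg a) \<longleftrightarrow> wf_expr z a \<and> a \<in> snd z"
| "wf_expr z (Add a b) \<longleftrightarrow> wf_expr z a \<and> wf_expr z b"
| "wf_expr z (Mul a b) \<longleftrightarrow> wf_expr z a \<and> wf_expr z b"

text \<open>The generator \<open>(i, U, s)\<close> stands for the germ of \<open>s\<close> at
  \<open>fst z i\<close>. The rules \<open>gen_restr\<close> to \<open>gen_mul\<close> make the
  stalk of each \<open>D i\<close> map homomorphically into the quotient, \<open>gen_arrow\<close>
  identifies elements along the arrows, and \<open>inverse\<close> localizes. Negatives are not
  postulated but obtained from \<open>Neg One\<close>, for which \<open>mul_zero\<close> is needed.
  As \<open>z\<close> is an arbitrary pair here, \<open>gen_arrow\<close> asks for both of its
  generators to be defined.\<close>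

inductive expr_eq :: "('i, 'p, 's) limit_point \<Rightarrow> ('i, 'p, 's) colim_expr \<Rightarrow> ('i, 'p, 's) colim_expr \<Rightarrow> bool"
  for z where
  refl: "wf_expr z a \<Longrightarrow> expr_eq z a a"
| sym: "expr_eq z a b \<Longrightarrow> expr_eq z b a"
| trans: "expr_eq z a b \<Longrightarrow> expr_eq z b c \<Longrightarrow> expr_eq z a c"
| add_cong: "expr_eq z a b \<Longrightarrow> expr_eq z c d \<Longrightarrow> expr_eq z (Add a c) (Add b d)"
| mul_cong: "expr_eq z a b \<Longrightarrow> expr_eq z c d \<Longrightarrow> expr_eq z (Mul a c) (Mul b d)"
| add_assoc: "wf_expr z a \<Longrightarrow> wf_expr z b \<Longrightarrow> wf_expr z c \<Longrightarrow> expr_eq z (Add (Add a b) c) (Add a (Add b c))"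
| add_comm: "wf_expr z a \<Longrightarrow> wf_expr z b \<Longrightarrow> expr_eq z (Add a b) (Add b a)"
| add_zero: "wf_expr z a \<Longrightarrow> expr_eq z (Add Zero a) a"
| mul_assoc: "wf_expr z a \<Longrightarrow> wf_expr z b \<Longrightarrow> wf_expr z c \<Longrightarrow> expr_eq z (Mul (Mul a b) c) (Mul a (Mul b c))"
| mul_comm: "wf_expr z a \<Longrightarrow> wf_expr z b \<Longrightarrow> expr_eq z (Mul a b) (Mul b a)"
| mul_one: "wf_expr z a \<Longrightarrow> expr_eq z (Mul One a) a"
| distrib: "wf_expr z a \<Longrightarrow> wf_expr z b \<Longrightarrow> wf_expr z c \<Longrightarrow>
    expr_eq z (Mul (Add a b) c) (Add (Mul a c) (Mul b c))"
| mul_zero: "wf_expr z a \<Longrightarrow> expr_eq z (Mul Zero a) Zero"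
| inverse: "wf_expr z a \<Longrightarrow> a \<in> snd z \<Longrightarrow> expr_eq z (Add (Mul a (Neg a)) One) Zero"
| gen_restr: "is_gen (fst z) (i, U, s) \<Longrightarrow> openin (space (D i)) V \<Longrightarrow> V \<subseteq> U \<Longrightarrow> fst z i \<in> V \<Longrightarrow>
    expr_eq z (Gen (i, U, s)) (Gen (i, V, restr (D i) U V s))"
| gen_one: "is_gen (fst z) (i, U, \<one>\<^bsub>sect (D i) U\<^esub>) \<Longrightarrow> expr_eq z (Gen (i, U, \<one>\<^bsub>sect (D i) U\<^esub>)) One"
| gen_add: "is_gen (fst z) (i, U, s) \<Longrightarrow> is_gen (fst z) (i, U, t) \<Longrightarrow>
    expr_eq z (Gen (i, U, s \<oplus>\<^bsub>sect (D i) U\<^esub> t)) (Add (Gen (i, U, s)) (Gen (i, U, t)))"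
| gen_mul: "is_gen (fst z) (i, U, s) \<Longrightarrow> is_gen (fst z) (i, U, t) \<Longrightarrow>
    expr_eq z (Gen (i, U, s \<otimes>\<^bsub>sect (D i) U\<^esub> t)) (Mul (Gen (i, U, s)) (Gen (i, U, t)))"
| gen_arrow: "c \<in> Ar J \<Longrightarrow> is_gen (fst z) (Cod J c, V, s) \<Longrightarrow>
    is_gen (fst z) (Dom J c, preim (D (Dom J c)) (\<delta> c) V, sec_map (\<delta> c) V s) \<Longrightarrow>
    expr_eq z (Gen (Cod J c, V, s)) (Gen (Dom J c, preim (D (Dom J c)) (\<delta> c) V, sec_map (\<delta> c) V s))"

declare expr_eq.trans [trans]

lemma is_gen_restr:
  assumes "is_gen x (i, U, s)" "openin (space (D i)) V" "V \<subseteq> U" "x i \<in> V"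
  shows "is_gen x (i, V, restr (D i) U V s)"
  using assms restr_closed[OF diagram_presheaf, of i U V s] by (simp add: is_gen_def)

lemma is_gen_ops:
  assumes "is_gen x (i, U, s)" "is_gen x (i, U, t)"
  shows "is_gen x (i, U, s \<oplus>\<^bsub>sect (D i) U\<^esub> t)" "is_gen x (i, U, s \<otimes>\<^bsub>sect (D i) U\<^esub> t)"
proof -
  have "cring (sect (D i) U)"
    using assms(1) cring_sect[OF diagram_presheaf] by (simp add: is_gen_def)
  then show "is_gen x (i, U, s \<oplus>\<^bsub>sect (D i) U\<^esub> t)" "is_gen x (i, U, s \<otimes>\<^bsub>sect (D i) U\<^esub> t)"
    using assms cring.cring_simprules(1,5) by (fastforce simp: is_gen_def)+
qed

lemma expr_eq_wf: "expr_eq z a b \<Longrightarrow> wf_expr z a \<and> wf_expr z b"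
  by (induction rule: expr_eq.induct) (simp_all add: is_gen_restr is_gen_ops)

text \<open>After the compatible family come the conditions on the set of units: it consists of
  exactly the invertible expressions, and the conditions on \<open>Zero\<close> and
  \<open>Add\<close> say that the resulting ring is local. The last condition says that the prime
  ideal lies over every maximal ideal; only nonunits of the \<open>D i\<close> have to be protected,
  as ring homomorphisms preserve units anyway. The value \<open>undefined\<close> off
  \<open>Ob J\<close> makes a family determined by its members at the objects, as uniqueness of the
  induced map requires.\<close>

definition limit_points :: "('i, 'p, 's) limit_point set" where
  "limit_points = {z.
     (\<forall>i. if i \<in> Ob J then fst z i \<in> topspace (space (D i)) else fst z i = undefined) \<and>
     (\<forall>c \<in> Ar J. pt_map (\<delta> c) (fst z (Dom J c)) = fst z (Cod J c)) \<and>
     (\<forall>a. a \<in> snd z \<longleftrightarrow> (\<exists>b. expr_eq z (Mul a b) One)) \<and>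
     Zero \<notin> snd z \<and> (\<forall>a b. Add a b \<in> snd z \<longrightarrow> a \<in> snd z \<or> b \<in> snd z) \<and>
     (\<forall>i U s. Gen (i, U, s) \<in> snd z \<longrightarrow>
        germ (D i) (fst z i) U s \<in> Units (stalk (D i) (fst z i)))}"

lemma
  assumes "z \<in> limit_points"
  shows limit_point_pt: "i \<in> Ob J \<Longrightarrow> fst z i \<in> topspace (space (D i))"
    and limit_point_undefined: "i \<notin> Ob J \<Longrightarrow> fst z i = undefined"
    and limit_point_arrow: "c \<in> Ar J \<Longrightarrow> pt_map (\<delta> c) (fst z (Dom J c)) = fst z (Cod J c)"
    and limit_point_unit: "a \<in> snd z \<longleftrightarrow> (\<exists>b. expr_eq z (Mul a b) One)"
    and limit_point_Zero: "Zero \<notin> snd z"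
    and limit_point_Add: "Add a b \<in> snd z \<Longrightarrow> a \<in> snd z \<or> b \<in> snd z"
    and limit_point_Gen: "Gen (i, U, s) \<in> snd z \<Longrightarrow>
      germ (D i) (fst z i) U s \<in> Units (stalk (D i) (fst z i))"
proof -
  have P: "\<forall>i. if i \<in> Ob J then fst z i \<in> topspace (space (D i)) else fst z i = undefined"
    "\<forall>c \<in> Ar J. pt_map (\<delta> c) (fst z (Dom J c)) = fst z (Cod J c)"
    "\<forall>a. a \<in> snd z \<longleftrightarrow> (\<exists>b. expr_eq z (Mul a b) One)"
    "Zero \<notin> snd z" "\<forall>a b. Add a b \<in> snd z \<longrightarrow> a \<in> snd z \<or> b \<in> snd z"
    "\<forall>i U s. Gen (i, U, s) \<in> snd z \<longrightarrow>
        germ (D i) (fst z i) U s \<in> Units (stalk (D i) (fst z i))"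
    using assms unfolding limit_points_def mem_Collect_eq by - (elim conjE, assumption)+
  show "i \<in> Ob J \<Longrightarrow> fst z i \<in> topspace (space (D i))" using P(1)[rule_format, of i] by simp
  show "i \<notin> Ob J \<Longrightarrow> fst z i = undefined" using P(1)[rule_format, of i] by simp
  show "c \<in> Ar J \<Longrightarrow> pt_map (\<delta> c) (fst z (Dom J c)) = fst z (Cod J c)" using P(2) by simp
  show "a \<in> snd z \<longleftrightarrow> (\<exists>b. expr_eq z (Mul a b) One)" using P(3) by simp
  show "Zero \<notin> snd z" using P(4) .
  show "Add a b \<in> snd z \<Longrightarrow> a \<in> snd z \<or> b \<in> snd z" using P(5) by simp
  show "Gen (i, U, s) \<in> snd z \<Longrightarrow> germ (D i) (fst z i) U s \<in> Units (stalk (D i) (fst z i))"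
    using P(6) by simp
qed

lemma limit_point_wf: "z \<in> limit_points \<Longrightarrow> a \<in> snd z \<Longrightarrow> wf_expr z a"
  using limit_point_unit expr_eq_wf wf_expr.simps(6) by metis

lemma limit_point_One: "z \<in> limit_points \<Longrightarrow> One \<in> snd z"
  using limit_point_unit expr_eq.mul_one wf_expr.simps(3) by metis

text \<open>The second component is constant: it only adapts the class to the type of sections.\<close>

definition expr_class ::
    "('i, 'p, 's) limit_point \<Rightarrow> ('i, 'p, 's) colim_expr \<Rightarrow>
     (('i, 'p, 's) colim_expr \<times> ('i, 'p, 's) colim_expr) set" where
  "expr_class z a = {b. expr_eq z a b} \<times> {One}"

lemma expr_class_eq_iff:
  assumes "wf_expr z a"
  shows "expr_class z a = expr_class z b \<longleftrightarrow> expr_eq z a b"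
proof
  assume "expr_class z a = expr_class z b"
  then have "{c. expr_eq z a c} = {c. expr_eq z b c}"
    unfolding expr_class_def by (auto simp: times_eq_iff)
  then have "expr_eq z b a" using expr_eq.refl[OF assms] by blast
  then show "expr_eq z a b" by (rule expr_eq.sym)
next
  assume "expr_eq z a b"
  then have "\<And>c. expr_eq z a c \<longleftrightarrow> expr_eq z b c" using expr_eq.trans expr_eq.sym by metis
  then show "expr_class z a = expr_class z b" by (simp add: expr_class_def)
qed

lemma expr_class_nonempty: "wf_expr z a \<Longrightarrow> expr_class z a \<noteq> {}"
  using expr_eq.refl unfolding expr_class_def by blast

text \<open>For a point \<open>z\<close> of the limit this is the colimit of the local rings of the
  \<open>D i\<close>, localized at the prime ideal of \<open>z\<close>. Its elements are the values
  that sections of the limit take at \<open>z\<close>.\<close>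

definition class_ring ::
    "('i, 'p, 's) limit_point \<Rightarrow> (('i, 'p, 's) colim_expr \<times> ('i, 'p, 's) colim_expr) set ring" where
  "class_ring z =
     \<lparr>carrier = expr_class z ` Collect (wf_expr z),
      mult = (\<lambda>A B. \<Union>(a, _) \<in> A. \<Union>(b, _) \<in> B. expr_class z (Mul a b)),
      one = expr_class z One,
      zero = expr_class z Zero,
      add = (\<lambda>A B. \<Union>(a, _) \<in> A. \<Union>(b, _) \<in> B. expr_class z (Add a b))\<rparr>"

lemma expr_class_op:
  assumes "wf_expr z a" "wf_expr z b"
    and "\<And>a b c d. expr_eq z a b \<Longrightarrow> expr_eq z c d \<Longrightarrow> expr_eq z (f a c) (f b d)"
  shows "(\<Union>(a', _) \<in> expr_class z a. \<Union>(b', _) \<in> expr_class z b. expr_class z (f a' b')) = expr_class z (f a b)"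
proof -
  have eq: "expr_class z (f a' b') = expr_class z (f a b)" if "expr_eq z a a'" "expr_eq z b b'" for a' b'
  proof -
    have "expr_eq z (f a b) (f a' b')" using assms(3) that by simp
    then show ?thesis using expr_class_eq_iff expr_eq_wf by metis
  qed
  have "(\<Union>(a', _) \<in> expr_class z a. \<Union>(b', _) \<in> expr_class z b. expr_class z (f a' b')) =
      (\<Union>_ \<in> expr_class z a. \<Union>_ \<in> expr_class z b. expr_class z (f a b))"
    by (intro SUP_cong refl) (auto simp: expr_class_def[of z a] expr_class_def[of z b] eq intro!: SUP_cong)
  then show ?thesis using expr_class_nonempty assms(1,2) by simp
qed

lemma
  shows class_ring_closed: "wf_expr z a \<Longrightarrow> expr_class z a \<in> carrier (class_ring z)"
    and class_ring_one: "\<one>\<^bsub>class_ring z\<^esub> = expr_class z One"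
    and class_ring_zero: "\<zero>\<^bsub>class_ring z\<^esub> = expr_class z Zero"
    and class_ring_mult: "\<lbrakk>wf_expr z a; wf_expr z b\<rbrakk> \<Longrightarrow>
      expr_class z a \<otimes>\<^bsub>class_ring z\<^esub> expr_class z b = expr_class z (Mul a b)"
    and class_ring_add: "\<lbrakk>wf_expr z a; wf_expr z b\<rbrakk> \<Longrightarrow>
      expr_class z a \<oplus>\<^bsub>class_ring z\<^esub> expr_class z b = expr_class z (Add a b)"
  using expr_class_op[of z a b Mul] expr_class_op[of z a b Add] expr_eq.mul_cong expr_eq.add_cong
  by (auto simp: class_ring_def)

lemmas class_ring_simps =
  class_ring_closed class_ring_one class_ring_zero class_ring_mult class_ring_add

lemma class_ring_carrier: "carrier (class_ring z) = expr_class z ` Collect (wf_expr z)"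
  by (simp add: class_ring_def)

lemma class_ringE:
  assumes "A \<in> carrier (class_ring z)"
  obtains a where "wf_expr z a" "A = expr_class z a"
  using assms by (auto simp: class_ring_carrier)

text \<open>\<open>Neg One\<close> is -1/1, so multiplication by it yields negatives;
  \<open>One \<in> snd z\<close> is what makes it well-formed.\<close>

lemma expr_minus:
  assumes z: "One \<in> snd z" and a: "wf_expr z a"
  shows "expr_eq z (Add (Mul (Neg One) a) a) Zero"
proof -
  note [simp] = z a
  have "expr_eq z (Add (Neg One) One) (Add (Mul One (Neg One)) One)"
    by (intro expr_eq.add_cong expr_eq.sym[OF expr_eq.mul_one] expr_eq.refl) simp_all
  also have "expr_eq z \<dots> Zero" by (rule expr_eq.inverse) simp_all
  finally have m: "expr_eq z (Add (Neg One) One) Zero" .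
  have "expr_eq z (Add (Mul (Neg One) a) a) (Add (Mul (Neg One) a) (Mul One a))"
    by (intro expr_eq.add_cong expr_eq.sym[OF expr_eq.mul_one] expr_eq.refl) simp_all
  also have "expr_eq z \<dots> (Mul (Add (Neg One) One) a)"
    by (intro expr_eq.sym[OF expr_eq.distrib]) simp_all
  also have "expr_eq z \<dots> (Mul Zero a)" using m by (intro expr_eq.mul_cong expr_eq.refl) simp_all
  also have "expr_eq z \<dots> Zero" by (rule expr_eq.mul_zero) simp
  finally show ?thesis .
qed

lemma cring_class_ring:
  assumes z: "One \<in> snd z"
  shows "cring (class_ring z)"
proof (rule cring_lawsI)
  note [simp] = z
  fix A assume "A \<in> carrier (class_ring z)"
  then obtain a where a: "wf_expr z a" "A = expr_class z a" by (rule class_ringE)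
  show "\<exists>B \<in> carrier (class_ring z). B \<oplus>\<^bsub>class_ring z\<^esub> A = \<zero>\<^bsub>class_ring z\<^esub>"
    using a expr_minus[OF z a(1)]
    by (intro bexI[of _ "expr_class z (Mul (Neg One) a)"])
      (simp_all add: class_ring_simps expr_class_eq_iff)
qed ((elim class_ringE)?, simp add: class_ring_simps expr_class_eq_iff
    expr_eq.add_assoc expr_eq.add_comm expr_eq.add_zero expr_eq.mul_assoc expr_eq.mul_comm
    expr_eq.mul_one expr_eq.distrib)+

text \<open>The inverse is the negative of \<open>Neg a\<close>, taken in the class ring. The
  hypothesis on \<open>z\<close> is only \<open>One \<in> snd z\<close>, because the lemma serves to
  prove that the points assigned to a cone are points of the limit.\<close>

lemma inverse_expr:
  assumes z: "One \<in> snd z" and a: "wf_expr z a" "a \<in> snd z"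
  shows "\<exists>b. expr_eq z (Mul a b) One"
proof -
  interpret cring "class_ring z" using cring_class_ring[OF z] .
  let ?a = "expr_class z a" and ?n = "expr_class z (Neg a)"
  have c: "?a \<in> carrier (class_ring z)" "?n \<in> carrier (class_ring z)"
    using a by (simp_all add: class_ring_closed)
  have "?a \<otimes>\<^bsub>class_ring z\<^esub> ?n \<oplus>\<^bsub>class_ring z\<^esub> \<one>\<^bsub>class_ring z\<^esub> = \<zero>\<^bsub>class_ring z\<^esub>"
    using a expr_eq.inverse[OF a] by (simp add: class_ring_simps expr_class_eq_iff)
  then have "?a \<otimes>\<^bsub>class_ring z\<^esub> ?n = \<ominus>\<^bsub>class_ring z\<^esub> \<one>\<^bsub>class_ring z\<^esub>"
    using c by (intro sum_zero_eq_neg) simp_all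
  then have "?a \<otimes>\<^bsub>class_ring z\<^esub> (\<ominus>\<^bsub>class_ring z\<^esub> ?n) = \<one>\<^bsub>class_ring z\<^esub>"
    using c by (simp add: r_minus)
  moreover obtain b where "wf_expr z b" "\<ominus>\<^bsub>class_ring z\<^esub> ?n = expr_class z b"
    using class_ringE[OF a_inv_closed[OF c(2)]] .
  ultimately have "expr_eq z (Mul a b) One" using a(1) by (simp add: class_ring_simps expr_class_eq_iff)
  then show ?thesis ..
qed

lemma limit_point_unit_iff:
  assumes z: "z \<in> limit_points" and a: "wf_expr z a"
  shows "a \<in> snd z \<longleftrightarrow> expr_class z a \<in> Units (class_ring z)"
proof -
  have "a \<in> snd z \<longleftrightarrow> (\<exists>b. wf_expr z b \<and> expr_eq z (Mul a b) One)"
    using limit_point_unit[OF z] expr_eq_wf by fastforce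
  also have "\<dots> \<longleftrightarrow> (\<exists>v \<in> carrier (class_ring z). expr_class z a \<otimes>\<^bsub>class_ring z\<^esub> v = \<one>\<^bsub>class_ring z\<^esub>)"
    using a by (auto simp: class_ring_carrier class_ring_simps expr_class_eq_iff)
  finally show ?thesis
    using a class_ring_closed unfolding cring.Units_iff[OF cring_class_ring[OF limit_point_One[OF z]]] by simp
qed

text \<open>A product in a commutative ring is a unit exactly if both factors are. This makes the
  basic open sets stable under intersection: those of \<open>h\<close> and \<open>k\<close> meet in
  that of \<open>Mul h k\<close>.\<close>

lemma limit_point_Mul:
  assumes z: "z \<in> limit_points"
  shows "Mul a b \<in> snd z \<longleftrightarrow> a \<in> snd z \<and> b \<in> snd z"
proof (cases "wf_expr z (Mul a b)")
  case True
  interpret cring "class_ring z" using cring_class_ring[OF limit_point_One[OF z]] .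
  have ab: "wf_expr z a" "wf_expr z b" using True by simp_all
  then have "expr_class z a \<in> carrier (class_ring z)" "expr_class z b \<in> carrier (class_ring z)"
    using class_ring_closed by simp_all
  then have "expr_class z (Mul a b) \<in> Units (class_ring z) \<longleftrightarrow>
      expr_class z a \<in> Units (class_ring z) \<and> expr_class z b \<in> Units (class_ring z)"
    using Units_mult_iff class_ring_mult[OF ab] by metis
  then show ?thesis using limit_point_unit_iff[OF z] ab True by simp
next
  case False
  then show ?thesis using limit_point_wf[OF z] by (metis wf_expr.simps(6))
qed

text \<open>The basic open sets are the \<open>{z. h \<in> snd z}\<close>; they also force the expression \<open>h\<close> to be defined.\<close>

definition nearby :: "('i, 'p, 's) limit_point \<Rightarrow> (('i, 'p, 's) limit_point \<Rightarrow> bool) \<Rightarrow> bool" where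
  "nearby z Q \<longleftrightarrow> (\<exists>h \<in> snd z. \<forall>w \<in> limit_points. h \<in> snd w \<longrightarrow> Q w)"

lemma nearby_conj:
  assumes "z \<in> limit_points" "nearby z Q" "nearby z R"
  shows "nearby z (\<lambda>w. Q w \<and> R w)"
proof -
  obtain h k where "h \<in> snd z" "\<forall>w \<in> limit_points. h \<in> snd w \<longrightarrow> Q w"
    "k \<in> snd z" "\<forall>w \<in> limit_points. k \<in> snd w \<longrightarrow> R w"
    using assms(2,3) unfolding nearby_def by auto
  then show ?thesis
    unfolding nearby_def using assms(1) by (intro bexI[of _ "Mul h k"]) (simp_all add: limit_point_Mul)
qed

lemma nearby_mono: "nearby z Q \<Longrightarrow> (\<And>w. w \<in> limit_points \<Longrightarrow> Q w \<Longrightarrow> R w) \<Longrightarrow> nearby z R"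
  unfolding nearby_def by blast

lemma nearby_True: "z \<in> limit_points \<Longrightarrow> (\<And>w. w \<in> limit_points \<Longrightarrow> Q w) \<Longrightarrow> nearby z Q"
  unfolding nearby_def using limit_point_One by blast

lemma nearby_self: "z \<in> limit_points \<Longrightarrow> nearby z Q \<Longrightarrow> Q z"
  unfolding nearby_def by blast

lemma nearby_mem: "a \<in> snd z \<Longrightarrow> nearby z (\<lambda>w. a \<in> snd w)"
  unfolding nearby_def by blast

section \<open>The topology of the limit\<close>

definition limit_topology :: "('i, 'p, 's) limit_point topology" where
  "limit_topology = topology (\<lambda>U. U \<subseteq> limit_points \<and> (\<forall>z \<in> U. nearby z (\<lambda>w. w \<in> U)))"

lemma openin_limit:
  "openin limit_topology U \<longleftrightarrow> U \<subseteq> limit_points \<and> (\<forall>z \<in> U. nearby z (\<lambda>w. w \<in> U))"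
proof -
  have "istopology (\<lambda>U. U \<subseteq> limit_points \<and> (\<forall>z \<in> U. nearby z (\<lambda>w. w \<in> U)))"
    unfolding istopology_def
  proof (intro conjI allI impI ballI)
    fix U V z
    assume U: "U \<subseteq> limit_points \<and> (\<forall>z \<in> U. nearby z (\<lambda>w. w \<in> U))"
      and V: "V \<subseteq> limit_points \<and> (\<forall>z \<in> V. nearby z (\<lambda>w. w \<in> V))"
    show "U \<inter> V \<subseteq> limit_points" using U by blast
    assume "z \<in> U \<inter> V"
    then show "nearby z (\<lambda>w. w \<in> U \<inter> V)"
      using nearby_conj[of z "\<lambda>w. w \<in> U" "\<lambda>w. w \<in> V"] U V by auto
  next
    fix \<U> z
    assume \<U>: "\<forall>U \<in> \<U>. U \<subseteq> limit_points \<and> (\<forall>z \<in> U. nearby z (\<lambda>w. w \<in> U))"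
    show "\<Union>\<U> \<subseteq> limit_points" using \<U> by blast
    assume "z \<in> \<Union>\<U>"
    then obtain U where U: "U \<in> \<U>" "z \<in> U" by blast
    then have "nearby z (\<lambda>w. w \<in> U)" using \<U> by simp
    then show "nearby z (\<lambda>w. w \<in> \<Union>\<U>)" by (rule nearby_mono) (rule UnionI[OF U(1)])
  qed
  then show ?thesis unfolding limit_topology_def by (simp add: topology_inverse')
qed

lemma openin_limit_Collect:
  "openin limit_topology {z \<in> limit_points. Q z} \<longleftrightarrow> (\<forall>z \<in> limit_points. Q z \<longrightarrow> nearby z Q)"
  unfolding openin_limit using nearby_mono[of _ Q "\<lambda>w. w \<in> limit_points \<and> Q w"]
    nearby_mono[of _ "\<lambda>w. w \<in> limit_points \<and> Q w" Q] by auto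

lemma topspace_limit: "topspace limit_topology = limit_points"
proof (rule equalityI)
  show "topspace limit_topology \<subseteq> limit_points" unfolding topspace_def openin_limit by blast
  show "limit_points \<subseteq> topspace limit_topology"
    by (rule openin_subset) (auto simp: openin_limit intro: nearby_True)
qed

text \<open>The unit section over \<open>U\<close> becomes the unit of the colimit wherever it is
  defined, so it is invertible exactly over the preimage of \<open>U\<close>. Preimages of open sets
  of the \<open>D i\<close> are therefore among the basic open sets, and the projections are
  continuous.\<close>

lemma gen_one_mem:
  assumes z: "z \<in> limit_points" and i: "i \<in> Ob J" "openin (space (D i)) U"
  shows "Gen (i, U, \<one>\<^bsub>sect (D i) U\<^esub>) \<in> snd z \<longleftrightarrow> fst z i \<in> U"
proof
  assume "Gen (i, U, \<one>\<^bsub>sect (D i) U\<^esub>) \<in> snd z"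
  then show "fst z i \<in> U" using limit_point_wf[OF z] by (fastforce simp: is_gen_def)
next
  assume "fst z i \<in> U"
  then have "is_gen (fst z) (i, U, \<one>\<^bsub>sect (D i) U\<^esub>)"
    using i cring.cring_simprules(6)[OF cring_sect[OF diagram_presheaf]] by (simp add: is_gen_def)
  then have "expr_eq z (Mul (Gen (i, U, \<one>\<^bsub>sect (D i) U\<^esub>)) One) (Mul One One)"
    by (intro expr_eq.mul_cong expr_eq.gen_one expr_eq.refl) simp_all
  also have "expr_eq z (Mul One One) One" by (simp add: expr_eq.mul_one)
  finally show "Gen (i, U, \<one>\<^bsub>sect (D i) U\<^esub>) \<in> snd z" using limit_point_unit[OF z] by auto
qed

lemma nearby_pt:
  assumes "z \<in> limit_points" "i \<in> Ob J" "openin (space (D i)) U" "fst z i \<in> U"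
  shows "nearby z (\<lambda>w. fst w i \<in> U)"
  using nearby_mono[OF nearby_mem[of "Gen (i, U, \<one>\<^bsub>sect (D i) U\<^esub>)" z]] gen_one_mem assms by simp

lemma nearby_is_gen:
  assumes "z \<in> limit_points" "is_gen (fst z) g"
  shows "nearby z (\<lambda>w. is_gen (fst w) g)"
proof -
  obtain i U s where g: "g = (i, U, s)" using prod_cases3 by blast
  have "nearby z (\<lambda>w. fst w i \<in> U)" using assms nearby_pt unfolding g is_gen_def by simp
  then show ?thesis by (rule nearby_mono) (use assms(2) in \<open>simp add: g is_gen_def\<close>)
qed

text \<open>An expression is defined where its generators are, which is open by the previous lemma,
  and where the arguments of \<open>Neg\<close> are units, which is a basic open condition.\<close>

lemma nearby_wf:
  assumes z: "z \<in> limit_points"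
  shows "wf_expr z a \<Longrightarrow> nearby z (\<lambda>w. wf_expr w a)"
  by (induction a)
    (use z in \<open>simp_all add: nearby_is_gen nearby_True nearby_conj nearby_mem\<close>)

text \<open>A derivation is finite and each of its side conditions, being a generator, being
  well-formed or being a unit, holds on a neighbourhood; on their intersection the same derivation
  can be repeated. This is why two sections with equal values at a point agree near that
  point.\<close>

lemma nearby_expr_eq:
  assumes z: "z \<in> limit_points" and "expr_eq z a b"
  shows "nearby z (\<lambda>w. expr_eq w a b)"
  using assms(2)
proof (induction rule: expr_eq.induct)
  case (refl a)
  then show ?case using nearby_mono[OF nearby_wf[OF z]] expr_eq.refl by metis
next
  case (sym a b)
  show ?case using sym.IH by (rule nearby_mono) (rule expr_eq.sym)
next
  case (trans a b c)
  show ?case using nearby_conj[OF z trans.IH] by (rule nearby_mono) (blast intro: expr_eq.trans)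
next
  case (add_cong a b c d)
  show ?case using nearby_conj[OF z add_cong.IH] by (rule nearby_mono) (blast intro: expr_eq.add_cong)
next
  case (mul_cong a b c d)
  show ?case using nearby_conj[OF z mul_cong.IH] by (rule nearby_mono) (blast intro: expr_eq.mul_cong)
next
  case (add_assoc a b c)
  then have "nearby z (\<lambda>w. wf_expr w (Mul a (Mul b c)))" by (intro nearby_wf[OF z]) simp
  then show ?case by (rule nearby_mono) (simp add: expr_eq.add_assoc)
next
  case (add_comm a b)
  then have "nearby z (\<lambda>w. wf_expr w (Mul a b))" by (intro nearby_wf[OF z]) simp
  then show ?case by (rule nearby_mono) (simp add: expr_eq.add_comm)
next
  case (add_zero a)
  then show ?case using nearby_mono[OF nearby_wf[OF z]] expr_eq.add_zero by metis
next
  case (mul_assoc a b c)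
  then have "nearby z (\<lambda>w. wf_expr w (Mul a (Mul b c)))" by (intro nearby_wf[OF z]) simp
  then show ?case by (rule nearby_mono) (simp add: expr_eq.mul_assoc)
next
  case (mul_comm a b)
  then have "nearby z (\<lambda>w. wf_expr w (Mul a b))" by (intro nearby_wf[OF z]) simp
  then show ?case by (rule nearby_mono) (simp add: expr_eq.mul_comm)
next
  case (mul_one a)
  then show ?case using nearby_mono[OF nearby_wf[OF z]] expr_eq.mul_one by metis
next
  case (distrib a b c)
  then have "nearby z (\<lambda>w. wf_expr w (Mul a (Mul b c)))" by (intro nearby_wf[OF z]) simp
  then show ?case by (rule nearby_mono) (simp add: expr_eq.distrib)
next
  case (mul_zero a)
  then show ?case using nearby_mono[OF nearby_wf[OF z]] expr_eq.mul_zero by metis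
next
  case (inverse a)
  then have "nearby z (\<lambda>w. wf_expr w (Neg a))" by (intro nearby_wf[OF z]) simp
  then show ?case by (rule nearby_mono) (simp add: expr_eq.inverse)
next
  case (gen_restr i U s V)
  then have "nearby z (\<lambda>w. is_gen (fst w) (i, U, s) \<and> fst w i \<in> V)"
    by (intro nearby_conj[OF z] nearby_is_gen[OF z] nearby_pt[OF z]) (simp_all add: is_gen_def)
  then show ?case by (rule nearby_mono) (use gen_restr in \<open>simp add: expr_eq.gen_restr\<close>)
next
  case (gen_one i U)
  then show ?case using nearby_mono[OF nearby_is_gen[OF z]] expr_eq.gen_one by metis
next
  case (gen_add i U s t)
  then show ?case
    using nearby_mono[OF nearby_conj[OF z nearby_is_gen[OF z] nearby_is_gen[OF z]]] expr_eq.gen_add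
    by metis
next
  case (gen_mul i U s t)
  then show ?case
    using nearby_mono[OF nearby_conj[OF z nearby_is_gen[OF z] nearby_is_gen[OF z]]] expr_eq.gen_mul
    by metis
next
  case (gen_arrow c V s)
  then have "nearby z (\<lambda>w. is_gen (fst w) (Cod J c, V, s) \<and>
      is_gen (fst w) (Dom J c, preim (D (Dom J c)) (\<delta> c) V, sec_map (\<delta> c) V s))"
    by (intro nearby_conj[OF z] nearby_is_gen[OF z])
  then show ?case by (rule nearby_mono) (use gen_arrow in \<open>simp add: expr_eq.gen_arrow\<close>)
qed

section \<open>The structure sheaf of the limit\<close>

declare split_paired_All [simp del] split_paired_Ex [simp del]

text \<open>The fixed value \<open>{}\<close> outside \<open>W\<close> makes sections over
  \<open>W\<close> equal as soon as they agree on \<open>W\<close>, and restriction only has to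
  reset values to \<open>{}\<close>. Since an expression already denotes a fraction, one expression
  per neighbourhood suffices and numerators need not be separated from denominators.\<close>

definition is_section :: "('i, 'p, 's) limit_point set \<Rightarrow> ('i, 'p, 's) limit_section \<Rightarrow> bool" where
  "is_section W \<sigma> \<longleftrightarrow> (\<forall>z. z \<notin> W \<longrightarrow> \<sigma> z = {}) \<and>
     (\<forall>z \<in> W. \<exists>a. nearby z (\<lambda>w. w \<in> W \<longrightarrow> wf_expr w a \<and> \<sigma> w = expr_class w a))"

definition section_ring :: "('i, 'p, 's) limit_point set \<Rightarrow> ('i, 'p, 's) limit_section ring" where
  "section_ring W =
     \<lparr>carrier = Collect (is_section W),
      mult = (\<lambda>\<sigma> \<tau> z. if z \<in> W then \<sigma> z \<otimes>\<^bsub>class_ring z\<^esub> \<tau> z else {}),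
      one = (\<lambda>z. if z \<in> W then \<one>\<^bsub>class_ring z\<^esub> else {}),
      zero = (\<lambda>z. if z \<in> W then \<zero>\<^bsub>class_ring z\<^esub> else {}),
      add = (\<lambda>\<sigma> \<tau> z. if z \<in> W then \<sigma> z \<oplus>\<^bsub>class_ring z\<^esub> \<tau> z else {})\<rparr>"

definition limit_space :: "(('i, 'p, 's) limit_point, ('i, 'p, 's) limit_section) ringed_space" where
  "limit_space = \<lparr>space = limit_topology, sect = section_ring,
     restr = (\<lambda>U V \<sigma> z. if z \<in> V then \<sigma> z else {})\<rparr>"

lemma limit_space_simps [simp]:
  "space limit_space = limit_topology" "sect limit_space = section_ring"
  "restr limit_space = (\<lambda>U V \<sigma> z. if z \<in> V then \<sigma> z else {})"
  "topspace limit_topology = limit_points"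
  by (simp_all add: limit_space_def topspace_limit)

lemma section_ring_simps:
  "\<sigma> \<in> carrier (section_ring W) \<longleftrightarrow> is_section W \<sigma>"
  "(\<sigma> \<otimes>\<^bsub>section_ring W\<^esub> \<tau>) = (\<lambda>z. if z \<in> W then \<sigma> z \<otimes>\<^bsub>class_ring z\<^esub> \<tau> z else {})"
  "(\<sigma> \<oplus>\<^bsub>section_ring W\<^esub> \<tau>) = (\<lambda>z. if z \<in> W then \<sigma> z \<oplus>\<^bsub>class_ring z\<^esub> \<tau> z else {})"
  "\<one>\<^bsub>section_ring W\<^esub> = (\<lambda>z. if z \<in> W then \<one>\<^bsub>class_ring z\<^esub> else {})"
  "\<zero>\<^bsub>section_ring W\<^esub> = (\<lambda>z. if z \<in> W then \<zero>\<^bsub>class_ring z\<^esub> else {})"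
  by (simp_all add: section_ring_def)

lemma openin_limit_points: "openin limit_topology W \<Longrightarrow> z \<in> W \<Longrightarrow> z \<in> limit_points"
  using openin_limit by blast

lemma section_outside: "is_section W \<sigma> \<Longrightarrow> z \<notin> W \<Longrightarrow> \<sigma> z = {}"
  by (simp add: is_section_def)

lemma section_nearby:
  assumes "openin limit_topology W" "is_section W \<sigma>" "z \<in> W"
  obtains a where "nearby z (\<lambda>w. w \<in> W \<and> wf_expr w a \<and> \<sigma> w = expr_class w a)"
proof -
  have z: "z \<in> limit_points" and W: "nearby z (\<lambda>w. w \<in> W)" using assms(1,3) openin_limit by auto
  obtain a where "nearby z (\<lambda>w. w \<in> W \<longrightarrow> wf_expr w a \<and> \<sigma> w = expr_class w a)"
    using assms(2,3) unfolding is_section_def by auto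
  from nearby_conj[OF z W this] have "nearby z (\<lambda>w. w \<in> W \<and> wf_expr w a \<and> \<sigma> w = expr_class w a)"
    by (rule nearby_mono) simp
  then show thesis by (rule that)
qed

lemma section_value:
  assumes "openin limit_topology W" "is_section W \<sigma>" "z \<in> W"
  obtains a where "wf_expr z a" "\<sigma> z = expr_class z a"
proof -
  obtain a where "nearby z (\<lambda>w. w \<in> W \<and> wf_expr w a \<and> \<sigma> w = expr_class w a)"
    using section_nearby[OF assms] .
  from nearby_self[OF openin_limit_points[OF assms(1,3)] this] show thesis using that by blast
qed

lemma section_closed:
  assumes "openin limit_topology W" "is_section W \<sigma>" "z \<in> W"
  shows "\<sigma> z \<in> carrier (class_ring z)"
  using section_value[OF assms] class_ring_closed by metis

lemma section_exprI:
  assumes "openin limit_topology W" "\<And>z. z \<in> W \<Longrightarrow> wf_expr z a"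
  shows "is_section W (\<lambda>z. if z \<in> W then expr_class z a else {})"
proof -
  have "nearby z (\<lambda>w. w \<in> W \<longrightarrow> wf_expr w a \<and> (if w \<in> W then expr_class w a else {}) = expr_class w a)"
    if "z \<in> W" for z
    using that assms openin_limit_points by (intro nearby_True) simp_all
  then show ?thesis
    unfolding is_section_def by (intro conjI allI impI ballI exI[of _ a]) simp_all
qed

text \<open>Here \<open>f\<close> is a ring operation at each point and \<open>g\<close> the
  corresponding constructor: where \<sigma> and \<tau> are given by \<open>a\<close> and
  \<open>b\<close>, the result is given by the one expression \<open>g a b\<close>.\<close>

lemma section_op:
  assumes W: "openin limit_topology W" and \<sigma>: "is_section W \<sigma>" and \<tau>: "is_section W \<tau>"
    and f: "\<And>w a b. wf_expr w a \<Longrightarrow> wf_expr w b \<Longrightarrow>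
      wf_expr w (g a b) \<and> f w (expr_class w a) (expr_class w b) = expr_class w (g a b)"
  shows "is_section W (\<lambda>z. if z \<in> W then f z (\<sigma> z) (\<tau> z) else {})"
proof -
  have "\<exists>c. nearby z (\<lambda>w. w \<in> W \<longrightarrow>
      wf_expr w c \<and> (if w \<in> W then f w (\<sigma> w) (\<tau> w) else {}) = expr_class w c)" if z: "z \<in> W" for z
  proof -
    obtain a where a: "nearby z (\<lambda>w. w \<in> W \<and> wf_expr w a \<and> \<sigma> w = expr_class w a)"
      using section_nearby[OF W \<sigma> z] .
    obtain b where b: "nearby z (\<lambda>w. w \<in> W \<and> wf_expr w b \<and> \<tau> w = expr_class w b)"
      using section_nearby[OF W \<tau> z] .
    show ?thesis
      by (rule exI[of _ "g a b"], rule nearby_mono[OF nearby_conj[OF openin_limit_points[OF W z] a b]])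
        (simp add: f)
  qed
  then show ?thesis unfolding is_section_def by simp
qed

lemma section_restr:
  assumes W: "openin limit_topology W" and V: "openin limit_topology V" "V \<subseteq> W" and \<sigma>: "is_section W \<sigma>"
  shows "is_section V (\<lambda>z. if z \<in> V then \<sigma> z else {})"
proof -
  have "\<exists>a. nearby z (\<lambda>w. w \<in> V \<longrightarrow> wf_expr w a \<and> (if w \<in> V then \<sigma> w else {}) = expr_class w a)"
    if z: "z \<in> V" for z
  proof -
    obtain a where a: "nearby z (\<lambda>w. w \<in> W \<and> wf_expr w a \<and> \<sigma> w = expr_class w a)"
      using section_nearby[OF W \<sigma> subsetD[OF V(2) z]] .
    show ?thesis by (rule exI[of _ a], rule nearby_mono[OF a]) simp
  qed
  then show ?thesis unfolding is_section_def by simp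
qed

lemma section_ops_closed:
  assumes W: "openin limit_topology W"
  shows "\<lbrakk>is_section W \<sigma>; is_section W \<tau>\<rbrakk> \<Longrightarrow> is_section W (\<lambda>z. if z \<in> W then \<sigma> z \<otimes>\<^bsub>class_ring z\<^esub> \<tau> z else {})"
    and "\<lbrakk>is_section W \<sigma>; is_section W \<tau>\<rbrakk> \<Longrightarrow> is_section W (\<lambda>z. if z \<in> W then \<sigma> z \<oplus>\<^bsub>class_ring z\<^esub> \<tau> z else {})"
    and "is_section W (\<lambda>z. if z \<in> W then \<one>\<^bsub>class_ring z\<^esub> else {})"
    and "is_section W (\<lambda>z. if z \<in> W then \<zero>\<^bsub>class_ring z\<^esub> else {})"
  unfolding class_ring_one class_ring_zero
  using section_op[OF W, of \<sigma> \<tau> Mul "\<lambda>z. mult (class_ring z)"]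
    section_op[OF W, of \<sigma> \<tau> Add "\<lambda>z. add (class_ring z)"]
    section_exprI[OF W, of One] section_exprI[OF W, of Zero]
  by (simp_all add: class_ring_simps)

lemma cring_section_ring:
  assumes W: "openin limit_topology W"
  shows "cring (section_ring W)"
proof -
  note cr = cring_class_ring[OF limit_point_One[OF openin_limit_points[OF W]]]
  note closed = section_closed[OF W]
  have r_one: "a \<otimes>\<^bsub>class_ring z\<^esub> \<one>\<^bsub>class_ring z\<^esub> = a"
    if "z \<in> W" "a \<in> carrier (class_ring z)" for z a
  proof -
    interpret cring "class_ring z" using cr[OF that(1)] .
    show ?thesis using that(2) by simp
  qed
  have inverse: "\<exists>\<tau> \<in> carrier (section_ring W). \<tau> \<oplus>\<^bsub>section_ring W\<^esub> \<sigma> = \<zero>\<^bsub>section_ring W\<^esub>"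
    if \<sigma>: "\<sigma> \<in> carrier (section_ring W)" for \<sigma>
  proof -
    \<comment> \<open>This is the section -1; its product with \<sigma> is the required
      negative.\<close>
    let ?m = "\<lambda>z. if z \<in> W then expr_class z (Neg One) else {}"
    have \<sigma>': "is_section W \<sigma>" using \<sigma> by (simp add: section_ring_simps)
    have m: "is_section W ?m"
      by (rule section_exprI[OF W]) (simp add: limit_point_One openin_limit_points[OF W])
    have "expr_class z (Neg One) \<otimes>\<^bsub>class_ring z\<^esub> \<sigma> z \<oplus>\<^bsub>class_ring z\<^esub> \<sigma> z = \<zero>\<^bsub>class_ring z\<^esub>" if z: "z \<in> W" for z
    proof -
      obtain a where a: "wf_expr z a" "\<sigma> z = expr_class z a" using section_value[OF W \<sigma>' z] .
      have zp: "z \<in> limit_points" using openin_limit_points[OF W z] .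
      show ?thesis
        using a expr_minus[OF limit_point_One[OF zp] a(1)] limit_point_One[OF zp] by (simp add: class_ring_simps expr_class_eq_iff)
    qed
    then show ?thesis
      using section_ops_closed(1)[OF W m \<sigma>']
      by (intro bexI[of _ "\<lambda>z. if z \<in> W then ?m z \<otimes>\<^bsub>class_ring z\<^esub> \<sigma> z else {}"])
        (simp_all add: section_ring_simps fun_eq_iff)
  qed
  show ?thesis
  proof (rule cring_lawsI)
    show "\<And>\<sigma>. \<sigma> \<in> carrier (section_ring W) \<Longrightarrow>
        \<exists>\<tau> \<in> carrier (section_ring W). \<tau> \<oplus>\<^bsub>section_ring W\<^esub> \<sigma> = \<zero>\<^bsub>section_ring W\<^esub>"
      using inverse .
  qed (simp_all add: section_ring_simps section_ops_closed[OF W] fun_eq_iff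
      cring.cring_simprules[OF cr] r_one closed section_outside)
qed

lemma presheaf_limit_space: "presheaf_of_rings limit_space"
proof -
  have "(\<lambda>\<sigma> z. if z \<in> V then \<sigma> z else {}) \<in> ring_hom (section_ring U) (section_ring V)"
    if "openin limit_topology U" "openin limit_topology V" "V \<subseteq> U" for U V
    using that by (intro ring_hom_memI) (auto simp: section_ring_simps section_restr fun_eq_iff)
  then show ?thesis
    unfolding presheaf_of_rings_def
    by (auto simp: cring_section_ring section_ring_simps section_outside fun_eq_iff)
qed

lemma sheaf_limit_space: "sheaf_condition limit_space"
  unfolding sheaf_condition_def limit_space_simps section_ring_simps
proof (intro allI impI)
  fix \<U> f
  assume o: "\<forall>U \<in> \<U>. openin limit_topology U" and f: "\<forall>U \<in> \<U>. is_section U (f U)"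
    and eq: "\<forall>U \<in> \<U>. \<forall>V \<in> \<U>. (\<lambda>z. if z \<in> U \<inter> V then f U z else {}) = (\<lambda>z. if z \<in> U \<inter> V then f V z else {})"
  \<comment> \<open>All members of this union coincide, so it selects the common value without a
    choice; off the cover it is the empty union, hence the prescribed value
    \<open>{}\<close>.\<close>
  define \<sigma> where "\<sigma> z = (\<Union>U \<in> {U \<in> \<U>. z \<in> U}. f U z)" for z
  have agree: "f U z = f V z" if "U \<in> \<U>" "V \<in> \<U>" "z \<in> U" "z \<in> V" for U V z
    using fun_cong[OF eq[rule_format, OF that(1,2)], of z] that by simp
  have \<sigma>: "\<sigma> z = f U z" if "U \<in> \<U>" "z \<in> U" for U z
    unfolding \<sigma>_def using agree that by blast
  have outside: "\<sigma> z = {}" if "z \<notin> \<Union>\<U>" for z using that unfolding \<sigma>_def by blast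
  have "is_section (\<Union>\<U>) \<sigma>"
    unfolding is_section_def
  proof (intro conjI allI impI ballI)
    show "\<sigma> z = {}" if "z \<notin> \<Union>\<U>" for z using outside that .
    fix z assume "z \<in> \<Union>\<U>"
    then obtain U where U: "U \<in> \<U>" "z \<in> U" by blast
    obtain a where a: "nearby z (\<lambda>w. w \<in> U \<and> wf_expr w a \<and> f U w = expr_class w a)"
      using section_nearby[of U "f U" z] U o f by blast
    have "nearby z (\<lambda>w. w \<in> \<Union>\<U> \<longrightarrow> wf_expr w a \<and> \<sigma> w = expr_class w a)"
      using a by (rule nearby_mono) (simp add: \<sigma>[OF U(1)])
    then show "\<exists>a. nearby z (\<lambda>w. w \<in> \<Union>\<U> \<longrightarrow> wf_expr w a \<and> \<sigma> w = expr_class w a)" by blast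
  qed
  moreover have "\<forall>U \<in> \<U>. (\<lambda>z. if z \<in> U then \<sigma> z else {}) = f U"
  proof (intro ballI ext)
    fix U z assume U: "U \<in> \<U>"
    show "(if z \<in> U then \<sigma> z else {}) = f U z"
      using \<sigma>[OF U] section_outside[of U "f U" z] f U by simp
  qed
  moreover have "\<tau> = \<sigma>" if \<tau>: "is_section (\<Union>\<U>) \<tau>" "\<forall>U \<in> \<U>. (\<lambda>z. if z \<in> U then \<tau> z else {}) = f U" for \<tau>
  proof
    fix z
    show "\<tau> z = \<sigma> z"
    proof (cases "z \<in> \<Union>\<U>")
      case True
      then obtain U where U: "U \<in> \<U>" "z \<in> U" by blast
      have "(if z \<in> U then \<tau> z else {}) = f U z" using fun_cong[OF bspec[OF \<tau>(2) U(1)], of z] by simp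
      then show ?thesis using \<sigma>[OF U] U(2) by simp
    next
      case False
      then show ?thesis using section_outside[OF \<tau>(1)] outside by simp
    qed
  qed
  ultimately show "\<exists>!s. is_section (\<Union>\<U>) s \<and> (\<forall>U \<in> \<U>. (\<lambda>z. if z \<in> U then s z else {}) = f U)"
    by blast
qed

lemma ringed_limit_space: "ringed_space limit_space"
  using presheaf_limit_space sheaf_limit_space by (simp add: ringed_space_def)

section \<open>The stalks of the limit\<close>

lemma openin_value_eq:
  assumes U: "openin limit_topology U" "is_section U \<sigma>" and V: "openin limit_topology V" "is_section V \<tau>"
  shows "openin limit_topology {z \<in> limit_points. z \<in> U \<and> z \<in> V \<and> \<sigma> z = \<tau> z}"
  unfolding openin_limit_Collect
proof (intro ballI impI)
  fix z assume z: "z \<in> limit_points" and zz: "z \<in> U \<and> z \<in> V \<and> \<sigma> z = \<tau> z"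
  obtain a where a: "nearby z (\<lambda>w. w \<in> U \<and> wf_expr w a \<and> \<sigma> w = expr_class w a)"
    using section_nearby[OF U] zz by blast
  obtain b where b: "nearby z (\<lambda>w. w \<in> V \<and> wf_expr w b \<and> \<tau> w = expr_class w b)"
    using section_nearby[OF V] zz by blast
  \<comment> \<open>Equality of the two values at \<open>z\<close> amounts to a derivation at
    \<open>z\<close>, which persists at nearby points.\<close>
  have "expr_eq z a b"
    using nearby_self[OF z a] nearby_self[OF z b] zz expr_class_eq_iff by metis
  note nearby_conj[OF z nearby_expr_eq[OF z this] nearby_conj[OF z a b]]
  then show "nearby z (\<lambda>z. z \<in> U \<and> z \<in> V \<and> \<sigma> z = \<tau> z)"
    by (rule nearby_mono) (simp add: expr_class_eq_iff)
qed

text \<open>Sections with the same value at \<open>z\<close> agree on an open set, so germs at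
  \<open>z\<close> correspond to values at \<open>z\<close>, and computations in the stalk become
  computations with expressions.\<close>

lemma limit_germ_eq_iff:
  assumes U: "openin limit_topology U" "is_section U \<sigma>" "z \<in> U"
    and V: "openin limit_topology V" "is_section V \<tau>" "z \<in> V"
  shows "germ limit_space z U \<sigma> = germ limit_space z V \<tau> \<longleftrightarrow> \<sigma> z = \<tau> z"
proof -
  have "germ limit_space z U \<sigma> = germ limit_space z V \<tau> \<longleftrightarrow>
    (\<exists>W. openin limit_topology W \<and> z \<in> W \<and> W \<subseteq> U \<inter> V \<and>
      (\<lambda>z. if z \<in> W then \<sigma> z else {}) = (\<lambda>z. if z \<in> W then \<tau> z else {}))"
    using germ_eq_iff[OF presheaf_limit_space, of U z \<sigma> V \<tau>] U V by (simp add: section_ring_simps)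
  also have "\<dots> \<longleftrightarrow> \<sigma> z = \<tau> z"
  proof
    assume eq: "\<sigma> z = \<tau> z"
    let ?N = "{z \<in> limit_points. z \<in> U \<and> z \<in> V \<and> \<sigma> z = \<tau> z}"
    have "(\<lambda>z. if z \<in> ?N then \<sigma> z else {}) = (\<lambda>z. if z \<in> ?N then \<tau> z else {})" by (rule ext) simp
    moreover have "z \<in> ?N" using eq U(3) V(3) openin_limit_points[OF U(1,3)] by simp
    ultimately show "\<exists>W. openin limit_topology W \<and> z \<in> W \<and> W \<subseteq> U \<inter> V \<and>
      (\<lambda>z. if z \<in> W then \<sigma> z else {}) = (\<lambda>z. if z \<in> W then \<tau> z else {})"
      using openin_value_eq[OF U(1,2) V(1,2)] by (intro exI[of _ ?N] conjI) blast+
  next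
    assume "\<exists>W. openin limit_topology W \<and> z \<in> W \<and> W \<subseteq> U \<inter> V \<and>
      (\<lambda>z. if z \<in> W then \<sigma> z else {}) = (\<lambda>z. if z \<in> W then \<tau> z else {})"
    then obtain W where "z \<in> W" "(\<lambda>z. if z \<in> W then \<sigma> z else {}) = (\<lambda>z. if z \<in> W then \<tau> z else {})"
      by (elim exE conjE)
    from fun_cong[OF this(2), of z] this(1) show "\<sigma> z = \<tau> z" by simp
  qed
  finally show ?thesis .
qed

text \<open>Each expression is a section over the largest set of points at which it is defined. Such
  sections represent all elements of the stalks and are the images of the sections of the
  \<open>D i\<close> under the projections.\<close>

definition expr_domain :: "('i, 'p, 's) colim_expr \<Rightarrow> ('i, 'p, 's) limit_point set" where
  "expr_domain a = {z \<in> limit_points. wf_expr z a}"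

definition expr_section :: "('i, 'p, 's) colim_expr \<Rightarrow> ('i, 'p, 's) limit_section" where
  "expr_section a = (\<lambda>z. if z \<in> expr_domain a then expr_class z a else {})"

definition expr_germ ::
    "('i, 'p, 's) limit_point \<Rightarrow> ('i, 'p, 's) colim_expr \<Rightarrow>
     (('i, 'p, 's) limit_point set \<times> ('i, 'p, 's) limit_section) set" where
  "expr_germ z a = germ limit_space z (expr_domain a) (expr_section a)"

lemma openin_expr_domain: "openin limit_topology (expr_domain a)"
  unfolding expr_domain_def openin_limit_Collect using nearby_wf by blast

lemma is_section_expr: "is_section (expr_domain a) (expr_section a)"
  unfolding expr_section_def
  by (rule section_exprI[OF openin_expr_domain]) (simp add: expr_domain_def)

lemma
  assumes z: "z \<in> limit_points" and a: "wf_expr z a"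
  shows mem_expr_domain: "z \<in> expr_domain a"
    and expr_section_value: "expr_section a z = expr_class z a"
  using assms by (simp_all add: expr_domain_def expr_section_def)

lemma expr_germ_eqI:
  assumes z: "z \<in> limit_points" and a: "wf_expr z a"
    and U: "openin limit_topology U" "is_section U \<sigma>" "z \<in> U" "\<sigma> z = expr_class z a"
  shows "germ limit_space z U \<sigma> = expr_germ z a"
  using limit_germ_eq_iff[OF U(1-3) openin_expr_domain is_section_expr mem_expr_domain[OF z a]]
    expr_section_value[OF z a] U(4) by (simp add: expr_germ_def)

lemma expr_germ_eq_iff:
  assumes z: "z \<in> limit_points" and a: "wf_expr z a" and b: "wf_expr z b"
  shows "expr_germ z a = expr_germ z b \<longleftrightarrow> expr_eq z a b"
  using limit_germ_eq_iff[OF openin_expr_domain is_section_expr mem_expr_domain[OF z a]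
      openin_expr_domain is_section_expr mem_expr_domain[OF z b]]
    expr_section_value[OF z a] expr_section_value[OF z b] expr_class_eq_iff[OF a]
  by (simp add: expr_germ_def)

lemma expr_germ_closed:
  "z \<in> limit_points \<Longrightarrow> wf_expr z a \<Longrightarrow> expr_germ z a \<in> carrier (stalk limit_space z)"
  unfolding expr_germ_def
  by (rule germ_closed)
    (simp_all add: openin_expr_domain mem_expr_domain section_ring_simps is_section_expr)

lemma expr_germE:
  assumes "A \<in> carrier (stalk limit_space z)"
  obtains a where "wf_expr z a" "A = expr_germ z a"
proof -
  obtain U \<sigma> where U: "openin limit_topology U" "z \<in> U" "is_section U \<sigma>" "A = germ limit_space z U \<sigma>"
    using assms by (auto simp: stalk_carrier section_ring_simps)
  obtain a where a: "wf_expr z a" "\<sigma> z = expr_class z a" using section_value[OF U(1,3,2)] .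
  then show thesis
    using that expr_germ_eqI[OF openin_limit_points[OF U(1,2)] a(1) U(1,3,2) a(2)] U(4) by simp
qed

lemma
  assumes z: "z \<in> limit_points" and a: "wf_expr z a" and b: "wf_expr z b"
  shows expr_germ_mult: "expr_germ z a \<otimes>\<^bsub>stalk limit_space z\<^esub> expr_germ z b = expr_germ z (Mul a b)"
    and expr_germ_add: "expr_germ z a \<oplus>\<^bsub>stalk limit_space z\<^esub> expr_germ z b = expr_germ z (Add a b)"
proof -
  define W where "W = expr_domain a \<inter> expr_domain b"
  define \<sigma> where "\<sigma> = (\<lambda>z. if z \<in> W then expr_section a z else {})"
  define \<tau> where "\<tau> = (\<lambda>z. if z \<in> W then expr_section b z else {})"
  have W: "openin limit_topology W" "z \<in> W"
    unfolding W_def using openin_expr_domain mem_expr_domain[OF z] a b by (auto simp: openin_Int)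
  have s: "is_section W \<sigma>" "is_section W \<tau>"
    unfolding \<sigma>_def \<tau>_def using section_restr[OF openin_expr_domain W(1) _ is_section_expr]
    by (simp_all add: W_def)
  have v: "\<sigma> z = expr_class z a" "\<tau> z = expr_class z b"
    using W(2) expr_section_value[OF z] a b by (simp_all add: \<sigma>_def \<tau>_def)
  have g: "expr_germ z a = germ limit_space z W \<sigma>" "expr_germ z b = germ limit_space z W \<tau>"
    using expr_germ_eqI[OF z a W(1) s(1) W(2) v(1)] expr_germ_eqI[OF z b W(1) s(2) W(2) v(2)] by simp_all
  note ops = section_ops_closed[OF W(1)]
  show "expr_germ z a \<otimes>\<^bsub>stalk limit_space z\<^esub> expr_germ z b = expr_germ z (Mul a b)"
    using germ_mult[OF presheaf_limit_space, of W z \<sigma> \<tau>] W s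
      expr_germ_eqI[OF z _ W(1) ops(1)[OF s] W(2), of "Mul a b"]
    by (simp add: g section_ring_simps v a b class_ring_simps)
  show "expr_germ z a \<oplus>\<^bsub>stalk limit_space z\<^esub> expr_germ z b = expr_germ z (Add a b)"
    using germ_add[OF presheaf_limit_space, of W z \<sigma> \<tau>] W s
      expr_germ_eqI[OF z _ W(1) ops(2)[OF s] W(2), of "Add a b"]
    by (simp add: g section_ring_simps v a b class_ring_simps)
qed

lemma
  assumes z: "z \<in> limit_points"
  shows expr_germ_One: "expr_germ z One = \<one>\<^bsub>stalk limit_space z\<^esub>"
    and expr_germ_Zero: "expr_germ z Zero = \<zero>\<^bsub>stalk limit_space z\<^esub>"
proof -
  have o: "openin limit_topology limit_points" using openin_topspace[of limit_topology] by simp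
  show "expr_germ z One = \<one>\<^bsub>stalk limit_space z\<^esub>"
    using expr_germ_eqI[OF z _ o section_ops_closed(3)[OF o] z, of One]
      germ_one[OF presheaf_limit_space, of limit_points z] z o
    by (simp add: section_ring_simps class_ring_simps)
  show "expr_germ z Zero = \<zero>\<^bsub>stalk limit_space z\<^esub>"
    using expr_germ_eqI[OF z _ o section_ops_closed(4)[OF o] z, of Zero]
      germ_zero[OF presheaf_limit_space, of limit_points z] z o
    by (simp add: section_ring_simps class_ring_simps)
qed

lemma cring_limit_stalk: "z \<in> limit_points \<Longrightarrow> cring (stalk limit_space z)"
  using cring_stalk[OF presheaf_limit_space] by simp

lemma expr_germ_unit_iff:
  assumes z: "z \<in> limit_points" and a: "wf_expr z a"
  shows "expr_germ z a \<in> Units (stalk limit_space z) \<longleftrightarrow> a \<in> snd z"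
proof -
  have "(\<exists>B \<in> carrier (stalk limit_space z). expr_germ z a \<otimes>\<^bsub>stalk limit_space z\<^esub> B = \<one>\<^bsub>stalk limit_space z\<^esub>)
    \<longleftrightarrow> (\<exists>b. wf_expr z b \<and> expr_germ z (Mul a b) = expr_germ z One)" (is "?L \<longleftrightarrow> ?R")
  proof
    assume ?L
    then obtain B where B: "B \<in> carrier (stalk limit_space z)"
      "expr_germ z a \<otimes>\<^bsub>stalk limit_space z\<^esub> B = \<one>\<^bsub>stalk limit_space z\<^esub>" by blast
    obtain b where "wf_expr z b" "B = expr_germ z b" using expr_germE[OF B(1)] .
    then show ?R using B(2) a expr_germ_mult[OF z] expr_germ_One[OF z] by auto
  next
    assume ?R
    then show ?L using a expr_germ_mult[OF z] expr_germ_One[OF z] expr_germ_closed[OF z] by metis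
  qed
  also have "\<dots> \<longleftrightarrow> (\<exists>b. wf_expr z b \<and> expr_eq z (Mul a b) One)"
    by (intro ex_cong1 conj_cong refl expr_germ_eq_iff[OF z]) (simp_all add: a)
  also have "\<dots> \<longleftrightarrow> a \<in> snd z"
    using limit_point_unit[OF z] expr_eq_wf by fastforce
  finally show ?thesis
    using expr_germ_closed[OF z a] cring.Units_iff[OF cring_limit_stalk[OF z]] by simp
qed

text \<open>Every germ is that of an expression, and it is a unit exactly if the expression lies in
  \<open>snd z\<close>. By \<open>local_ring_iff\<close>, locality thus comes down to the conditions
  on \<open>Zero\<close> and \<open>Add\<close> that are built into the points.\<close>

lemma locally_ringed_limit_space: "locally_ringed_space limit_space"
  unfolding locally_ringed_space_def
proof (intro conjI ballI ringed_limit_space)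
  fix z assume "z \<in> topspace (space limit_space)"
  then have z: "z \<in> limit_points" by simp
  show "local_ring (stalk limit_space z)"
    unfolding local_ring_iff
  proof (intro conjI ballI impI)
    show "cring (stalk limit_space z)" using cring_limit_stalk[OF z] .
    have "\<not> expr_eq z One Zero"
    proof
      assume "expr_eq z One Zero"
      then have "expr_germ z One = expr_germ z Zero" using expr_germ_eq_iff[OF z] by simp
      then show False
        using expr_germ_unit_iff[OF z, of Zero] expr_germ_unit_iff[OF z, of One]
          limit_point_Zero[OF z] limit_point_One[OF z] by simp
    qed
    then show "\<one>\<^bsub>stalk limit_space z\<^esub> \<noteq> \<zero>\<^bsub>stalk limit_space z\<^esub>"
      using expr_germ_eq_iff[OF z, of One Zero] expr_germ_One[OF z] expr_germ_Zero[OF z] by simp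
    fix A B
    assume A: "A \<in> carrier (stalk limit_space z)" and B: "B \<in> carrier (stalk limit_space z)"
      and AB: "A \<oplus>\<^bsub>stalk limit_space z\<^esub> B \<in> Units (stalk limit_space z)"
    obtain a where a: "wf_expr z a" "A = expr_germ z a" using expr_germE[OF A] .
    obtain b where b: "wf_expr z b" "B = expr_germ z b" using expr_germE[OF B] .
    have "Add a b \<in> snd z"
      using AB a b expr_germ_add[OF z a(1) b(1)] expr_germ_unit_iff[OF z, of "Add a b"] by simp
    then show "A \<in> Units (stalk limit_space z) \<or> B \<in> Units (stalk limit_space z)"
      using limit_point_Add[OF z] expr_germ_unit_iff[OF z] a b by blast
  qed
qed

section \<open>The cone of projections\<close>

definition projection :: "'i \<Rightarrow> (('i, 'p, 's) limit_point, ('i, 'p, 's) limit_section, 'p, 's) rs_map" where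
  "projection i = \<lparr>pt_map = (\<lambda>z. fst z i), sec_map = (\<lambda>U s. expr_section (Gen (i, U, s)))\<rparr>"

lemma projection_simps [simp]:
  "pt_map (projection i) z = fst z i" "sec_map (projection i) U s = expr_section (Gen (i, U, s))"
  by (simp_all add: projection_def)

lemma expr_domain_gen:
  assumes "i \<in> Ob J" "openin (space (D i)) U" "s \<in> carrier (sect (D i) U)"
  shows "expr_domain (Gen (i, U, s)) = preim limit_space (projection i) U"
  using assms by (simp add: expr_domain_def preim_def is_gen_def)

lemma expr_section_eqI:
  assumes "expr_domain a = expr_domain b" "\<And>z. z \<in> expr_domain a \<Longrightarrow> expr_eq z a b"
  shows "expr_section a = expr_section b"
proof
  fix z
  show "expr_section a z = expr_section b z"
  proof (cases "z \<in> expr_domain a")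
    case True
    then have "wf_expr z a" by (simp add: expr_domain_def)
    then have "expr_class z a = expr_class z b" using assms(2)[OF True] by (simp add: expr_class_eq_iff)
    then show ?thesis using assms(1) by (simp add: expr_section_def)
  qed (use assms(1) in \<open>simp add: expr_section_def\<close>)
qed

text \<open>A section of \<open>D i\<close> goes to the corresponding generator, whose domain is the
  required preimage. The rules \<open>gen_mul\<close>, \<open>gen_add\<close> and
  \<open>gen_one\<close> give the homomorphisms, and \<open>gen_restr\<close> gives
  naturality.\<close>

lemma projection_ringed_morphism:
  assumes i: "i \<in> Ob J"
  shows "ringed_space_morphism limit_space (D i) (projection i)"
  unfolding ringed_space_morphism_def
proof (intro conjI allI impI ballI)
  note P = diagram_presheaf[OF i]
  show "continuous_map (space limit_space) (space (D i)) (pt_map (projection i))"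
    using nearby_pt[OF _ i] limit_point_pt[OF _ i]
    by (auto simp: continuous_map_def openin_limit_Collect)
  fix V assume V: "openin (space (D i)) V"
  interpret V: cring "sect (D i) V" using cring_sect[OF P V] .
  let ?W = "preim limit_space (projection i) V"
  have dom: "expr_domain (Gen (i, V, s)) = ?W" if "s \<in> carrier (sect (D i) V)" for s
    using expr_domain_gen[OF i V that] .
  have W: "openin limit_topology ?W" using openin_expr_domain dom[OF V.one_closed] by metis
  have gen: "is_gen (fst z) (i, V, s)" "z \<in> limit_points"
    if "z \<in> ?W" "s \<in> carrier (sect (D i) V)" for z s
    using that i V by (auto simp: preim_def is_gen_def)
  have val: "expr_section (Gen (i, V, s)) z = (if z \<in> ?W then expr_class z (Gen (i, V, s)) else {})"
    if "s \<in> carrier (sect (D i) V)" for s z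
    using dom[OF that] by (simp add: expr_section_def)
  show "sec_map (projection i) V \<in> ring_hom (sect (D i) V) (sect limit_space ?W)"
  proof (rule ring_hom_memI)
    fix s assume s: "s \<in> carrier (sect (D i) V)"
    show "sec_map (projection i) V s \<in> carrier (sect limit_space ?W)"
      using is_section_expr[of "Gen (i, V, s)"] dom[OF s] by (simp add: section_ring_simps)
    fix t assume t: "t \<in> carrier (sect (D i) V)"
    have "expr_class z (Gen (i, V, s \<otimes>\<^bsub>sect (D i) V\<^esub> t)) = expr_class z (Mul (Gen (i, V, s)) (Gen (i, V, t)))"
      if z: "z \<in> ?W" for z
      using expr_eq.gen_mul[OF gen(1)[OF z s] gen(1)[OF z t]] gen(1)[OF z] s t
      by (simp add: expr_class_eq_iff)
    then show "sec_map (projection i) V (s \<otimes>\<^bsub>sect (D i) V\<^esub> t) =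
        sec_map (projection i) V s \<otimes>\<^bsub>sect limit_space ?W\<^esub> sec_map (projection i) V t"
      using s t gen(1) by (simp add: fun_eq_iff section_ring_simps val class_ring_simps)
    have "expr_class z (Gen (i, V, s \<oplus>\<^bsub>sect (D i) V\<^esub> t)) = expr_class z (Add (Gen (i, V, s)) (Gen (i, V, t)))"
      if z: "z \<in> ?W" for z
      using expr_eq.gen_add[OF gen(1)[OF z s] gen(1)[OF z t]] gen(1)[OF z] s t
      by (simp add: expr_class_eq_iff)
    then show "sec_map (projection i) V (s \<oplus>\<^bsub>sect (D i) V\<^esub> t) =
        sec_map (projection i) V s \<oplus>\<^bsub>sect limit_space ?W\<^esub> sec_map (projection i) V t"
      using s t gen(1) by (simp add: fun_eq_iff section_ring_simps val class_ring_simps)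
  next
    have "expr_class z (Gen (i, V, \<one>\<^bsub>sect (D i) V\<^esub>)) = expr_class z One" if z: "z \<in> ?W" for z
      using expr_eq.gen_one[OF gen(1)[OF z V.one_closed]] gen(1)[OF z V.one_closed]
      by (simp add: expr_class_eq_iff)
    then show "sec_map (projection i) V \<one>\<^bsub>sect (D i) V\<^esub> = \<one>\<^bsub>sect limit_space ?W\<^esub>"
      by (simp add: fun_eq_iff section_ring_simps val class_ring_simps)
  qed
  fix V' s assume V': "openin (space (D i)) V'" "V' \<subseteq> V" and s: "s \<in> carrier (sect (D i) V)"
  let ?s' = "restr (D i) V V' s"
  have s': "?s' \<in> carrier (sect (D i) V')" using restr_closed[OF P V V'(1,2) s] .
  have dom': "expr_domain (Gen (i, V', ?s')) = preim limit_space (projection i) V'"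
    using expr_domain_gen[OF i V'(1) s'] .
  have sub: "preim limit_space (projection i) V' \<subseteq> ?W" using V'(2) by (auto simp: preim_def)
  have "expr_class z (Gen (i, V', ?s')) = expr_class z (Gen (i, V, s))"
    if z: "z \<in> preim limit_space (projection i) V'" for z
  proof -
    have g: "is_gen (fst z) (i, V, s)" using gen(1)[OF subsetD[OF sub z] s] .
    have "fst z i \<in> V'" using z by (simp add: preim_def)
    then have "expr_eq z (Gen (i, V, s)) (Gen (i, V', ?s'))" using expr_eq.gen_restr[OF g V'] by simp
    then show ?thesis using g by (simp add: expr_class_eq_iff[symmetric])
  qed
  moreover have "z \<in> ?W" if "z \<in> preim limit_space (projection i) V'" for z using subsetD[OF sub that] .
  ultimately show "sec_map (projection i) V' ?s' =
      restr limit_space ?W (preim limit_space (projection i) V') (sec_map (projection i) V s)"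
    by (simp add: fun_eq_iff expr_section_def dom[OF s] dom')
qed

text \<open>Locality is the last condition in \<open>limit_points\<close>: if a generator is a unit
  at \<open>z\<close>, then so is its germ in \<open>D i\<close>.\<close>

lemma projection_morphism:
  assumes i: "i \<in> Ob J"
  shows "lrs_morphism limit_space (D i) (projection i)"
  unfolding lrs_morphism_iff
proof (intro conjI ballI allI impI locally_ringed_limit_space diagram_space[OF i] projection_ringed_morphism[OF i])
  fix z V s
  assume z: "z \<in> topspace (space limit_space)" and V: "openin (space (D i)) V"
    "pt_map (projection i) z \<in> V" "s \<in> carrier (sect (D i) V)"
    and unit: "germ limit_space z (preim limit_space (projection i) V) (sec_map (projection i) V s)
      \<in> Units (stalk limit_space z)"
  have "wf_expr z (Gen (i, V, s))" using V i by (simp add: is_gen_def)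
  then have "Gen (i, V, s) \<in> snd z"
    using unit expr_germ_unit_iff[of z "Gen (i, V, s)"] z expr_domain_gen[OF i V(1,3)]
    by (simp add: expr_germ_def)
  then show "germ (D i) (pt_map (projection i) z) V s \<in> Units (stalk (D i) (pt_map (projection i) z))"
    using limit_point_Gen z by simp
qed

text \<open>On points this is compatibility of the family, on sections it is the rule
  \<open>gen_arrow\<close>.\<close>

lemma limit_cone: "lrs_cone J D \<delta> limit_space projection"
  unfolding lrs_cone_def
proof (intro conjI ballI locally_ringed_limit_space projection_morphism)
  fix c assume c: "c \<in> Ar J"
  note f = diagram_morphism[OF c]
  have "expr_section (Gen (Dom J c, preim (D (Dom J c)) (\<delta> c) V, sec_map (\<delta> c) V s)) =
      expr_section (Gen (Cod J c, V, s))"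
    if V: "openin (space (D (Cod J c))) V" "s \<in> carrier (sect (D (Cod J c)) V)" for V s
  proof (rule expr_section_eqI)
    have i: "Dom J c \<in> Ob J" "Cod J c \<in> Ob J" using Dom_Ob[OF c] Cod_Ob[OF c] .
    let ?P = "preim (D (Dom J c)) (\<delta> c) V" and ?s = "sec_map (\<delta> c) V s"
    have P: "openin (space (D (Dom J c))) ?P" "?s \<in> carrier (sect (D (Dom J c)) ?P)"
      using openin_preim[OF f V(1)] ring_hom_closed[OF morphism_sec[OF f V(1)] V(2)] .
    show dom: "expr_domain (Gen (Dom J c, ?P, ?s)) = expr_domain (Gen (Cod J c, V, s))"
      unfolding expr_domain_gen[OF i(1) P] expr_domain_gen[OF i(2) V]
      using limit_point_arrow[OF _ c] limit_point_pt[OF _ i(1)] by (auto simp: preim_def)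
    fix z assume z: "z \<in> expr_domain (Gen (Dom J c, ?P, ?s))"
    then have "z \<in> expr_domain (Gen (Cod J c, V, s))" using dom by simp
    with z show "expr_eq z (Gen (Dom J c, ?P, ?s)) (Gen (Cod J c, V, s))"
      by (intro expr_eq.sym[OF expr_eq.gen_arrow[OF c]]) (simp_all add: expr_domain_def)
  qed
  then show "morphism_eq limit_space (D (Cod J c))
      (comp_morphism (D (Dom J c)) (\<delta> c) (projection (Dom J c))) (projection (Cod J c))"
    using limit_point_arrow[OF _ c] by (simp add: morphism_eq_def comp_morphism_def)
qed

end

section \<open>The universal property\<close>

text \<open>The hypothesis on \<open>y\<close> is the relation imposed on \<open>Neg\<close> by the
  rule \<open>inverse\<close>. It determines the image of \<open>Neg a\<close> under any
  homomorphism that makes \<open>a\<close> invertible, which is needed for the uniqueness of the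
  induced map.\<close>

lemma (in cring) minus_inverse_unique:
  assumes "x \<in> Units R" "y \<in> carrier R" "x \<otimes> y \<oplus> \<one> = \<zero>"
  shows "y = \<ominus> (inv x)"
proof -
  have x: "x \<in> carrier R" using assms(1) by auto
  have xy: "x \<otimes> y = \<ominus> \<one>" using assms x by (intro sum_zero_eq_neg) simp_all
  have "y = inv x \<otimes> (x \<otimes> y)" using assms(1,2) x by (simp add: m_assoc[symmetric])
  then show ?thesis using assms(1) unfolding xy by (simp add: r_minus)
qed

locale lrs_diagram_cone = lrs_diagram J D \<delta>
  for J :: "('i, 'j) cat"
    and D :: "'i \<Rightarrow> ('p, 's) ringed_space"
    and \<delta> :: "'j \<Rightarrow> ('p, 's, 'p, 's) rs_map" +
  fixes X :: "('q, 't) ringed_space"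
    and \<xi> :: "'i \<Rightarrow> ('q, 't, 'p, 's) rs_map"
  assumes cone: "lrs_cone J D \<delta> X \<xi>"
begin

lemma
  shows cone_lrs: "locally_ringed_space X"
    and cone_morphism: "i \<in> Ob J \<Longrightarrow> lrs_morphism X (D i) (\<xi> i)"
    and cone_arrow: "c \<in> Ar J \<Longrightarrow> morphism_eq X (D (Cod J c))
        (comp_morphism (D (Dom J c)) (\<delta> c) (\<xi> (Dom J c))) (\<xi> (Cod J c))"
  using cone by (simp_all add: lrs_cone_def)

lemma
  shows cone_ringed: "ringed_space X" and cone_presheaf: "presheaf_of_rings X"
    and cone_local_ring: "p \<in> topspace (space X) \<Longrightarrow> local_ring (stalk X p)"
  using locally_ringed_spaceD[OF cone_lrs] by simp_all

lemma cone_cring: "p \<in> topspace (space X) \<Longrightarrow> cring (stalk X p)"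
  using cring_stalk[OF cone_presheaf] .

lemma cone_ringed_morphism: "i \<in> Ob J \<Longrightarrow> ringed_space_morphism X (D i) (\<xi> i)"
  using cone_morphism by (simp add: lrs_morphism_def)

lemma
  assumes c: "c \<in> Ar J"
  shows cone_arrow_pt: "p \<in> topspace (space X) \<Longrightarrow>
      pt_map (\<delta> c) (pt_map (\<xi> (Dom J c)) p) = pt_map (\<xi> (Cod J c)) p"
    and cone_arrow_sec: "\<lbrakk>openin (space (D (Cod J c))) V; s \<in> carrier (sect (D (Cod J c)) V)\<rbrakk> \<Longrightarrow>
      sec_map (\<xi> (Dom J c)) (preim (D (Dom J c)) (\<delta> c) V) (sec_map (\<delta> c) V s) = sec_map (\<xi> (Cod J c)) V s"
  using cone_arrow[OF c] by (simp_all add: morphism_eq_def comp_morphism_def)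

lemma preim_cone_arrow:
  assumes c: "c \<in> Ar J"
  shows "preim X (\<xi> (Dom J c)) (preim (D (Dom J c)) (\<delta> c) V) = preim X (\<xi> (Cod J c)) V"
  using cone_arrow_pt[OF c] morphism_pt[OF cone_ringed_morphism[OF Dom_Ob[OF c]]]
  by (auto simp: preim_def)

section \<open>The map on points induced by a cone\<close>

definition cone_pt :: "'q \<Rightarrow> 'i \<Rightarrow> 'p" where
  "cone_pt p i = (if i \<in> Ob J then pt_map (\<xi> i) p else undefined)"

text \<open>The homomorphism from the colimit to the stalk of \<open>X\<close> at \<open>p\<close>
  that the cone induces, extended to those fractions whose denominators become units.\<close>

primrec expr_value :: "'q \<Rightarrow> ('i, 'p, 's) colim_expr \<Rightarrow> ('q set \<times> 't) set" where
  "expr_value p (Gen g) = (case g of (i, U, s) \<Rightarrow> germ X p (preim X (\<xi> i) U) (sec_map (\<xi> i) U s))"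
| "expr_value p Zero = \<zero>\<^bsub>stalk X p\<^esub>"
| "expr_value p One = \<one>\<^bsub>stalk X p\<^esub>"
| "expr_value p (Neg a) = \<ominus>\<^bsub>stalk X p\<^esub> (inv\<^bsub>stalk X p\<^esub> expr_value p a)"
| "expr_value p (Add a b) = expr_value p a \<oplus>\<^bsub>stalk X p\<^esub> expr_value p b"
| "expr_value p (Mul a b) = expr_value p a \<otimes>\<^bsub>stalk X p\<^esub> expr_value p b"

text \<open>Well-formedness at a point refers to its set of units, while the units at the point
  assigned to \<open>p\<close> are to be the well-formed expressions with invertible value.
  Recursion on the expression breaks this circle; \<open>has_value_iff\<close> then identifies the
  two notions.\<close>

primrec has_value :: "'q \<Rightarrow> ('i, 'p, 's) colim_expr \<Rightarrow> bool" where
  "has_value p (Gen g) \<longleftrightarrow> is_gen (cone_pt p) g"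
| "has_value p Zero \<longleftrightarrow> True"
| "has_value p One \<longleftrightarrow> True"
| "has_value p (Neg a) \<longleftrightarrow> has_value p a \<and> expr_value p a \<in> Units (stalk X p)"
| "has_value p (Add a b) \<longleftrightarrow> has_value p a \<and> has_value p b"
| "has_value p (Mul a b) \<longleftrightarrow> has_value p a \<and> has_value p b"

definition lift_pt :: "'q \<Rightarrow> ('i, 'p, 's) limit_point" where
  "lift_pt p = (cone_pt p, {a. has_value p a \<and> expr_value p a \<in> Units (stalk X p)})"

lemma fst_lift_pt [simp]: "fst (lift_pt p) = cone_pt p"
  by (simp add: lift_pt_def)

lemma has_value_iff: "has_value p a \<longleftrightarrow> wf_expr (lift_pt p) a"
  by (induction a) (auto simp: lift_pt_def)

lemma mem_lift_pt: "a \<in> snd (lift_pt p) \<longleftrightarrow> wf_expr (lift_pt p) a \<and> expr_value p a \<in> Units (stalk X p)"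
  unfolding has_value_iff[symmetric] by (simp add: lift_pt_def)

lemma lift_gen:
  assumes p: "p \<in> topspace (space X)" and g: "is_gen (cone_pt p) (i, U, s)"
  shows "i \<in> Ob J" "openin (space (D i)) U" "s \<in> carrier (sect (D i) U)"
    "openin (space X) (preim X (\<xi> i) U)" "p \<in> preim X (\<xi> i) U"
    "sec_map (\<xi> i) U s \<in> carrier (sect X (preim X (\<xi> i) U))"
proof -
  show i: "i \<in> Ob J" and U: "openin (space (D i)) U" and s: "s \<in> carrier (sect (D i) U)"
    using g by (simp_all add: is_gen_def)
  note f = cone_ringed_morphism[OF i]
  show "openin (space X) (preim X (\<xi> i) U)" using openin_preim[OF f U] .
  show "p \<in> preim X (\<xi> i) U" using g p i by (simp add: is_gen_def cone_pt_def preim_def)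
  show "sec_map (\<xi> i) U s \<in> carrier (sect X (preim X (\<xi> i) U))"
    using ring_hom_closed[OF morphism_sec[OF f U] s] .
qed

lemma expr_value_closed:
  assumes p: "p \<in> topspace (space X)"
  shows "wf_expr (lift_pt p) a \<Longrightarrow> expr_value p a \<in> carrier (stalk X p)"
proof (induction a)
  case (Gen g)
  obtain i U s where g: "g = (i, U, s)" using prod_cases3 by blast
  have "is_gen (cone_pt p) (i, U, s)" using Gen by (simp add: g)
  from lift_gen[OF p this] show ?case by (simp add: g germ_closed)
qed (use cone_cring[OF p] in
    \<open>simp_all add: mem_lift_pt cring.cring_simprules monoid.Units_inv_closed cring_def ring.is_monoid\<close>)

lemma expr_value_eq:
  assumes p: "p \<in> topspace (space X)" and "expr_eq (lift_pt p) a b"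
  shows "expr_value p a = expr_value p b"
  using assms(2)
proof (induction rule: expr_eq.induct)
  interpret cring "stalk X p" using cone_cring[OF p] .
  note closed = expr_value_closed[OF p]
  note P = cone_presheaf
  {
    case (add_assoc a b c)
    then show ?case by (simp add: closed a_assoc)
  next
    case (add_comm a b)
    then show ?case by (simp add: closed a_comm)
  next
    case (mul_assoc a b c)
    then show ?case by (simp add: closed m_assoc)
  next
    case (mul_comm a b)
    then show ?case by (simp add: closed m_comm)
  next
    case (distrib a b c)
    then show ?case by (simp add: closed l_distr)
  next
    case (inverse a)
    then have "expr_value p a \<in> Units (stalk X p)" by (simp add: mem_lift_pt)
    then show ?case by (simp add: Units_closed r_minus l_neg)
  next
    case (gen_restr i U s V)
    then have g: "is_gen (cone_pt p) (i, U, s)" "is_gen (cone_pt p) (i, V, restr (D i) U V s)"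
      using is_gen_restr by simp_all
    note U = lift_gen[OF p g(1)] and V = lift_gen[OF p g(2)]
    have "preim X (\<xi> i) V \<subseteq> preim X (\<xi> i) U" using gen_restr(3) by (auto simp: preim_def)
    then show ?case
      using morphism_restr[OF cone_ringed_morphism[OF U(1)] U(2) V(2) gen_restr(3) U(3)]
        germ_restr[OF P U(4) V(4) _ V(5) U(6)] by simp
  next
    case (gen_one i U)
    then have g: "is_gen (cone_pt p) (i, U, \<one>\<^bsub>sect (D i) U\<^esub>)" by simp
    note U = lift_gen[OF p g]
    show ?case
      using ring_hom_one[OF morphism_sec[OF cone_ringed_morphism[OF U(1)] U(2)]] germ_one[OF P U(4,5)]
      by simp
  next
    case (gen_add i U s t)
    then have g: "is_gen (cone_pt p) (i, U, s)" "is_gen (cone_pt p) (i, U, t)" by simp_all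
    note U = lift_gen[OF p g(1)] and t = lift_gen[OF p g(2)]
    show ?case
      using ring_hom_add[OF morphism_sec[OF cone_ringed_morphism[OF U(1)] U(2)] U(3) t(3)]
        germ_add[OF P U(4,5,6) t(6)] by simp
  next
    case (gen_mul i U s t)
    then have g: "is_gen (cone_pt p) (i, U, s)" "is_gen (cone_pt p) (i, U, t)" by simp_all
    note U = lift_gen[OF p g(1)] and t = lift_gen[OF p g(2)]
    show ?case
      using ring_hom_mult[OF morphism_sec[OF cone_ringed_morphism[OF U(1)] U(2)] U(3) t(3)]
        germ_mult[OF P U(4,5,6) t(6)] by simp
  next
    case (gen_arrow c V s)
    then have g: "is_gen (cone_pt p) (Cod J c, V, s)" by simp
    note V = lift_gen[OF p g]
    show ?case using cone_arrow_sec[OF gen_arrow(1) V(2,3)] preim_cone_arrow[OF gen_arrow(1)] by simp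
  }
qed (use expr_value_closed[OF p] cone_cring[OF p] in \<open>simp_all add: cring.cring_simprules\<close>)

lemma lift_pt_One: "p \<in> topspace (space X) \<Longrightarrow> One \<in> snd (lift_pt p)"
  using monoid.Units_one_closed[OF ring.is_monoid[OF cring.axioms(1)[OF cone_cring]]]
  by (simp add: mem_lift_pt)

text \<open>The conditions on \<open>Zero\<close> and \<open>Add\<close> are pulled back from the
  local ring of \<open>X\<close> at \<open>p\<close>. The condition on generators is locality of the
  \<xi> \<open>i\<close>.\<close>

lemma lift_pt_limit_point:
  assumes p: "p \<in> topspace (space X)"
  shows "lift_pt p \<in> limit_points"
proof -
  interpret cring "stalk X p" using cone_cring[OF p] .
  note closed = expr_value_closed[OF p]
  have R: "\<one>\<^bsub>stalk X p\<^esub> \<noteq> \<zero>\<^bsub>stalk X p\<^esub>" "\<And>A B. \<lbrakk>A \<in> carrier (stalk X p); B \<in> carrier (stalk X p);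
      A \<oplus>\<^bsub>stalk X p\<^esub> B \<in> Units (stalk X p)\<rbrakk> \<Longrightarrow> A \<in> Units (stalk X p) \<or> B \<in> Units (stalk X p)"
    using cone_local_ring[OF p] unfolding local_ring_iff by auto
  have 1: "if i \<in> Ob J then cone_pt p i \<in> topspace (space (D i)) else cone_pt p i = undefined" for i
    using morphism_pt[OF cone_ringed_morphism p] by (simp add: cone_pt_def)
  have 2: "pt_map (\<delta> c) (cone_pt p (Dom J c)) = cone_pt p (Cod J c)" if "c \<in> Ar J" for c
    using cone_arrow_pt[OF that p] Dom_Ob[OF that] Cod_Ob[OF that] by (simp add: cone_pt_def)
  have 3: "a \<in> snd (lift_pt p) \<longleftrightarrow> (\<exists>b. expr_eq (lift_pt p) (Mul a b) One)" for a
  proof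
    assume "a \<in> snd (lift_pt p)"
    then show "\<exists>b. expr_eq (lift_pt p) (Mul a b) One"
      using inverse_expr[OF lift_pt_One[OF p]] mem_lift_pt by simp
  next
    assume "\<exists>b. expr_eq (lift_pt p) (Mul a b) One"
    then obtain b where b: "expr_eq (lift_pt p) (Mul a b) One" ..
    then have wf: "wf_expr (lift_pt p) a" "wf_expr (lift_pt p) b" using expr_eq_wf by fastforce+
    have "expr_value p a \<otimes>\<^bsub>stalk X p\<^esub> expr_value p b = \<one>\<^bsub>stalk X p\<^esub>"
      using expr_value_eq[OF p b] by simp
    then show "a \<in> snd (lift_pt p)" using wf closed Units_iff mem_lift_pt by auto
  qed
  have 4: "Zero \<notin> snd (lift_pt p)"
  proof
    assume "Zero \<in> snd (lift_pt p)"
    then have "\<zero>\<^bsub>stalk X p\<^esub> \<in> Units (stalk X p)" by (simp add: mem_lift_pt)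
    then obtain B where "B \<in> carrier (stalk X p)" "\<zero>\<^bsub>stalk X p\<^esub> \<otimes>\<^bsub>stalk X p\<^esub> B = \<one>\<^bsub>stalk X p\<^esub>"
      using Units_iff by auto
    then show False using R(1) by simp
  qed
  have 5: "a \<in> snd (lift_pt p) \<or> b \<in> snd (lift_pt p)" if "Add a b \<in> snd (lift_pt p)" for a b
    using that R(2)[OF closed closed] by (simp add: mem_lift_pt)
  have 6: "germ (D i) (cone_pt p i) U s \<in> Units (stalk (D i) (cone_pt p i))"
    if "Gen (i, U, s) \<in> snd (lift_pt p)" for i U s
  proof -
    have g: "is_gen (cone_pt p) (i, U, s)" using that by (simp add: mem_lift_pt)
    note U = lift_gen[OF p g]
    have "germ X p (preim X (\<xi> i) U) (sec_map (\<xi> i) U s) \<in> Units (stalk X p)"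
      using that by (simp add: mem_lift_pt)
    then show ?thesis
      using cone_morphism[OF U(1)] p U(1-3,5) unfolding lrs_morphism_iff
      by (simp add: preim_def cone_pt_def)
  qed
  show ?thesis
    unfolding limit_points_def mem_Collect_eq fst_lift_pt
    by (intro conjI allI ballI impI) (fact 1 2 3 4 5 6 | erule 2 5 6)+
qed

text \<open>The values of a fixed expression vary as the germs of a section: a generator gives its
  pullback along \<xi> \<open>i\<close>, and for \<open>Neg\<close> the invertibility at
  \<open>p\<close> spreads to a neighbourhood by \<open>germ_inverse_nhd\<close>. Both continuity of
  the map on points and gluing of the values depend on this.\<close>

lemma expr_value_nhd:
  assumes "p \<in> topspace (space X)" "wf_expr (lift_pt p) a"
  shows "\<exists>W t. openin (space X) W \<and> p \<in> W \<and> t \<in> carrier (sect X W) \<and>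
    (\<forall>q \<in> W. wf_expr (lift_pt q) a \<and> expr_value q a = germ X q W t)"
  using assms(2)
proof (induction a)
  note p = assms(1) and P = cone_presheaf
  let ?T = "topspace (space X)"
  interpret T: cring "sect X ?T" using cring_sect[OF P] by simp
  \<comment> \<open>Addition and multiplication both need their two arguments represented over one
    open set.\<close>
  have binary: "\<exists>W s t. openin (space X) W \<and> p \<in> W \<and> s \<in> carrier (sect X W) \<and> t \<in> carrier (sect X W) \<and>
      (\<forall>q \<in> W. wf_expr (lift_pt q) a \<and> wf_expr (lift_pt q) b \<and>
        expr_value q a = germ X q W s \<and> expr_value q b = germ X q W t)"
    if a: "\<exists>W t. openin (space X) W \<and> p \<in> W \<and> t \<in> carrier (sect X W) \<and>
        (\<forall>q \<in> W. wf_expr (lift_pt q) a \<and> expr_value q a = germ X q W t)"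
      and b: "\<exists>W t. openin (space X) W \<and> p \<in> W \<and> t \<in> carrier (sect X W) \<and>
        (\<forall>q \<in> W. wf_expr (lift_pt q) b \<and> expr_value q b = germ X q W t)" for a b
  proof -
    obtain U s where U: "openin (space X) U" "p \<in> U" "s \<in> carrier (sect X U)"
      "\<forall>q \<in> U. wf_expr (lift_pt q) a \<and> expr_value q a = germ X q U s" using a by (elim exE conjE)
    obtain V t where V: "openin (space X) V" "p \<in> V" "t \<in> carrier (sect X V)"
      "\<forall>q \<in> V. wf_expr (lift_pt q) b \<and> expr_value q b = germ X q V t" using b by (elim exE conjE)
    have W: "openin (space X) (U \<inter> V)" using U(1) V(1) by (rule openin_Int)
    show ?thesis
    proof (intro exI conjI ballI)
      show "openin (space X) (U \<inter> V)" "p \<in> U \<inter> V" using W U(2) V(2) by simp_all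
      show "restr X U (U \<inter> V) s \<in> carrier (sect X (U \<inter> V))" "restr X V (U \<inter> V) t \<in> carrier (sect X (U \<inter> V))"
        using restr_closed[OF P U(1) W _ U(3)] restr_closed[OF P V(1) W _ V(3)] by simp_all
      fix q assume q: "q \<in> U \<inter> V"
      show "wf_expr (lift_pt q) a" "wf_expr (lift_pt q) b" using q U(4) V(4) by simp_all
      show "expr_value q a = germ X q (U \<inter> V) (restr X U (U \<inter> V) s)"
        "expr_value q b = germ X q (U \<inter> V) (restr X V (U \<inter> V) t)"
        using q U(4) V(4) germ_restr[OF P U(1) W _ q U(3)] germ_restr[OF P V(1) W _ q V(3)] by simp_all
    qed
  qed
  {
    case (Gen g)
    obtain i U s where g: "g = (i, U, s)" using prod_cases3 by blast
    have gen: "is_gen (cone_pt p) (i, U, s)" using Gen by (simp add: g)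
    note U = lift_gen[OF p gen]
    have "\<forall>q \<in> preim X (\<xi> i) U. wf_expr (lift_pt q) (Gen g) \<and>
        expr_value q (Gen g) = germ X q (preim X (\<xi> i) U) (sec_map (\<xi> i) U s)"
      using U(1-3) by (simp add: g is_gen_def preim_def cone_pt_def)
    then show ?case using U(4-6) by blast
  next
    case Zero
    have "\<forall>q \<in> ?T. wf_expr (lift_pt q) Zero \<and> expr_value q Zero = germ X q ?T \<zero>\<^bsub>sect X ?T\<^esub>"
      using germ_zero[OF P] by simp
    then show ?case using p T.zero_closed openin_topspace by blast
  next
    case One
    have "\<forall>q \<in> ?T. wf_expr (lift_pt q) One \<and> expr_value q One = germ X q ?T \<one>\<^bsub>sect X ?T\<^esub>"
      using germ_one[OF P] by simp
    then show ?case using p T.one_closed openin_topspace by blast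
  next
    case (Neg a)
    then have a: "wf_expr (lift_pt p) a" "expr_value p a \<in> Units (stalk X p)" by (simp_all add: mem_lift_pt)
    obtain U s where U: "openin (space X) U" "p \<in> U" "s \<in> carrier (sect X U)"
      "\<forall>q \<in> U. wf_expr (lift_pt q) a \<and> expr_value q a = germ X q U s"
      using Neg.IH[OF a(1)] by (elim exE conjE)
    have unit: "germ X p U s \<in> Units (stalk X p)" using a(2) U(2,4) by simp
    obtain W t where W: "openin (space X) W" "p \<in> W" "W \<subseteq> U"
      "t \<in> carrier (sect X W)" and inverse: "\<And>y. y \<in> W \<Longrightarrow> germ X y U s \<in> Units (stalk X y)"
      "\<And>y. y \<in> W \<Longrightarrow> \<ominus>\<^bsub>stalk X y\<^esub> (inv\<^bsub>stalk X y\<^esub> germ X y U s) = germ X y W t"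
      by (rule germ_inverse_nhd[OF P U(1-3) unit], rule that)
    have "\<forall>q \<in> W. wf_expr (lift_pt q) (Neg a) \<and> expr_value q (Neg a) = germ X q W t"
    proof
      fix q assume q: "q \<in> W"
      show "wf_expr (lift_pt q) (Neg a) \<and> expr_value q (Neg a) = germ X q W t"
        using inverse[OF q] U(4) subsetD[OF W(3) q] by (simp add: mem_lift_pt)
    qed
    then show ?case using W by blast
  next
    case (Add a b)
    obtain W s t where W: "openin (space X) W" "p \<in> W" and st: "s \<in> carrier (sect X W)" "t \<in> carrier (sect X W)"
      and v: "\<forall>q \<in> W. wf_expr (lift_pt q) a \<and> wf_expr (lift_pt q) b \<and>
        expr_value q a = germ X q W s \<and> expr_value q b = germ X q W t"
      using binary[OF Add.IH] Add.prems by (auto simp del: split_paired_All)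
    interpret W: cring "sect X W" using cring_sect[OF P W(1)] .
    have "\<forall>q \<in> W. wf_expr (lift_pt q) (Add a b) \<and> expr_value q (Add a b) = germ X q W (s \<oplus>\<^bsub>sect X W\<^esub> t)"
      using v germ_add[OF P W(1) _ st] by simp
    then show ?case using W W.a_closed[OF st] by blast
  next
    case (Mul a b)
    obtain W s t where W: "openin (space X) W" "p \<in> W" and st: "s \<in> carrier (sect X W)" "t \<in> carrier (sect X W)"
      and v: "\<forall>q \<in> W. wf_expr (lift_pt q) a \<and> wf_expr (lift_pt q) b \<and>
        expr_value q a = germ X q W s \<and> expr_value q b = germ X q W t"
      using binary[OF Mul.IH] Mul.prems by (auto simp del: split_paired_All)
    interpret W: cring "sect X W" using cring_sect[OF P W(1)] .
    have "\<forall>q \<in> W. wf_expr (lift_pt q) (Mul a b) \<and> expr_value q (Mul a b) = germ X q W (s \<otimes>\<^bsub>sect X W\<^esub> t)"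
      using v germ_mult[OF P W(1) _ st] by simp
    then show ?case using W W.m_closed[OF st] by blast
  }
qed

text \<open>Continuity at \<open>p\<close> for basic open sets: the value of \<open>h\<close> is
  locally a section with invertible germ at \<open>p\<close>, and it stays invertible near
  \<open>p\<close>.\<close>

lemma nearby_lift:
  assumes p: "p \<in> topspace (space X)" and "nearby (lift_pt p) Q"
  shows "\<exists>W. openin (space X) W \<and> p \<in> W \<and> (\<forall>q \<in> W. Q (lift_pt q))"
proof -
  obtain h where h: "h \<in> snd (lift_pt p)" and Q: "\<And>w. w \<in> limit_points \<Longrightarrow> h \<in> snd w \<Longrightarrow> Q w"
    using assms(2) unfolding nearby_def by auto
  have "wf_expr (lift_pt p) h" and unit: "expr_value p h \<in> Units (stalk X p)" using h mem_lift_pt by simp_all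
  then obtain U s where U: "openin (space X) U" "p \<in> U" "s \<in> carrier (sect X U)"
    and v: "\<forall>q \<in> U. wf_expr (lift_pt q) h \<and> expr_value q h = germ X q U s"
    using expr_value_nhd[OF p] by blast
  have "germ X p U s \<in> Units (stalk X p)" using unit U(2) v by simp
  from germ_inverse_nhd[OF cone_presheaf U this] obtain W where W: "openin (space X) W" "p \<in> W" "W \<subseteq> U"
    and inverse: "\<And>y. y \<in> W \<Longrightarrow> germ X y U s \<in> Units (stalk X y)" by metis
  have "Q (lift_pt q)" if q: "q \<in> W" for q
  proof (rule Q)
    show "lift_pt q \<in> limit_points" using lift_pt_limit_point openin_subset[OF W(1)] q by blast
    show "h \<in> snd (lift_pt q)" using inverse[OF q] v subsetD[OF W(3) q] by (simp add: mem_lift_pt)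
  qed
  then show ?thesis using W(1,2) by blast
qed

section \<open>The induced map on sections\<close>

definition lift_value :: "('i, 'p, 's) limit_section \<Rightarrow> 'q \<Rightarrow> ('q set \<times> 't) set" where
  "lift_value \<sigma> p =
     expr_value p (SOME a. wf_expr (lift_pt p) a \<and> \<sigma> (lift_pt p) = expr_class (lift_pt p) a)"

text \<open>Two expressions for the same value of \<sigma> are equal modulo the relations and hence
  have the same value in the stalk of \<open>X\<close>.\<close>

lemma lift_value_eq:
  assumes p: "p \<in> topspace (space X)" and a: "wf_expr (lift_pt p) a" "\<sigma> (lift_pt p) = expr_class (lift_pt p) a"
  shows "lift_value \<sigma> p = expr_value p a"
proof -
  define b where "b = (SOME a. wf_expr (lift_pt p) a \<and> \<sigma> (lift_pt p) = expr_class (lift_pt p) a)"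
  have "\<exists>a. wf_expr (lift_pt p) a \<and> \<sigma> (lift_pt p) = expr_class (lift_pt p) a"
    using a by (intro exI[of _ a] conjI)
  from someI_ex[OF this] have "wf_expr (lift_pt p) b \<and> \<sigma> (lift_pt p) = expr_class (lift_pt p) b"
    unfolding b_def .
  then have "expr_eq (lift_pt p) b a" using expr_class_eq_iff[of "lift_pt p" b a] a(2) by simp
  from expr_value_eq[OF p this] show ?thesis by (simp add: lift_value_def b_def)
qed

text \<open>The pullback of \<sigma> is the section with the prescribed germs
  \<open>lift_value\<close>; its existence and uniqueness come from \<open>section_glue\<close>. The
  set comprehension is the preimage of \<open>V\<close>, written out because \<open>preim\<close>
  would refer to the map being defined.\<close>

definition lift :: "('q, 't, ('i, 'p, 's) limit_point, ('i, 'p, 's) limit_section) rs_map" where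
  "lift = \<lparr>pt_map = lift_pt, sec_map = (\<lambda>V \<sigma>. THE s.
     s \<in> carrier (sect X {p \<in> topspace (space X). lift_pt p \<in> V}) \<and>
     (\<forall>p \<in> {p \<in> topspace (space X). lift_pt p \<in> V}.
        germ X p {p \<in> topspace (space X). lift_pt p \<in> V} s = lift_value \<sigma> p))\<rparr>"

lemma pt_map_lift [simp]: "pt_map lift = lift_pt"
  by (simp add: lift_def)

lemma preim_lift: "p \<in> preim X lift V \<longleftrightarrow> p \<in> topspace (space X) \<and> lift_pt p \<in> V"
  by (simp add: preim_def)

lemma openin_preim_lift:
  assumes V: "openin limit_topology V"
  shows "openin (space X) (preim X lift V)"
proof (subst openin_subopen, intro ballI)
  fix p assume p: "p \<in> preim X lift V"
  have "nearby (lift_pt p) (\<lambda>w. w \<in> V)" using V p unfolding openin_limit preim_lift by simp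
  then obtain W where W: "openin (space X) W" "p \<in> W" "\<forall>q \<in> W. lift_pt q \<in> V"
    using nearby_lift p unfolding preim_lift by metis
  moreover have "W \<subseteq> preim X lift V" using W(3) openin_subset[OF W(1)] by (auto simp: preim_lift)
  ultimately show "\<exists>T. openin (space X) T \<and> p \<in> T \<and> T \<subseteq> preim X lift V" by blast
qed

text \<open>Near \<open>p\<close> the section \<sigma> is given by one expression \<open>a\<close>
  along the map on points, and the values of \<open>a\<close> are the germs of one section
  \<open>t\<close>; on the intersection of the two neighbourhoods \<open>t\<close> has the
  prescribed germs, so \<open>section_glue\<close> applies.\<close>

lemma
  assumes V: "openin limit_topology V" and \<sigma>: "is_section V \<sigma>"
  shows sec_map_lift_closed: "sec_map lift V \<sigma> \<in> carrier (sect X (preim X lift V))"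
    and germ_sec_map_lift: "p \<in> preim X lift V \<Longrightarrow> germ X p (preim X lift V) (sec_map lift V \<sigma>) = lift_value \<sigma> p"
proof -
  let ?U = "preim X lift V"
  have U: "openin (space X) ?U" using openin_preim_lift[OF V] .
  have "\<exists>W t. openin (space X) W \<and> p \<in> W \<and> W \<subseteq> ?U \<and> t \<in> carrier (sect X W) \<and>
      (\<forall>q \<in> W. germ X q W t = lift_value \<sigma> q)" if p: "p \<in> ?U" for p
  proof -
    have pX: "p \<in> topspace (space X)" and pV: "lift_pt p \<in> V" using p by (simp_all add: preim_lift)
    obtain a where a: "nearby (lift_pt p) (\<lambda>w. w \<in> V \<and> wf_expr w a \<and> \<sigma> w = expr_class w a)"
      using section_nearby[OF V \<sigma> pV] .
    obtain N where N: "openin (space X) N" "p \<in> N"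
      "\<forall>q \<in> N. lift_pt q \<in> V \<and> wf_expr (lift_pt q) a \<and> \<sigma> (lift_pt q) = expr_class (lift_pt q) a"
      using nearby_lift[OF pX a] by blast
    then have "wf_expr (lift_pt p) a" by simp
    then obtain M t where M: "openin (space X) M" "p \<in> M" "t \<in> carrier (sect X M)"
      "\<forall>q \<in> M. wf_expr (lift_pt q) a \<and> expr_value q a = germ X q M t"
      using expr_value_nhd[OF pX] by blast
    have W: "openin (space X) (M \<inter> N)" using M(1) N(1) by (rule openin_Int)
    show ?thesis
    proof (intro exI conjI ballI)
      show "openin (space X) (M \<inter> N)" "p \<in> M \<inter> N" using W M(2) N(2) by simp_all
      show "restr X M (M \<inter> N) t \<in> carrier (sect X (M \<inter> N))"
        using restr_closed[OF cone_presheaf M(1) W _ M(3)] by simp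
      show "M \<inter> N \<subseteq> ?U" using openin_subset[OF W] N(3) by (auto simp: preim_lift)
      fix q assume q: "q \<in> M \<inter> N"
      have "q \<in> topspace (space X)" using openin_subset[OF W] q by blast
      then have "lift_value \<sigma> q = expr_value q a" using N(3) q by (intro lift_value_eq) simp_all
      then show "germ X q (M \<inter> N) (restr X M (M \<inter> N) t) = lift_value \<sigma> q"
        using germ_restr[OF cone_presheaf M(1) W _ q M(3)] M(4) q by simp
    qed
  qed
  from section_glue[OF cone_ringed U this]
  have "\<exists>!s. s \<in> carrier (sect X ?U) \<and> (\<forall>p \<in> ?U. germ X p ?U s = lift_value \<sigma> p)" .
  from theI'[OF this] have *: "sec_map lift V \<sigma> \<in> carrier (sect X ?U) \<and>
      (\<forall>p \<in> ?U. germ X p ?U (sec_map lift V \<sigma>) = lift_value \<sigma> p)"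
    by (simp add: lift_def preim_def)
  show "sec_map lift V \<sigma> \<in> carrier (sect X ?U)" using * by simp
  show "p \<in> ?U \<Longrightarrow> germ X p ?U (sec_map lift V \<sigma>) = lift_value \<sigma> p" using * by simp
qed

text \<open>By \<open>section_eqI\<close> all identities are tested on germs. There they concern
  values of expressions, and evaluation is compatible with \<open>Mul\<close>, \<open>Add\<close>
  and \<open>One\<close> by its recursion equations.\<close>

lemma lift_ringed_morphism: "ringed_space_morphism X limit_space lift"
  unfolding ringed_space_morphism_def limit_space_simps
proof (intro conjI allI impI ballI)
  have "openin (space X) {p \<in> topspace (space X). lift_pt p \<in> V}" if "openin limit_topology V" for V
    using openin_preim_lift[OF that] by (simp add: preim_def)
  then show "continuous_map (space X) limit_topology (pt_map lift)"
    using lift_pt_limit_point by (auto simp: continuous_map)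
  fix V assume V: "openin limit_topology V"
  let ?U = "preim X lift V"
  have U: "openin (space X) ?U" using openin_preim_lift[OF V] .
  interpret U: cring "sect X ?U" using cring_sect[OF cone_presheaf U] .
  note closed = sec_map_lift_closed[OF V] and germs = germ_sec_map_lift[OF V]
  have val: "\<exists>a. wf_expr (lift_pt p) a \<and> \<sigma> (lift_pt p) = expr_class (lift_pt p) a \<and> lift_value \<sigma> p = expr_value p a"
    if \<sigma>: "is_section V \<sigma>" and p: "p \<in> ?U" for \<sigma> p
  proof -
    have pX: "p \<in> topspace (space X)" and pV: "lift_pt p \<in> V" using p by (simp_all add: preim_lift)
    obtain a where "wf_expr (lift_pt p) a" "\<sigma> (lift_pt p) = expr_class (lift_pt p) a"
      using section_value[OF V \<sigma> pV] .
    then show ?thesis using lift_value_eq[OF pX] by blast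
  qed
  note sec_eq = section_eqI[OF cone_ringed U]
  show "sec_map lift V \<in> ring_hom (section_ring V) (sect X ?U)"
  proof (rule ring_hom_memI)
    fix \<sigma> assume "\<sigma> \<in> carrier (section_ring V)"
    then have \<sigma>: "is_section V \<sigma>" by (simp add: section_ring_simps)
    show "sec_map lift V \<sigma> \<in> carrier (sect X ?U)" using closed[OF \<sigma>] .
    fix \<tau> assume "\<tau> \<in> carrier (section_ring V)"
    then have \<tau>: "is_section V \<tau>" by (simp add: section_ring_simps)
    note ops = section_ops_closed[OF V]
    show "sec_map lift V (\<sigma> \<otimes>\<^bsub>section_ring V\<^esub> \<tau>) = sec_map lift V \<sigma> \<otimes>\<^bsub>sect X ?U\<^esub> sec_map lift V \<tau>"
      unfolding section_ring_simps
    proof (rule sec_eq[OF closed[OF ops(1)[OF \<sigma> \<tau>]] U.m_closed[OF closed[OF \<sigma>] closed[OF \<tau>]]])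
      fix p assume p: "p \<in> ?U"
      then have pX: "p \<in> topspace (space X)" "lift_pt p \<in> V" by (simp_all add: preim_lift)
      obtain a where a: "wf_expr (lift_pt p) a" "\<sigma> (lift_pt p) = expr_class (lift_pt p) a"
        "lift_value \<sigma> p = expr_value p a" using val[OF \<sigma> p] by blast
      obtain b where b: "wf_expr (lift_pt p) b" "\<tau> (lift_pt p) = expr_class (lift_pt p) b"
        "lift_value \<tau> p = expr_value p b" using val[OF \<tau> p] by blast
      have "lift_value (\<lambda>z. if z \<in> V then \<sigma> z \<otimes>\<^bsub>class_ring z\<^esub> \<tau> z else {}) p = expr_value p (Mul a b)"
        using a b pX by (intro lift_value_eq) (simp_all add: class_ring_simps)
      then show "germ X p ?U (sec_map lift V (\<lambda>z. if z \<in> V then \<sigma> z \<otimes>\<^bsub>class_ring z\<^esub> \<tau> z else {})) =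
          germ X p ?U (sec_map lift V \<sigma> \<otimes>\<^bsub>sect X ?U\<^esub> sec_map lift V \<tau>)"
        using germs[OF ops(1)[OF \<sigma> \<tau>] p] germs[OF \<sigma> p] germs[OF \<tau> p] a(3) b(3)
          germ_mult[OF cone_presheaf U p closed[OF \<sigma>] closed[OF \<tau>]] by simp
    qed
    show "sec_map lift V (\<sigma> \<oplus>\<^bsub>section_ring V\<^esub> \<tau>) = sec_map lift V \<sigma> \<oplus>\<^bsub>sect X ?U\<^esub> sec_map lift V \<tau>"
      unfolding section_ring_simps
    proof (rule sec_eq[OF closed[OF ops(2)[OF \<sigma> \<tau>]] U.a_closed[OF closed[OF \<sigma>] closed[OF \<tau>]]])
      fix p assume p: "p \<in> ?U"
      then have pX: "p \<in> topspace (space X)" "lift_pt p \<in> V" by (simp_all add: preim_lift)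
      obtain a where a: "wf_expr (lift_pt p) a" "\<sigma> (lift_pt p) = expr_class (lift_pt p) a"
        "lift_value \<sigma> p = expr_value p a" using val[OF \<sigma> p] by blast
      obtain b where b: "wf_expr (lift_pt p) b" "\<tau> (lift_pt p) = expr_class (lift_pt p) b"
        "lift_value \<tau> p = expr_value p b" using val[OF \<tau> p] by blast
      have "lift_value (\<lambda>z. if z \<in> V then \<sigma> z \<oplus>\<^bsub>class_ring z\<^esub> \<tau> z else {}) p = expr_value p (Add a b)"
        using a b pX by (intro lift_value_eq) (simp_all add: class_ring_simps)
      then show "germ X p ?U (sec_map lift V (\<lambda>z. if z \<in> V then \<sigma> z \<oplus>\<^bsub>class_ring z\<^esub> \<tau> z else {})) =
          germ X p ?U (sec_map lift V \<sigma> \<oplus>\<^bsub>sect X ?U\<^esub> sec_map lift V \<tau>)"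
        using germs[OF ops(2)[OF \<sigma> \<tau>] p] germs[OF \<sigma> p] germs[OF \<tau> p] a(3) b(3)
          germ_add[OF cone_presheaf U p closed[OF \<sigma>] closed[OF \<tau>]] by simp
    qed
  next
    note one = section_ops_closed(3)[OF V]
    show "sec_map lift V \<one>\<^bsub>section_ring V\<^esub> = \<one>\<^bsub>sect X ?U\<^esub>"
      unfolding section_ring_simps
    proof (rule sec_eq[OF closed[OF one] U.one_closed])
      fix p assume p: "p \<in> ?U"
      then have pX: "p \<in> topspace (space X)" "lift_pt p \<in> V" by (simp_all add: preim_lift)
      have "lift_value (\<lambda>z. if z \<in> V then \<one>\<^bsub>class_ring z\<^esub> else {}) p = expr_value p One"
        using pX by (intro lift_value_eq) (simp_all add: class_ring_simps)
      then show "germ X p ?U (sec_map lift V (\<lambda>z. if z \<in> V then \<one>\<^bsub>class_ring z\<^esub> else {})) =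
          germ X p ?U \<one>\<^bsub>sect X ?U\<^esub>"
        using germs[OF one p] germ_one[OF cone_presheaf U p] by simp
    qed
  qed
  fix V' \<sigma> assume V': "openin limit_topology V'" "V' \<subseteq> V" and "\<sigma> \<in> carrier (section_ring V)"
  then have \<sigma>: "is_section V \<sigma>" by (simp add: section_ring_simps)
  let ?U' = "preim X lift V'" and ?\<sigma>' = "\<lambda>z. if z \<in> V' then \<sigma> z else {}"
  have U': "openin (space X) ?U'" using openin_preim_lift[OF V'(1)] .
  have sub: "?U' \<subseteq> ?U" using V'(2) by (auto simp: preim_lift)
  note \<sigma>' = section_restr[OF V V' \<sigma>]
  show "sec_map lift V' ?\<sigma>' = restr X ?U ?U' (sec_map lift V \<sigma>)"
  proof (rule section_eqI[OF cone_ringed U' sec_map_lift_closed[OF V'(1) \<sigma>']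
        restr_closed[OF cone_presheaf U U' sub closed[OF \<sigma>]]])
    fix p assume p: "p \<in> ?U'"
    have pV: "p \<in> topspace (space X)" "lift_pt p \<in> V'" using p by (simp_all add: preim_lift)
    obtain a where a: "wf_expr (lift_pt p) a" "\<sigma> (lift_pt p) = expr_class (lift_pt p) a"
      "lift_value \<sigma> p = expr_value p a" using val[OF \<sigma> subsetD[OF sub p]] by blast
    have "lift_value ?\<sigma>' p = expr_value p a" using a pV by (intro lift_value_eq) simp_all
    then show "germ X p ?U' (sec_map lift V' ?\<sigma>') = germ X p ?U' (restr X ?U ?U' (sec_map lift V \<sigma>))"
      using germ_sec_map_lift[OF V'(1) \<sigma>' p] germs[OF \<sigma> subsetD[OF sub p]] a(3)
        germ_restr[OF cone_presheaf U U' sub p closed[OF \<sigma>]] by simp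
  qed
qed

text \<open>Locality holds because the units at \<open>lift_pt p\<close> were taken to be all
  expressions with invertible value.\<close>

lemma lift_morphism: "lrs_morphism X limit_space lift"
  unfolding lrs_morphism_iff limit_space_simps section_ring_simps pt_map_lift
proof (intro conjI ballI allI impI cone_lrs locally_ringed_limit_space lift_ringed_morphism)
  fix p V \<sigma>
  assume p: "p \<in> topspace (space X)" and V: "openin limit_topology V" "lift_pt p \<in> V" and \<sigma>: "is_section V \<sigma>"
    and unit: "germ X p (preim X lift V) (sec_map lift V \<sigma>) \<in> Units (stalk X p)"
  obtain a where a: "wf_expr (lift_pt p) a" "\<sigma> (lift_pt p) = expr_class (lift_pt p) a"
    using section_value[OF V(1) \<sigma> V(2)] .
  have "a \<in> snd (lift_pt p)"
    using unit germ_sec_map_lift[OF V(1) \<sigma>] p V(2) lift_value_eq[where \<sigma> = \<sigma>, OF p a] a(1)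
    by (simp add: preim_lift mem_lift_pt)
  then show "germ limit_space (lift_pt p) V \<sigma> \<in> Units (stalk limit_space (lift_pt p))"
    using expr_germ_eqI[OF lift_pt_limit_point[OF p] a(1) V(1) \<sigma> V(2) a(2)]
      expr_germ_unit_iff[OF lift_pt_limit_point[OF p] a(1)] by simp
qed

section \<open>Compatibility with the projections and uniqueness\<close>

lemma lift_commutes:
  assumes i: "i \<in> Ob J"
  shows "morphism_eq X (D i) (comp_morphism limit_space (projection i) lift) (\<xi> i)"
  unfolding morphism_eq_def comp_morphism_def
proof (simp add: i cone_pt_def, intro allI impI ballI)
  fix V s assume V: "openin (space (D i)) V" and s: "s \<in> carrier (sect (D i) V)"
  let ?g = "Gen (i, V, s)"
  have dom: "preim limit_space (projection i) V = expr_domain ?g" using expr_domain_gen[OF i V s] by simp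
  have pre: "preim X lift (expr_domain ?g) = preim X (\<xi> i) V"
    unfolding dom[symmetric] using lift_pt_limit_point by (auto simp: preim_def cone_pt_def i)
  have U: "openin (space X) (preim X (\<xi> i) V)"
    using openin_preim[OF cone_ringed_morphism[OF i] V] .
  note sec = sec_map_lift_closed[OF openin_expr_domain is_section_expr, of ?g]
    and germs = germ_sec_map_lift[OF openin_expr_domain is_section_expr, of _ ?g]
  have "sec_map lift (expr_domain ?g) (expr_section ?g) = sec_map (\<xi> i) V s"
  proof (rule section_eqI[OF cone_ringed U])
    show "sec_map lift (expr_domain ?g) (expr_section ?g) \<in> carrier (sect X (preim X (\<xi> i) V))"
      using sec unfolding pre .
    show "sec_map (\<xi> i) V s \<in> carrier (sect X (preim X (\<xi> i) V))"
      using ring_hom_closed[OF morphism_sec[OF cone_ringed_morphism[OF i] V] s] .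
    fix p assume p: "p \<in> preim X (\<xi> i) V"
    then have pX: "p \<in> topspace (space X)" and wf: "wf_expr (lift_pt p) ?g"
      using i V s by (simp_all add: preim_def is_gen_def cone_pt_def)
    have "lift_value (expr_section ?g) p = expr_value p ?g"
      using lift_value_eq[OF pX wf] expr_section_value[OF lift_pt_limit_point[OF pX] wf] by simp
    then show "germ X p (preim X (\<xi> i) V) (sec_map lift (expr_domain ?g) (expr_section ?g)) =
        germ X p (preim X (\<xi> i) V) (sec_map (\<xi> i) V s)"
      using germs[of p] p unfolding pre by simp
  qed
  then show "sec_map lift (preim limit_space (projection i) V) (expr_section ?g) = sec_map (\<xi> i) V s"
    unfolding dom .
qed

text \<open>Every germ of the limit is that of an expression, and compatibility with the projections
  fixes the images of the generators. Induction on expressions then fixes the maps on stalks, from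
  which both the sets of units of the points and the pullbacks of sections are recovered.\<close>

lemma lift_unique:
  assumes v: "lrs_morphism X limit_space v"
    and comm: "\<And>i. i \<in> Ob J \<Longrightarrow> morphism_eq X (D i) (comp_morphism limit_space (projection i) v) (\<xi> i)"
  shows "morphism_eq X limit_space lift v"
proof -
  have vr: "ringed_space_morphism X limit_space v" using v by (simp add: lrs_morphism_def)
  have comm_pt: "fst (pt_map v p) i = pt_map (\<xi> i) p" if "i \<in> Ob J" "p \<in> topspace (space X)" for i p
    using comm[OF that(1)] that(2) by (simp add: morphism_eq_def comp_morphism_def)
  have comm_sec: "sec_map v (preim limit_space (projection i) V) (expr_section (Gen (i, V, s))) = sec_map (\<xi> i) V s"
    if "i \<in> Ob J" "openin (space (D i)) V" "s \<in> carrier (sect (D i) V)" for i V s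
    using comm[OF that(1)] that(2,3) by (simp add: morphism_eq_def comp_morphism_def)
  have vz: "pt_map v p \<in> limit_points" if "p \<in> topspace (space X)" for p
    using morphism_pt[OF vr that] by simp
  note sm = stalk_map_germ[OF cone_presheaf presheaf_limit_space vr]
  \<comment> \<open>Well-formedness at \<open>pt_map v p\<close> depends on its set of units, which
    is not yet known to be that of \<open>lift_pt p\<close>. It is therefore compared in the same
    induction as the values.\<close>
  have vals: "(wf_expr (pt_map v p) a \<longleftrightarrow> wf_expr (lift_pt p) a) \<and>
      (wf_expr (pt_map v p) a \<longrightarrow> stalk_map X v p (expr_germ (pt_map v p) a) = expr_value p a)"
    (is "?wf a \<and> ?val a") and units: "\<And>b. wf_expr (pt_map v p) b \<Longrightarrow>
      b \<in> snd (pt_map v p) \<longleftrightarrow> stalk_map X v p (expr_germ (pt_map v p) b) \<in> Units (stalk X p)"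
    if p: "p \<in> topspace (space X)" for p a
  proof -
    let ?z = "pt_map v p"
    note z = vz[OF p]
    note h = stalk_map_hom[OF cone_presheaf presheaf_limit_space vr p]
    interpret L: cring "stalk limit_space ?z" using cring_limit_stalk[OF z] .
    interpret S: cring "stalk X p" using cone_cring[OF p] .
    show units: "b \<in> snd ?z \<longleftrightarrow> stalk_map X v p (expr_germ ?z b) \<in> Units (stalk X p)"
      if b: "wf_expr ?z b" for b
    proof
      assume "b \<in> snd ?z"
      then show "stalk_map X v p (expr_germ ?z b) \<in> Units (stalk X p)"
        using ring_hom_Units[OF L.is_cring S.is_cring h] expr_germ_unit_iff[OF z b] by simp
    next
      assume "stalk_map X v p (expr_germ ?z b) \<in> Units (stalk X p)"
      moreover have "local_ring_hom (stalk limit_space ?z) (stalk X p) (stalk_map X v p)"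
        using v p by (simp add: lrs_morphism_def)
      ultimately have "expr_germ ?z b \<in> Units (stalk limit_space ?z)"
        using local_ring_hom_iff[OF locally_ringed_spaceD(3)[OF locally_ringed_limit_space] cone_local_ring[OF p]]
          expr_germ_closed[OF z b] z by simp
      then show "b \<in> snd ?z" using expr_germ_unit_iff[OF z b] by simp
    qed
    show "?wf a \<and> ?val a"
    proof (induction a)
      case (Gen g)
      obtain i U s where g: "g = (i, U, s)" using prod_cases3 by blast
      have wf: "?wf (Gen g)" using comm_pt[OF _ p] by (auto simp: g is_gen_def cone_pt_def)
      moreover have "?val (Gen g)"
      proof
        assume a: "wf_expr ?z (Gen g)"
        then have gen: "i \<in> Ob J" "openin (space (D i)) U" "s \<in> carrier (sect (D i) U)"
          by (simp_all add: g is_gen_def)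
        have pre: "preim X v (preim limit_space (projection i) U) = preim X (\<xi> i) U"
          using comm_pt[OF gen(1)] vz by (auto simp: preim_def)
        have "stalk_map X v p (expr_germ ?z (Gen g)) =
            germ X p (preim X v (expr_domain (Gen g))) (sec_map v (expr_domain (Gen g)) (expr_section (Gen g)))"
          unfolding expr_germ_def
          by (rule sm[OF p]) (simp_all add: openin_expr_domain mem_expr_domain[OF z a] section_ring_simps is_section_expr)
        then show "stalk_map X v p (expr_germ ?z (Gen g)) = expr_value p (Gen g)"
          using comm_sec[OF gen] pre by (simp add: g expr_domain_gen[OF gen])
      qed
      ultimately show ?case ..
    next
      case Zero
      then show ?case
        using expr_germ_Zero[OF z] ring_hom_zero[OF h L.ring_axioms S.ring_axioms] by simp
    next
      case One
      then show ?case using expr_germ_One[OF z] ring_hom_one[OF h] by simp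
    next
      case (Neg a)
      \<comment> \<open>Here locality of \<open>v\<close> enters: \<open>a\<close> is a unit at
        \<open>pt_map v p\<close> exactly if its image in the stalk of \<open>X\<close> is
        invertible, and by the induction hypothesis this is the condition at
        \<open>lift_pt p\<close>.\<close>
      have "?wf (Neg a)" using Neg units[of a] by (auto simp: mem_lift_pt)
      moreover have "?val (Neg a)"
      proof
        assume n: "wf_expr ?z (Neg a)"
        then have a: "wf_expr ?z a" "a \<in> snd ?z" by simp_all
        \<comment> \<open>The relation that defines \<open>Neg a\<close> is carried to the stalk of
          \<open>X\<close>, where \<open>minus_inverse_unique\<close> solves it for the image of
          \<open>Neg a\<close>.\<close>
        have "expr_germ ?z (Add (Mul a (Neg a)) One) = expr_germ ?z Zero"
          using expr_eq.inverse[OF a] expr_germ_eq_iff[OF z] n by simp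
        then have "expr_germ ?z a \<otimes>\<^bsub>stalk limit_space ?z\<^esub> expr_germ ?z (Neg a)
            \<oplus>\<^bsub>stalk limit_space ?z\<^esub> \<one>\<^bsub>stalk limit_space ?z\<^esub> = \<zero>\<^bsub>stalk limit_space ?z\<^esub>"
          using a n expr_germ_mult[OF z a(1) n] expr_germ_add[OF z, of "Mul a (Neg a)" One]
            expr_germ_One[OF z] expr_germ_Zero[OF z] by simp
        then have "stalk_map X v p (expr_germ ?z a \<otimes>\<^bsub>stalk limit_space ?z\<^esub> expr_germ ?z (Neg a)
            \<oplus>\<^bsub>stalk limit_space ?z\<^esub> \<one>\<^bsub>stalk limit_space ?z\<^esub>) = \<zero>\<^bsub>stalk X p\<^esub>"
          using ring_hom_zero[OF h L.ring_axioms S.ring_axioms] by simp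
        then have "stalk_map X v p (expr_germ ?z a) \<otimes>\<^bsub>stalk X p\<^esub> stalk_map X v p (expr_germ ?z (Neg a))
            \<oplus>\<^bsub>stalk X p\<^esub> \<one>\<^bsub>stalk X p\<^esub> = \<zero>\<^bsub>stalk X p\<^esub>"
          using expr_germ_closed[OF z a(1)] expr_germ_closed[OF z n]
          by (simp add: ring_hom_add[OF h] ring_hom_mult[OF h] ring_hom_one[OF h])
        then have "stalk_map X v p (expr_germ ?z (Neg a)) =
            \<ominus>\<^bsub>stalk X p\<^esub> (inv\<^bsub>stalk X p\<^esub> stalk_map X v p (expr_germ ?z a))"
          using units[OF a(1)] a(2) ring_hom_closed[OF h expr_germ_closed[OF z n]]
          by (intro S.minus_inverse_unique) simp_all
        then show "stalk_map X v p (expr_germ ?z (Neg a)) = expr_value p (Neg a)" using Neg a(1) by simp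
      qed
      ultimately show ?case ..
    next
      case (Add a b)
      then show ?case
        using expr_germ_add[OF z, of a b, symmetric] expr_germ_closed[OF z] by (auto simp: ring_hom_add[OF h])
    next
      case (Mul a b)
      then show ?case
        using expr_germ_mult[OF z, of a b, symmetric] expr_germ_closed[OF z] by (auto simp: ring_hom_mult[OF h])
    qed
  qed
  have pt: "pt_map v p = lift_pt p" if p: "p \<in> topspace (space X)" for p
  proof (rule prod_eqI)
    \<comment> \<open>Both families are \<open>undefined\<close> off \<open>Ob J\<close>, so
      agreement at the objects is equality of functions.\<close>
    show "fst (pt_map v p) = fst (lift_pt p)"
      using comm_pt[OF _ p] limit_point_undefined[OF vz[OF p]] by (auto simp: cone_pt_def fun_eq_iff)
    have "a \<in> snd (pt_map v p) \<longleftrightarrow> a \<in> snd (lift_pt p)" for a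
      using vals[OF p, of a] units[OF p, of a] limit_point_wf[OF vz[OF p], of a] mem_lift_pt by metis
    then show "snd (pt_map v p) = snd (lift_pt p)" by blast
  qed
  have "sec_map lift V \<sigma> = sec_map v V \<sigma>" if V: "openin limit_topology V" and \<sigma>: "is_section V \<sigma>" for V \<sigma>
  proof -
    have pre: "preim X v V = preim X lift V" using pt by (auto simp: preim_def)
    have \<sigma>': "\<sigma> \<in> carrier (sect limit_space V)" and V': "openin (space limit_space) V"
      using \<sigma> V by (simp_all add: section_ring_simps)
    show ?thesis
    proof (rule section_eqI[OF cone_ringed openin_preim_lift[OF V] sec_map_lift_closed[OF V \<sigma>]])
      show "sec_map v V \<sigma> \<in> carrier (sect X (preim X lift V))"
        using ring_hom_closed[OF morphism_sec[OF vr V'] \<sigma>'] unfolding pre .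
      fix p assume "p \<in> preim X lift V"
      then have p: "p \<in> topspace (space X)" "lift_pt p \<in> V" "p \<in> preim X lift V" by (simp_all add: preim_lift)
      obtain a where a: "wf_expr (lift_pt p) a" "\<sigma> (lift_pt p) = expr_class (lift_pt p) a"
        using section_value[OF V \<sigma> p(2)] .
      have "germ X p (preim X lift V) (sec_map v V \<sigma>) = stalk_map X v p (germ limit_space (lift_pt p) V \<sigma>)"
        using sm[OF p(1) V' _ \<sigma>'] p(2) unfolding pre pt[OF p(1)] by simp
      also have "\<dots> = stalk_map X v p (expr_germ (lift_pt p) a)"
        using expr_germ_eqI[OF lift_pt_limit_point[OF p(1)] a(1) V \<sigma> p(2) a(2)] by simp
      also have "\<dots> = expr_value p a" using vals[OF p(1), of a] a(1) unfolding pt[OF p(1)] by simp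
      also have "\<dots> = germ X p (preim X lift V) (sec_map lift V \<sigma>)"
        using germ_sec_map_lift[OF V \<sigma> p(3)] lift_value_eq[where \<sigma> = \<sigma>, OF p(1) a] by simp
      finally show "germ X p (preim X lift V) (sec_map lift V \<sigma>) = germ X p (preim X lift V) (sec_map v V \<sigma>)"
        by simp
    qed
  qed
  then show ?thesis using pt unfolding morphism_eq_def by (simp add: section_ring_simps)
qed

end

text \<open>Neither \<open>limit_space\<close> nor \<open>projection\<close> depends on the types
  \<open>'q\<close> and \<open>'t\<close> of the test spaces, so one and the same cone has the
  universal property for every choice of these types.\<close>

lemma (in lrs_diagram) limit_space_is_limit:
  "lrs_limit TYPE('q \<times> 't) J D \<delta> limit_space projection"
  unfolding lrs_limit_def
proof (intro conjI limit_cone allI impI)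
  fix X :: "('q, 't) ringed_space" and \<xi>
  assume "lrs_cone J D \<delta> X \<xi>"
  then interpret lrs_diagram_cone J D \<delta> X \<xi> by unfold_locales
  show "\<exists>u. lrs_morphism X limit_space u \<and>
      (\<forall>i \<in> Ob J. morphism_eq X (D i) (comp_morphism limit_space (projection i) u) (\<xi> i)) \<and>
      (\<forall>v. lrs_morphism X limit_space v \<and>
        (\<forall>i \<in> Ob J. morphism_eq X (D i) (comp_morphism limit_space (projection i) v) (\<xi> i)) \<longrightarrow>
        morphism_eq X limit_space u v)"
    using lift_morphism lift_commutes lift_unique by blast
qed

text \<open>The first conjunct tests \<open>L\<close> against spaces on its own types, which
  characterizes it up to isomorphism among these; the second tests the same \<open>L\<close> against
  spaces on arbitrary types.\<close>

theorem corollary5: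
  fixes J :: "('i, 'j) cat"
    and D :: "'i \<Rightarrow> ('p, 's) ringed_space"
    and \<delta> :: "'j \<Rightarrow> ('p, 's, 'p, 's) rs_map"
  assumes "small_category J"
    and "lrs_functor J D \<delta>"
  shows "\<exists>(L :: (('i, 'p, 's) limit_point, ('i, 'p, 's) limit_section) ringed_space) \<pi>.
           lrs_limit TYPE(('i, 'p, 's) limit_point \<times> ('i, 'p, 's) limit_section) J D \<delta> L \<pi> \<and>
           lrs_limit TYPE('q \<times> 't) J D \<delta> L \<pi>"
proof -
  interpret lrs_diagram J D \<delta> using assms by unfold_locales
  show ?thesis by (intro exI conjI) (rule limit_space_is_limit)+
qed

end
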